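(* Let $(\boldsymbol{x},\boldsymbol{\nu}_1,\boldsymbol{\nu}_2):U\to H^3\times\Delta_5$ be a hyperbolic generalized framed surface with basic invariants $a_i,b_i,c_i,e_i,f_i,g_i$, $i=1,2$, and write $\boldsymbol{a}=(a_1\ a_2)^T$, $\boldsymbol{b}=(b_1\ b_2)^T$, $\boldsymbol{c}=(c_1\ c_2)^T$. Let $\boldsymbol{p}=(u_0,v_0)\in U$ be a singular point of $\boldsymbol{x}$, that is, $\alpha(u_0,v_0)=\det(\boldsymbol{b}\ \boldsymbol{c})(u_0,v_0)=0$ and $\beta(u_0,v_0)=\det(\boldsymbol{c}\ \boldsymbol{a})(u_0,v_0)=0$. Define $\varphi=\det(\boldsymbol{x},\xi\boldsymbol{x},\eta\boldsymbol{x},\eta\eta\boldsymbol{x}):U\to\mathbb{R}$, where $\xi=c_1\,\partial/\partial u+c_2\,\partial/\partial v$ and $\eta=c_2\,\partial/\partial u-c_1\,\partial/\partial v$, and $\det\mathrm{Hess}\,\varphi=\varphi_{uu}\varphi_{vv}-\varphi_{uv}^2$. Then: (1) $\boldsymbol{p}$ is a cross cap singular point of $\boldsymbol{x}$ if and only if $(a_1,a_2,b_1,b_2)(u_0,v_0)=(0,0,0,0)$, $(c_1,c_2)(u_0,v_0)\neq(0,0)$ and $$\bigl(\det(\boldsymbol{b}_u\ \boldsymbol{c})\det(\boldsymbol{a}_v\ \boldsymbol{c})-\det(\boldsymbol{b}_v\ \boldsymbol{c})\det(\boldsymbol{a}_u\ \boldsymbol{c})\bigr)(u_0,v_0)\neq0.$$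 (2) $\boldsymbol{p}$ is an $S_1^+$ singular point of $\boldsymbol{x}$ if and only if $(a_1,a_2,b_1,b_2)(u_0,v_0)=(0,0,0,0)$, $(c_1,c_2)(u_0,v_0)\neq(0,0)$, $$\bigl(\det(\boldsymbol{b}_u\ \boldsymbol{c})\det(\boldsymbol{a}_v\ \boldsymbol{c})-\det(\boldsymbol{b}_v\ \boldsymbol{c})\det(\boldsymbol{a}_u\ \boldsymbol{c})\bigr)(u_0,v_0)=0,$$ $\det\mathrm{Hess}\,\varphi(u_0,v_0)<0$ and $$\bigl(-c_1\det(\boldsymbol{a}_v\ \boldsymbol{c})+c_2\det(\boldsymbol{a}_u\ \boldsymbol{c}),\ c_2\det(\boldsymbol{b}_u\ \boldsymbol{c})-c_1\det(\boldsymbol{b}_v\ \boldsymbol{c})\bigr)(u_0,v_0)\neq(0,0).$$ (3) $\boldsymbol{p}$ is an $S_1^-$ singular point of $\boldsymbol{x}$ if and only if $(a_1,a_2,b_1,b_2)(u_0,v_0)=(0,0,0,0)$, $(c_1,c_2)(u_0,v_0)\neq(0,0)$, $$\bigl(\det(\boldsymbol{b}_u\ \boldsymbol{c})\det(\boldsymbol{a}_v\ \boldsymbol{c})-\det(\boldsymbol{b}_v\ \boldsymbol{c})\det(\boldsymbol{a}_u\ \boldsymbol{c})\bigr)(u_0,v_0)=0$$ and $\det\mathrm{Hess}\,\varphi(u_0,v_0)>0$.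
   Context: $\mathbb{R}^4_1$ is $\mathbb{R}^4$ with the pseudo inner product $\langle \boldsymbol{x},\boldsymbol{y}\rangle=-x_1y_1+x_2y_2+x_3y_3+x_4y_4$. The pseudo vector product $\boldsymbol{x}\wedge\boldsymbol{y}\wedge\boldsymbol{z}$ of three vectors of $\mathbb{R}^4_1$ is the unique vector with $\langle \boldsymbol{w},\boldsymbol{x}\wedge\boldsymbol{y}\wedge\boldsymbol{z}\rangle=\det(\boldsymbol{w},\boldsymbol{x},\boldsymbol{y},\boldsymbol{z})$ for all $\boldsymbol{w}\in\mathbb{R}^4_1$. $H^3=\{\boldsymbol{x}\in\mathbb{R}^4_1: \langle\boldsymbol{x},\boldsymbol{x}\rangle=-1,\ x_1>0\}$, $S^3_1=\{\boldsymbol{x}\in\mathbb{R}^4_1:\langle\boldsymbol{x},\boldsymbol{x}\rangle=1\}$, $\Delta_5=\{(\boldsymbol{\nu}_1,\boldsymbol{\nu}_2)\in S^3_1\times S^3_1:\langle\boldsymbol{\nu}_1,\boldsymbol{\nu}_2\rangle=0\}$. $U$ is a simply connected open subset of $\mathbb{R}^2$ with coordinates $(u,v)$; subscripts $u,v$ denote partial derivatives; all maps are $C^\infty$. Hyperbolic generalized framed surface: a smooth map $(\boldsymbol{x},\boldsymbol{\nu}_1,\boldsymbol{\nu}_2):U\to H^3\times\Delta_5$ with $\langle\boldsymbol{x},\boldsymbol{\nu}_1\rangle=\langle\boldsymbol{x},\boldsymbol{\nu}_2\rangle=0$ on $U$ for which there are smooth functions $\alpha,\beta:U\to\mathbb{R}$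 with $\boldsymbol{x}\wedge\boldsymbol{x}_u\wedge\boldsymbol{x}_v=\alpha\boldsymbol{\nu}_1+\beta\boldsymbol{\nu}_2$ on $U$. With $\boldsymbol{\nu}_3=\boldsymbol{x}\wedge\boldsymbol{\nu}_1\wedge\boldsymbol{\nu}_2$, its basic invariants are the smooth functions given by $\boldsymbol{x}_u=a_1\boldsymbol{\nu}_1+b_1\boldsymbol{\nu}_2+c_1\boldsymbol{\nu}_3$, $\boldsymbol{\nu}_{1u}=a_1\boldsymbol{x}+e_1\boldsymbol{\nu}_2+f_1\boldsymbol{\nu}_3$, $\boldsymbol{\nu}_{2u}=b_1\boldsymbol{x}-e_1\boldsymbol{\nu}_1+g_1\boldsymbol{\nu}_3$, $\boldsymbol{\nu}_{3u}=c_1\boldsymbol{x}-f_1\boldsymbol{\nu}_1-g_1\boldsymbol{\nu}_2$, and the same formulas with $u$ replaced by $v$ and index $1$ by $2$. One has $a_1b_2-a_2b_1=0$, $\alpha=\det(\boldsymbol{b}\ \boldsymbol{c})$, $\beta=\det(\boldsymbol{c}\ \boldsymbol{a})$. For a vector field $\zeta$ on $U$, $\zeta\boldsymbol{x}$ denotes the derivative of $\boldsymbol{x}$ (as an $\mathbb{R}^4$-valued map) along $\zeta$, and $\eta\eta\boldsymbol{x}=\eta(\eta\boldsymbol{x})$. The point $\boldsymbol{p}$ is a cross cap singular point (respectively $S_1^{\pm}$ singular point) of $\boldsymbol{x}$ if the germ of $\boldsymbol{x}:U\to H^3$ at $\boldsymbol{p}$ is $\mathcal{A}$-equivalent (equivalent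 under germs of diffeomorphisms of source and target) to the germ at the origin of $(u,v)\mapsto(u,v^2,uv)$ (respectively $(u,v)\mapsto(u,v^2,v(u^2\pm v^2))$) into $\mathbb{R}^3$. *)

theory Defs
  imports "HOL-Analysis.Analysis"
begin

section \<open>Smooth maps\<close>

primrec higher_differentiable_on ::
    "'a::real_normed_vector set \<Rightarrow> nat \<Rightarrow> ('a \<Rightarrow> 'b::real_normed_vector) \<Rightarrow> bool" where
  "higher_differentiable_on S 0 f \<longleftrightarrow> continuous_on S f"
| "higher_differentiable_on S (Suc k) f \<longleftrightarrow>
     (\<forall>z\<in>S. f differentiable (at z)) \<and>
     (\<forall>v. higher_differentiable_on S k (\<lambda>z. frechet_derivative f (at z) v))"

text \<open>
  On an arbitrary subset of a normed space, smoothness means local extendability to a smooth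
  map on an open set. For open sets this is the usual notion (\<open>smooth_on_open_iff\<close> below), and
  for relatively open subsets of an embedded submanifold, such as hyperbolic space in
  Minkowski space, it is smoothness with respect to the manifold structure.
\<close>

definition smooth_on ::
    "'a::real_normed_vector set \<Rightarrow> ('a \<Rightarrow> 'b::real_normed_vector) \<Rightarrow> bool" where
  "smooth_on S f \<longleftrightarrow>
     (\<forall>z\<in>S. \<exists>N F. open N \<and> z \<in> N \<and> (\<forall>k. higher_differentiable_on N k F) \<and>
                (\<forall>y\<in>N \<inter> S. F y = f y))"

lemma frechet_derivative_cong_open:
  assumes "open N" "z \<in> N" "\<And>y. y \<in> N \<Longrightarrow> F y = f y"
  shows "frechet_derivative F (at z) = frechet_derivative f (at z)"
proof -
  have "(F has_derivative D) (at z) \<longleftrightarrow> (f has_derivative D) (at z)" for D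
    using assms by (metis has_derivative_transform_within_open)
  then show ?thesis
    by (simp add: frechet_derivative_def)
qed

lemma higher_differentiable_on_local:
  assumes "\<And>z. z \<in> S \<Longrightarrow> \<exists>N F. open N \<and> z \<in> N \<and> higher_differentiable_on N k F \<and>
                (\<forall>y\<in>N. F y = f y)"
  shows "higher_differentiable_on S k f"
  using assms
proof (induction k arbitrary: f)
  case 0
  have "isCont f z" if z: "z \<in> S" for z
  proof -
    obtain N F where N: "open N" "z \<in> N" "continuous_on N F" "\<forall>y\<in>N. F y = f y"
      using 0[OF z] by auto
    then have "continuous_on N f" by (metis continuous_on_cong)
    then show ?thesis using N continuous_on_eq_continuous_at by blast
  qed
  then show ?case by (simp add: continuous_at_imp_continuous_on)
next
  case (Suc k)
  have "f differentiable (at z)" if z: "z \<in> S" for z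
  proof -
    obtain N F where N: "open N" "z \<in> N" "\<forall>y\<in>N. F differentiable (at y)" "\<forall>y\<in>N. F y = f y"
      using Suc.prems[OF z] by auto
    then show ?thesis
      unfolding differentiable_def by (metis has_derivative_transform_within_open)
  qed
  moreover have "higher_differentiable_on S k (\<lambda>z. frechet_derivative f (at z) v)" for v
  proof (rule Suc.IH)
    fix z assume "z \<in> S"
    then obtain N F where N: "open N" "z \<in> N" "higher_differentiable_on N (Suc k) F"
        "\<forall>y\<in>N. F y = f y"
      using Suc.prems by blast
    then have "\<forall>y\<in>N. frechet_derivative F (at y) v = frechet_derivative f (at y) v"
      using frechet_derivative_cong_open by metis
    with N show "\<exists>N F. open N \<and> z \<in> N \<and> higher_differentiable_on N k F \<and>
                   (\<forall>y\<in>N. F y = frechet_derivative f (at y) v)"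
      by (intro exI[of _ N] exI[of _ "\<lambda>y. frechet_derivative F (at y) v"]) auto
  qed
  ultimately show ?case by simp
qed

lemma smooth_on_open_iff:
  assumes "open S"
  shows "smooth_on S f \<longleftrightarrow> (\<forall>k. higher_differentiable_on S k f)"
proof
  assume L: "smooth_on S f"
  show "\<forall>k. higher_differentiable_on S k f"
  proof (intro allI higher_differentiable_on_local)
    fix k z assume "z \<in> S"
    then obtain N F where N: "open N" "z \<in> N" "\<forall>k. higher_differentiable_on N k F"
        "\<forall>y\<in>N \<inter> S. F y = f y"
      using L unfolding smooth_on_def by blast
    have sub: "higher_differentiable_on (N \<inter> S) k G" if "higher_differentiable_on N k G"
      for k and G :: "'a \<Rightarrow> 'b"
      using that by (induction k arbitrary: G) (auto intro: continuous_on_subset)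
    show "\<exists>N F. open N \<and> z \<in> N \<and> higher_differentiable_on N k F \<and> (\<forall>y\<in>N. F y = f y)"
      using N sub \<open>z \<in> S\<close> assms by (intro exI[of _ "N \<inter> S"] exI[of _ F]) auto
  qed
next
  assume "\<forall>k. higher_differentiable_on S k f"
  then show "smooth_on S f"
    unfolding smooth_on_def using assms by blast
qed

definition diffeomorphism ::
    "'a::real_normed_vector set \<Rightarrow> 'b::real_normed_vector set \<Rightarrow> ('a \<Rightarrow> 'b) \<Rightarrow> bool" where
  "diffeomorphism S T f \<longleftrightarrow> (\<exists>g. homeomorphism S T f g \<and> smooth_on S f \<and> smooth_on T g)"


section \<open>\<open>\<A>\<close>-equivalence of map germs\<close>

text \<open>The germ at \<open>p\<close> of \<open>f : S \<rightarrow> T\<close> against the germ at \<open>q\<close> of \<open>g : S' \<rightarrow> T'\<close>.\<close>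

definition A_equivalent ::
    "'a::real_normed_vector set \<Rightarrow> 'b::real_normed_vector set \<Rightarrow> ('a \<Rightarrow> 'b) \<Rightarrow> 'a \<Rightarrow>
     'c::real_normed_vector set \<Rightarrow> 'd::real_normed_vector set \<Rightarrow> ('c \<Rightarrow> 'd) \<Rightarrow> 'c \<Rightarrow> bool" where
  "A_equivalent S T f p S' T' g q \<longleftrightarrow>
     (\<exists>V W V' W' \<theta> \<Psi>.
        openin (top_of_set S) V \<and> p \<in> V \<and> openin (top_of_set T) W \<and> f ` V \<subseteq> W \<and>
        openin (top_of_set S') V' \<and> q \<in> V' \<and> openin (top_of_set T') W' \<and> g ` V' \<subseteq> W' \<and>
        diffeomorphism V V' \<theta> \<and> \<theta> p = q \<and>
        diffeomorphism W W' \<Psi> \<and> \<Psi> (f p) = g q \<and>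
        (\<forall>z\<in>V. \<Psi> (f z) = g (\<theta> z)))"

definition cross_cap_map :: "real^2 \<Rightarrow> real^3" where
  "cross_cap_map z = vector [z$1, (z$2)\<^sup>2, z$1 * z$2]"

definition S1_plus_map :: "real^2 \<Rightarrow> real^3" where
  "S1_plus_map z = vector [z$1, (z$2)\<^sup>2, z$2 * ((z$1)\<^sup>2 + (z$2)\<^sup>2)]"

definition S1_minus_map :: "real^2 \<Rightarrow> real^3" where
  "S1_minus_map z = vector [z$1, (z$2)\<^sup>2, z$2 * ((z$1)\<^sup>2 - (z$2)\<^sup>2)]"


section \<open>Lorentz-Minkowski 4-space\<close>

definition mink :: "real^4 \<Rightarrow> real^4 \<Rightarrow> real" where
  "mink x y = - (x$1 * y$1) + x$2 * y$2 + x$3 * y$3 + x$4 * y$4"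

text \<open>
  In both determinants the vectors are entered as rows; by transposition this is the same as
  entering them as columns.
\<close>

definition det2 :: "real^2 \<Rightarrow> real^2 \<Rightarrow> real" where
  "det2 x y = det (vector [x, y] :: real^2^2)"

definition det4 :: "real^4 \<Rightarrow> real^4 \<Rightarrow> real^4 \<Rightarrow> real^4 \<Rightarrow> real" where
  "det4 w x y z = det (vector [w, x, y, z] :: real^4^4)"

definition wedge :: "real^4 \<Rightarrow> real^4 \<Rightarrow> real^4 \<Rightarrow> real^4" where
  "wedge x y z = (THE n. \<forall>w. mink w n = det4 w x y z)"

lemma det4_linear: "linear (\<lambda>w. det4 w x y z)"
proof -
  define c where "c = (vector [0, x, y, z] :: real^4^4)"
  have "(vector [w, x, y, z] :: real^4^4) = (\<chi> i. if i = 1 then w else c $ i)" for w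
    by (simp add: c_def vec_eq_iff vector_def forall_4)
  then have eq: "det4 w x y z = det (\<chi> i. if i = 1 then w else c $ i)" for w
    by (simp add: det4_def)
  show ?thesis
    unfolding eq
  proof (rule linearI)
    fix r :: real and w :: "real^4"
    show "det (\<chi> i. if i = 1 then r *\<^sub>R w else c $ i) =
          r *\<^sub>R det (\<chi> i. if i = 1 then w else c $ i)"
      using det_row_mul[of 1 r "\<lambda>_. w" "\<lambda>i. c $ i"] by (simp add: scalar_mult_eq_scaleR cong: if_cong)
  qed (simp add: det_row_add)
qed

lemma ex1_wedge: "\<exists>!n. \<forall>w. mink w n = det4 w x y z"
proof
  define d where "d i = det4 (axis i 1) x y z" for i :: 4
  define n :: "real^4" where "n = (\<chi> i. if i = 1 then - d i else d i)"
  have "det4 w x y z = (\<Sum>i\<in>UNIV. w$i * d i)" for w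
  proof -
    have "w = (\<Sum>i\<in>UNIV. w$i *\<^sub>R axis i 1)"
      by (metis basis_expansion scalar_mult_eq_scaleR)
    then have "det4 w x y z = det4 (\<Sum>i\<in>UNIV. w$i *\<^sub>R axis i 1) x y z"
      by simp
    then show ?thesis
      by (simp add: d_def linear_sum[OF det4_linear] linear_scale[OF det4_linear])
  qed
  then show "\<forall>w. mink w n = det4 w x y z"
    by (simp add: mink_def n_def sum_4)
  fix m assume m: "\<forall>w. mink w m = det4 w x y z"
  have "mink (axis i 1) m = mink (axis i 1) n" for i
    using m \<open>\<forall>w. mink w n = det4 w x y z\<close> by simp
  from this[of 1] this[of 2] this[of 3] this[of 4] show "m = n"
    by (simp add: mink_def axis_def vec_eq_iff forall_4)
qed

definition H3 :: "(real^4) set" where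
  "H3 = {x. mink x x = -1 \<and> x$1 > 0}"

definition S31 :: "(real^4) set" where
  "S31 = {x. mink x x = 1}"

definition Delta5 :: "((real^4) \<times> (real^4)) set" where
  "Delta5 = {(n1, n2). n1 \<in> S31 \<and> n2 \<in> S31 \<and> mink n1 n2 = 0}"


section \<open>Derivatives in the plane\<close>

text \<open>The coordinates \<open>u\<close> and \<open>v\<close> correspond to the indices \<open>1\<close> and \<open>2\<close>.\<close>

definition partial :: "2 \<Rightarrow> (real^2 \<Rightarrow> 'b::real_normed_vector) \<Rightarrow> real^2 \<Rightarrow> 'b" where
  "partial i f q = frechet_derivative f (at q) (axis i 1)"

definition along :: "(real^2 \<Rightarrow> real^2) \<Rightarrow> (real^2 \<Rightarrow> 'b::real_normed_vector) \<Rightarrow> real^2 \<Rightarrow> 'b" where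
  "along \<zeta> f q = (\<zeta> q)$1 *\<^sub>R partial 1 f q + (\<zeta> q)$2 *\<^sub>R partial 2 f q"

definition det_Hess :: "(real^2 \<Rightarrow> real) \<Rightarrow> real^2 \<Rightarrow> real" where
  "det_Hess h q =
     partial 1 (partial 1 h) q * partial 2 (partial 2 h) q - (partial 2 (partial 1 h) q)\<^sup>2"


section \<open>Hyperbolic generalized framed surfaces\<close>

definition framing_coefficients ::
    "(real^2) set \<Rightarrow> (real^2 \<Rightarrow> real^4) \<Rightarrow> (real^2 \<Rightarrow> real^4) \<Rightarrow> (real^2 \<Rightarrow> real^4) \<Rightarrow>
     (real^2 \<Rightarrow> real) \<Rightarrow> (real^2 \<Rightarrow> real) \<Rightarrow> bool" where
  "framing_coefficients U x \<nu>1 \<nu>2 \<alpha> \<beta> \<longleftrightarrow>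
     smooth_on U \<alpha> \<and> smooth_on U \<beta> \<and>
     (\<forall>q\<in>U. wedge (x q) (partial 1 x q) (partial 2 x q) = \<alpha> q *\<^sub>R \<nu>1 q + \<beta> q *\<^sub>R \<nu>2 q)"

definition hyperbolic_generalized_framed_surface ::
    "(real^2) set \<Rightarrow> (real^2 \<Rightarrow> real^4) \<Rightarrow> (real^2 \<Rightarrow> real^4) \<Rightarrow> (real^2 \<Rightarrow> real^4) \<Rightarrow> bool" where
  "hyperbolic_generalized_framed_surface U x \<nu>1 \<nu>2 \<longleftrightarrow>
     smooth_on U x \<and> smooth_on U \<nu>1 \<and> smooth_on U \<nu>2 \<and>
     (\<forall>q\<in>U. x q \<in> H3 \<and> (\<nu>1 q, \<nu>2 q) \<in> Delta5 \<and>
            mink (x q) (\<nu>1 q) = 0 \<and> mink (x q) (\<nu>2 q) = 0) \<and>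
     (\<exists>\<alpha> \<beta>. framing_coefficients U x \<nu>1 \<nu>2 \<alpha> \<beta>)"

text \<open>
  The invariants are bundled into plane vectors, e.g. \<open>a = (a\<^sub>1, a\<^sub>2)\<close>; the component with index
  \<open>1\<close> belongs to the \<open>u\<close>-derivatives and that with index \<open>2\<close> to the \<open>v\<close>-derivatives.
\<close>

definition basic_invariants ::
    "(real^2) set \<Rightarrow> (real^2 \<Rightarrow> real^4) \<Rightarrow> (real^2 \<Rightarrow> real^4) \<Rightarrow> (real^2 \<Rightarrow> real^4) \<Rightarrow>
     (real^2 \<Rightarrow> real^2) \<Rightarrow> (real^2 \<Rightarrow> real^2) \<Rightarrow> (real^2 \<Rightarrow> real^2) \<Rightarrow>
     (real^2 \<Rightarrow> real^2) \<Rightarrow> (real^2 \<Rightarrow> real^2) \<Rightarrow> (real^2 \<Rightarrow> real^2) \<Rightarrow> bool" where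
  "basic_invariants U x \<nu>1 \<nu>2 a b c e f g \<longleftrightarrow>
     (let \<nu>3 = (\<lambda>q. wedge (x q) (\<nu>1 q) (\<nu>2 q)) in
      smooth_on U a \<and> smooth_on U b \<and> smooth_on U c \<and>
      smooth_on U e \<and> smooth_on U f \<and> smooth_on U g \<and>
      (\<forall>q\<in>U. \<forall>i.
         partial i x q = a q $ i *\<^sub>R \<nu>1 q + b q $ i *\<^sub>R \<nu>2 q + c q $ i *\<^sub>R \<nu>3 q \<and>
         partial i \<nu>1 q = a q $ i *\<^sub>R x q + e q $ i *\<^sub>R \<nu>2 q + f q $ i *\<^sub>R \<nu>3 q \<and>
         partial i \<nu>2 q = b q $ i *\<^sub>R x q - e q $ i *\<^sub>R \<nu>1 q + g q $ i *\<^sub>R \<nu>3 q \<and>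
         partial i \<nu>3 q = c q $ i *\<^sub>R x q - f q $ i *\<^sub>R \<nu>1 q - g q $ i *\<^sub>R \<nu>2 q))"

definition cross_cap_point :: "(real^2) set \<Rightarrow> (real^2 \<Rightarrow> real^4) \<Rightarrow> real^2 \<Rightarrow> bool" where
  "cross_cap_point U x p \<longleftrightarrow> A_equivalent U H3 x p UNIV UNIV cross_cap_map 0"

definition S1_plus_point :: "(real^2) set \<Rightarrow> (real^2 \<Rightarrow> real^4) \<Rightarrow> real^2 \<Rightarrow> bool" where
  "S1_plus_point U x p \<longleftrightarrow> A_equivalent U H3 x p UNIV UNIV S1_plus_map 0"

definition S1_minus_point :: "(real^2) set \<Rightarrow> (real^2 \<Rightarrow> real^4) \<Rightarrow> real^2 \<Rightarrow> bool" where
  "S1_minus_point U x p \<longleftrightarrow> A_equivalent U H3 x p UNIV UNIV S1_minus_map 0"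

end

theory Submission
  imports Defs
begin

text \<open>
  A corank one germ can be written as \<open>(u, f\<^sub>2, f\<^sub>3)\<close> after changing coordinates. If the second
  derivative along the kernel is transverse to the image of the differential, a Morse lemma with
  parameter turns \<open>f\<^sub>2\<close> into \<open>v\<^sup>2\<close>, and Whitney's theorem on even functions turns \<open>f\<^sub>3\<close> into
  \<open>v G(u, v\<^sup>2)\<close>. The germ is then a cross cap if \<open>G\<^sub>u \<noteq> 0\<close>, and of type \<open>S\<^sub>1\<^sup>\<plusminus>\<close> if
  \<open>G\<^sub>u = 0\<close> and \<open>\<plusminus> G\<^sub>u\<^sub>u G\<^sub>Y > 0\<close>, where \<open>Y\<close> is the second argument of \<open>G\<close>.

  The invariants of the surface are those of the reduced germ \<open>F\<close>: at the singular point \<open>\<phi>\<close> agrees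
  with a nowhere vanishing multiple of \<open>det(F\<^sub>u, F\<^sub>v, F\<^sub>v\<^sub>v)\<close>, composed with the source
  diffeomorphism, up to terms with vanishing \<open>2\<close>-jet, as long as the cross cap determinant
  vanishes. For \<open>F = (u, v\<^sup>2, v G(u, v\<^sup>2))\<close> the Hessian determinant is \<open>- 24 G\<^sub>u\<^sub>u G\<^sub>Y\<close>.

  That \<open>a\<close> and \<open>b\<close> vanish at such points follows from \<open>det(x, \<nu>\<^sub>3, x\<^sub>u, x\<^sub>v) = 0\<close>: dividing
  by \<open>G(u, 0)\<close> along \<open>v = 0\<close> and differentiating in \<open>v\<close> forces \<open>\<nu>\<^sub>3\<close> to be tangent to the image
  of the differential.
\<close>

section \<open>Calculus of smooth germs\<close>

text \<open>The Hessian determinant of \<phi> is not obviously an invariant: second derivatives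
  transform tensorially only at a point where value and first derivatives vanish. For
  \<open>det(F_u, F_v, F_vv)\<close> the first derivatives at the origin vanish exactly when the
  cross cap determinant does, and each further term of \<phi> is then a product of germs whose
  orders of vanishing add up to three. The condition on the second derivative along the kernel is
  stated for \<open>S_1^+\<close> alone because the other two cases imply it: a nonzero cross cap
  determinant does so at once, and if the condition fails, the pure second derivative of
  \<open>det(F_u, F_v, F_vv)\<close> along the kernel is zero, so that the Hessian determinant
  cannot be positive. The vanishing of \<open>a\<close> and \<open>b\<close> concerns the frame and
  not the germ of \<open>x\<close> alone: a priori the image of the differential could be any
  tangent line. It is forced by the neighbouring regular points, where \<nu>3 is tangent to the
  surface. Since smoothness means iterated Frechet differentiability, infinite order is always
  reached by induction: a derivative is expressed through functions of the same kind.\<close>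

definition smooth_at :: "('a::real_normed_vector \<Rightarrow> 'b::real_normed_vector) \<Rightarrow> 'a \<Rightarrow> bool" where
  "smooth_at f z \<longleftrightarrow> (\<exists>N. open N \<and> z \<in> N \<and> (\<forall>k. higher_differentiable_on N k f))"

abbreviation D :: "('a::real_normed_vector \<Rightarrow> 'b::real_normed_vector) \<Rightarrow> 'a \<Rightarrow> 'a \<Rightarrow> 'b" where
  "D f z \<equiv> frechet_derivative f (at z)"

lemma D_eqI: "(f has_derivative f') (at z) \<Longrightarrow> D f z = f'"
  by (metis frechet_derivative_at)

section \<open>Finite orders of differentiability on open sets\<close>

lemma hd_subset:
  "higher_differentiable_on S k f \<Longrightarrow> T \<subseteq> S \<Longrightarrow> higher_differentiable_on T k f"
  by (induction k arbitrary: f) (auto intro: continuous_on_subset)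

lemma hd_SucD: "higher_differentiable_on S (Suc k) f \<Longrightarrow> higher_differentiable_on S k f"
proof (induction k arbitrary: f)
  case 0
  then show ?case
    by (auto intro!: continuous_at_imp_continuous_on differentiable_imp_continuous_within)
next
  case (Suc k)
  then show ?case by (meson higher_differentiable_on.simps(2))
qed

lemma hd_cong:
  assumes "open S" "\<And>z. z \<in> S \<Longrightarrow> f z = g z" "higher_differentiable_on S k f"
  shows "higher_differentiable_on S k g"
  by (rule higher_differentiable_on_local) (use assms in blast)

text \<open>Taking the derivative as an explicit formula \<open>f'\<close> lets the inductions on
  the order below work with product and chain rules instead of with
  \<open>frechet_derivative\<close>.\<close>

lemma hd_SucI:
  assumes "open S" "\<And>z. z \<in> S \<Longrightarrow> (f has_derivative f' z) (at z)"
    and "\<And>v. higher_differentiable_on S k (\<lambda>z. f' z v)"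
  shows "higher_differentiable_on S (Suc k) f"
proof -
  have "higher_differentiable_on S k (\<lambda>z. D f z v)" for v
    by (rule hd_cong[OF assms(1) _ assms(3)]) (use D_eqI[OF assms(2)] in simp)
  then show ?thesis
    using assms(2) by (auto simp: differentiable_def)
qed

lemma hd_SucD':
  assumes "higher_differentiable_on S (Suc k) f"
  shows "z \<in> S \<Longrightarrow> (f has_derivative D f z) (at z)"
    "higher_differentiable_on S k (\<lambda>z. D f z v)"
  using assms by (auto simp: frechet_derivative_works)

lemma hd_const: "higher_differentiable_on S k (\<lambda>z. c)"
  by (induction k arbitrary: c) auto

lemma hd_bounded_linear:
  assumes "open S" "bounded_linear f" shows "higher_differentiable_on S k f"
proof (cases k)
  case 0
  then show ?thesis by (simp add: assms linear_continuous_on)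
next
  case (Suc n)
  show ?thesis
    unfolding Suc using assms
    by (intro hd_SucI[where f'="\<lambda>z. f"] hd_const bounded_linear_imp_has_derivative)
qed

lemma hd_add:
  assumes "open S" "higher_differentiable_on S k f" "higher_differentiable_on S k g"
  shows "higher_differentiable_on S k (\<lambda>z. f z + g z)"
  using assms(2,3)
proof (induction k arbitrary: f g)
  case 0
  then show ?case by (auto intro: continuous_intros)
next
  case (Suc k)
  show ?case
    by (rule hd_SucI[OF assms(1), where f'="\<lambda>z v. D f z v + D g z v"])
      (intro has_derivative_add Suc.IH hd_SucD'[OF Suc.prems(1)] hd_SucD'[OF Suc.prems(2)]; assumption)+
qed

lemma hd_bilinear:
  assumes "bounded_bilinear p" "open S" "higher_differentiable_on S k f" "higher_differentiable_on S k g"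
  shows "higher_differentiable_on S k (\<lambda>z. p (f z) (g z))"
  using assms(3,4)
proof (induction k arbitrary: f g)
  case 0
  then show ?case by (auto intro: bounded_bilinear.continuous_on[OF assms(1)])
next
  case (Suc k)
  show ?case
    by (rule hd_SucI[OF assms(2), where f'="\<lambda>z v. p (f z) (D g z v) + p (D f z v) (g z)"])
      (intro bounded_bilinear.FDERIV[OF assms(1)] hd_add[OF assms(2)] Suc.IH hd_SucD'[OF Suc.prems(1)]
        hd_SucD'[OF Suc.prems(2)] hd_SucD[OF Suc.prems(1)] hd_SucD[OF Suc.prems(2)]; assumption)+
qed

lemma hd_sum:
  assumes "open S" "\<And>i. i \<in> I \<Longrightarrow> higher_differentiable_on S k (f i)"
  shows "higher_differentiable_on S k (\<lambda>z. \<Sum>i\<in>I. f i z)"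
  using assms(2) by (induction I rule: infinite_finite_induct) (auto intro: hd_const hd_add[OF assms(1)])

lemma linear_basis_sum:
  fixes L :: "'a::euclidean_space \<Rightarrow> 'b::real_normed_vector"
  assumes "linear L" shows "L v = (\<Sum>e\<in>Basis. (v \<bullet> e) *\<^sub>R L e)"
proof -
  have "L v = L (\<Sum>e\<in>Basis. (v \<bullet> e) *\<^sub>R e)" by (simp add: euclidean_representation)
  also have "\<dots> = (\<Sum>e\<in>Basis. (v \<bullet> e) *\<^sub>R L e)"
    by (simp add: linear_sum[OF assms] linear_scale[OF assms])
  finally show ?thesis .
qed

text \<open>In \<open>D g (f z) (D f z v)\<close> both the base point and the direction vary with
  \<open>z\<close>. Expanding the direction in the basis leaves \<open>D g (f z) e\<close> with
  fixed \<open>e\<close>, which the induction hypothesis covers; this is why the middle space is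
  Euclidean.\<close>

lemma hd_compose:
  fixes f :: "'a::real_normed_vector \<Rightarrow> 'b::euclidean_space"
  assumes "open S" "open T" "f ` S \<subseteq> T"
    and "higher_differentiable_on S k f" "higher_differentiable_on T k g"
  shows "higher_differentiable_on S k (\<lambda>z. g (f z))"
  using assms(4,5)
proof (induction k arbitrary: g)
  case 0
  then show ?case using assms(3) by (auto intro: continuous_on_compose2)
next
  case (Suc k)
  have g: "y \<in> T \<Longrightarrow> (g has_derivative D g y) (at y)" for y
    using hd_SucD'(1)[OF Suc.prems(2)] by blast
  let ?f' = "\<lambda>z v. \<Sum>e\<in>Basis. (D f z v \<bullet> e) *\<^sub>R D g (f z) e"
  show ?case
  proof (rule hd_SucI[OF assms(1), where f'="?f'"])
    fix z assume z: "z \<in> S"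
    then have fz: "f z \<in> T" using assms(3) by blast
    have "((\<lambda>z. g (f z)) has_derivative (\<lambda>v. D g (f z) (D f z v))) (at z)"
      using has_derivative_compose[OF hd_SucD'(1)[OF Suc.prems(1) z] g[OF fz]] .
    moreover have "D g (f z) (D f z v) = ?f' z v" for v
      by (rule linear_basis_sum) (use g[OF fz] has_derivative_linear in blast)
    ultimately show "((\<lambda>z. g (f z)) has_derivative ?f' z) (at z)" by simp
  next
    fix v
    show "higher_differentiable_on S k (\<lambda>z. ?f' z v)"
    proof (intro hd_sum[OF assms(1)] hd_bilinear[OF bounded_bilinear_scaleR assms(1)])
      fix e :: 'b
      show "higher_differentiable_on S k (\<lambda>z. D f z v \<bullet> e)"
        by (rule hd_bilinear[OF bounded_bilinear_inner assms(1) hd_SucD'(2)[OF Suc.prems(1)] hd_const])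
      show "higher_differentiable_on S k (\<lambda>z. D g (f z) e)"
        by (rule Suc.IH[OF hd_SucD[OF Suc.prems(1)] hd_SucD'(2)[OF Suc.prems(2)]])
    qed
  qed
qed

lemma hd_inverse: "higher_differentiable_on (- {0::real}) k inverse"
proof (induction k)
  case 0
  then show ?case by (auto intro!: continuous_intros)
next
  case (Suc k)
  have o: "open (- {0::real})" by auto
  show ?case
  proof (rule hd_SucI[OF o, where f'="\<lambda>z v. (inverse z * inverse z) * (- v)"])
    fix z :: real assume "z \<in> - {0}"
    then show "(inverse has_derivative (\<lambda>v. inverse z * inverse z * - v)) (at z)"
      by (auto intro!: derivative_eq_intros simp: fun_eq_iff)
  next
    fix v :: real
    show "higher_differentiable_on (- {0}) k (\<lambda>z. inverse z * inverse z * - v)"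
      by (intro hd_bilinear[OF bounded_bilinear_mult o] hd_const Suc)
  qed
qed

text \<open>The derivative is the composition of \<open>inverse\<close> with \<open>sqrt\<close> up
  to a constant factor, so every order of differentiability yields the next.\<close>

lemma hd_sqrt: "higher_differentiable_on {0<..} k sqrt"
proof (induction k)
  case 0
  then show ?case by (auto intro!: continuous_intros)
next
  case (Suc k)
  have o: "open {0::real<..}" "open (- {0::real})" by auto
  show ?case
  proof (rule hd_SucI[OF o(1), where f'="\<lambda>z v. inverse (sqrt z) * (v / 2)"])
    fix z :: real assume "z \<in> {0<..}"
    then show "(sqrt has_derivative (\<lambda>v. inverse (sqrt z) * (v / 2))) (at z)"
      by (auto intro!: derivative_eq_intros simp: fun_eq_iff field_simps)
  next
    fix v :: real
    have "higher_differentiable_on {0<..} k (\<lambda>z. inverse (sqrt z))"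
      by (rule hd_compose[OF o _ Suc hd_inverse]) auto
    then show "higher_differentiable_on {0<..} k (\<lambda>z. inverse (sqrt z) * (v / 2))"
      by (intro hd_bilinear[OF bounded_bilinear_mult o(1)] hd_const)
  qed
qed

section \<open>Smoothness at a point and its closure properties\<close>

lemma smooth_on_iff_smooth_at:
  assumes "open S" shows "smooth_on S f \<longleftrightarrow> (\<forall>z\<in>S. smooth_at f z)"
proof
  assume "smooth_on S f"
  then show "\<forall>z\<in>S. smooth_at f z"
    using assms smooth_on_open_iff unfolding smooth_at_def by blast
next
  assume "\<forall>z\<in>S. smooth_at f z"
  then show "smooth_on S f"
    unfolding smooth_on_open_iff[OF assms] smooth_at_def
    by (intro allI higher_differentiable_on_local) blast
qed

lemma smooth_at_eventually: "smooth_at f z \<Longrightarrow> \<forall>\<^sub>F y in nhds z. smooth_at f y"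
  unfolding smooth_at_def eventually_nhds by blast

lemma smooth_at_cong_ev:
  assumes "smooth_at f z" "\<forall>\<^sub>F y in nhds z. f y = g y"
  shows "smooth_at g z"
proof -
  obtain N where N: "open N" "z \<in> N" "\<forall>k. higher_differentiable_on N k f"
    using assms unfolding smooth_at_def by blast
  obtain M where M: "open M" "z \<in> M" "\<forall>y\<in>M. f y = g y"
    using assms(2) unfolding eventually_nhds by blast
  have "higher_differentiable_on (N \<inter> M) k g" for k
    by (rule hd_cong[where f=f]) (use N M in \<open>auto intro: hd_subset\<close>)
  then show ?thesis unfolding smooth_at_def using N M by (intro exI[of _ "N \<inter> M"]) auto
qed

lemma smooth_at_compose:
  fixes f :: "'a::real_normed_vector \<Rightarrow> 'b::euclidean_space"
  assumes "smooth_at g (f z)" "smooth_at f z"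
  shows "smooth_at (\<lambda>z. g (f z)) z"
proof -
  obtain N where N: "open N" "z \<in> N" "\<forall>k. higher_differentiable_on N k f"
    using assms unfolding smooth_at_def by blast
  obtain M where M: "open M" "f z \<in> M" "\<forall>k. higher_differentiable_on M k g"
    using assms unfolding smooth_at_def by blast
  have "continuous_on N f" using N(3) higher_differentiable_on.simps(1) by blast
  then have o: "open (f -` M \<inter> N)"
    using N(1) M(1) by (metis continuous_on_open_vimage)
  have "higher_differentiable_on (f -` M \<inter> N) k (\<lambda>z. g (f z))" for k
    by (rule hd_compose[OF o M(1)]) (use N M in \<open>auto intro: hd_subset\<close>)
  then show ?thesis unfolding smooth_at_def using o N M by blast
qed

lemma smooth_at_openI: "open S \<Longrightarrow> z \<in> S \<Longrightarrow> (\<And>k. higher_differentiable_on S k f) \<Longrightarrow> smooth_at f z"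
  unfolding smooth_at_def by blast

named_theorems sm "smoothness of germs"

lemma smooth_at_const [sm, intro, simp]: "smooth_at (\<lambda>z. c) z"
  by (rule smooth_at_openI[of UNIV]) (auto intro: hd_const)

lemma smooth_at_bounded_linear: "bounded_linear f \<Longrightarrow> smooth_at f z"
  by (rule smooth_at_openI[of UNIV]) (auto intro: hd_bounded_linear)

lemma smooth_at_id [sm, intro, simp]: "smooth_at (\<lambda>z. z) z"
  by (intro smooth_at_bounded_linear bounded_linear_ident)

lemma smooth_at_bilinear:
  assumes "bounded_bilinear p" "smooth_at f z" "smooth_at g z"
  shows "smooth_at (\<lambda>z. p (f z) (g z)) z"
proof -
  obtain N where N: "open N" "z \<in> N" "\<forall>k. higher_differentiable_on N k f"
    using assms unfolding smooth_at_def by blast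
  obtain M where M: "open M" "z \<in> M" "\<forall>k. higher_differentiable_on M k g"
    using assms unfolding smooth_at_def by blast
  show ?thesis
    by (rule smooth_at_openI[of "N \<inter> M"])
      (use N M in \<open>auto intro: hd_subset intro!: hd_bilinear[OF assms(1)]\<close>)
qed

lemma smooth_at_add [sm]:
  assumes "smooth_at f z" "smooth_at g z"
  shows "smooth_at (\<lambda>z. f z + g z) z"
proof -
  obtain N where N: "open N" "z \<in> N" "\<forall>k. higher_differentiable_on N k f"
    using assms unfolding smooth_at_def by blast
  obtain M where M: "open M" "z \<in> M" "\<forall>k. higher_differentiable_on M k g"
    using assms unfolding smooth_at_def by blast
  show ?thesis
    by (rule smooth_at_openI[of "N \<inter> M"]) (use N M in \<open>auto intro: hd_subset intro!: hd_add\<close>)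
qed

lemmas smooth_at_mult [sm] = smooth_at_bilinear[OF bounded_bilinear_mult]
lemmas smooth_at_scaleR [sm] = smooth_at_bilinear[OF bounded_bilinear_scaleR]
lemmas smooth_at_inner [sm] = smooth_at_bilinear[OF bounded_bilinear_inner]

lemma smooth_at_minus [sm]: "smooth_at f z \<Longrightarrow> smooth_at (\<lambda>z. - f z) z"
  using smooth_at_scaleR[of "\<lambda>z. -1" z f] by simp

lemma smooth_at_diff [sm]: "smooth_at f z \<Longrightarrow> smooth_at g z \<Longrightarrow> smooth_at (\<lambda>z. f z - g z) z"
  using smooth_at_add[of f z "\<lambda>z. - g z"] smooth_at_minus[of g z] by simp

lemma smooth_at_power [sm]:
  fixes f :: "'a::real_normed_vector \<Rightarrow> real"
  shows "smooth_at f z \<Longrightarrow> smooth_at (\<lambda>z. f z ^ n) z"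
  by (induction n) (auto intro: sm)

lemma smooth_at_sum [sm]:
  "(\<And>i. i \<in> I \<Longrightarrow> smooth_at (f i) z) \<Longrightarrow> smooth_at (\<lambda>z. \<Sum>i\<in>I. f i z) z"
  by (induction I rule: infinite_finite_induct) (auto intro: sm)

lemma smooth_at_prod [sm]:
  fixes f :: "'i \<Rightarrow> 'a::real_normed_vector \<Rightarrow> real"
  shows "(\<And>i. i \<in> I \<Longrightarrow> smooth_at (f i) z) \<Longrightarrow> smooth_at (\<lambda>z. \<Prod>i\<in>I. f i z) z"
  by (induction I rule: infinite_finite_induct) (auto intro: sm)

lemma smooth_at_inverse [sm]:
  fixes f :: "'a::real_normed_vector \<Rightarrow> real"
  assumes "smooth_at f z" "f z \<noteq> 0" shows "smooth_at (\<lambda>z. inverse (f z)) z"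
  by (rule smooth_at_compose[OF _ assms(1)]) (rule smooth_at_openI[OF _ _ hd_inverse], use assms in auto)

lemma smooth_at_divide [sm]:
  fixes f :: "'a::real_normed_vector \<Rightarrow> real"
  shows "smooth_at f z \<Longrightarrow> smooth_at g z \<Longrightarrow> g z \<noteq> 0 \<Longrightarrow> smooth_at (\<lambda>z. f z / g z) z"
  unfolding divide_inverse by (intro sm)

lemma smooth_at_sqrt [sm]:
  assumes "smooth_at f z" "f z > 0" shows "smooth_at (\<lambda>z. sqrt (f z)) z"
  by (rule smooth_at_compose[OF _ assms(1)]) (rule smooth_at_openI[OF _ _ hd_sqrt], use assms in auto)

lemma smooth_at_nth [sm]:
  fixes f :: "'a::real_normed_vector \<Rightarrow> real^'n"
  assumes "smooth_at f z" shows "smooth_at (\<lambda>z. f z $ i) z"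
  by (rule smooth_at_compose[OF smooth_at_bounded_linear[OF bounded_linear_vec_nth] assms])

lemma smooth_at_vec_lambda [sm]:
  fixes f :: "'a::real_normed_vector \<Rightarrow> 'n::finite \<Rightarrow> real"
  assumes "\<And>i. smooth_at (\<lambda>z. f z i) z" shows "smooth_at (\<lambda>z. \<chi> i. f z i) z"
proof -
  have "(\<chi> i. f z i) = (\<Sum>i\<in>UNIV. f z i *\<^sub>R axis i 1)" for z
    by (metis (no_types, lifting) basis_expansion scalar_mult_eq_scaleR sum.cong vec_lambda_beta)
  then show ?thesis by (simp add: sm assms)
qed

lemma smooth_at_vecI:
  fixes f :: "'a::real_normed_vector \<Rightarrow> real^'n"
  assumes "\<And>i. smooth_at (\<lambda>z. f z $ i) z" shows "smooth_at f z"
  using smooth_at_vec_lambda[of "\<lambda>z i. f z $ i" z, OF assms] by simp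

lemma smooth_at_vector2 [sm]:
  fixes f g :: "'a::real_normed_vector \<Rightarrow> real"
  assumes "smooth_at f z" "smooth_at g z"
  shows "smooth_at (\<lambda>z. vector [f z, g z] :: real^2) z"
proof (rule smooth_at_vecI)
  fix i :: 2 show "smooth_at (\<lambda>z. (vector [f z, g z] :: real^2) $ i) z"
    using assms exhaust_2[of i] by auto
qed

lemma smooth_at_vector3 [sm]:
  fixes f g h :: "'a::real_normed_vector \<Rightarrow> real"
  assumes "smooth_at f z" "smooth_at g z" "smooth_at h z"
  shows "smooth_at (\<lambda>z. vector [f z, g z, h z] :: real^3) z"
proof (rule smooth_at_vecI)
  fix i :: 3 show "smooth_at (\<lambda>z. (vector [f z, g z, h z] :: real^3) $ i) z"
    using assms exhaust_3[of i] by auto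
qed

lemma vector_4_nth [simp]:
  "(vector [x, y, z, w] :: 'a::zero^4) $ 1 = x"
  "(vector [x, y, z, w] :: 'a::zero^4) $ 2 = y"
  "(vector [x, y, z, w] :: 'a::zero^4) $ 3 = z"
  "(vector [x, y, z, w] :: 'a::zero^4) $ 4 = w"
  by (simp_all add: vector_def)

lemma smooth_at_vector4 [sm]:
  fixes f g h k :: "'a::real_normed_vector \<Rightarrow> real"
  assumes "smooth_at f z" "smooth_at g z" "smooth_at h z" "smooth_at k z"
  shows "smooth_at (\<lambda>z. vector [f z, g z, h z, k z] :: real^4) z"
proof (rule smooth_at_vecI)
  fix i :: 4 show "smooth_at (\<lambda>z. (vector [f z, g z, h z, k z] :: real^4) $ i) z"
    using assms exhaust_4[of i] by auto
qed

lemma smooth_at_det [sm]: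
  fixes A :: "'a::real_normed_vector \<Rightarrow> real^'n^'n"
  assumes "\<And>i j. smooth_at (\<lambda>z. A z $ i $ j) z"
  shows "smooth_at (\<lambda>z. det (A z)) z"
  unfolding det_def by (intro sm assms)

lemma smooth_at_differentiable: "smooth_at f z \<Longrightarrow> f differentiable (at z)"
  unfolding smooth_at_def by (metis higher_differentiable_on.simps(2))

lemma smooth_at_has_derivative: "smooth_at f z \<Longrightarrow> (f has_derivative D f z) (at z)"
  using smooth_at_differentiable frechet_derivative_works by blast

lemma smooth_at_linear_D: "smooth_at f z \<Longrightarrow> linear (D f z)"
  using smooth_at_has_derivative has_derivative_linear by blast

lemma smooth_at_isCont: "smooth_at f z \<Longrightarrow> isCont f z"
  using smooth_at_differentiable differentiable_imp_continuous_within by blast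

lemma smooth_at_D [sm]: "smooth_at f z \<Longrightarrow> smooth_at (\<lambda>z. D f z v) z"
  unfolding smooth_at_def by (metis higher_differentiable_on.simps(2))

text \<open>For a direction that varies with the point, the basis expansion reduces to
  \<open>smooth_at_D\<close>. The expansion is valid where \<open>f\<close> is differentiable, hence
  near \<open>z\<close>.\<close>

lemma smooth_at_D_dir:
  fixes f :: "'a::euclidean_space \<Rightarrow> 'b::real_normed_vector"
  assumes "smooth_at f z" "smooth_at w z"
  shows "smooth_at (\<lambda>z. D f z (w z)) z"
proof -
  have "smooth_at (\<lambda>z. \<Sum>e\<in>Basis. (w z \<bullet> e) *\<^sub>R D f z e) z"
    by (intro sm assms)
  moreover have "\<forall>\<^sub>F y in nhds z. (\<Sum>e\<in>Basis. (w y \<bullet> e) *\<^sub>R D f y e) = D f y (w y)"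
    using smooth_at_eventually[OF assms(1)]
    by eventually_elim (metis linear_basis_sum smooth_at_linear_D)
  ultimately show ?thesis by (rule smooth_at_cong_ev)
qed

section \<open>Differentiation rules for germs\<close>

lemma D_cong_ev: "\<forall>\<^sub>F y in nhds z. f y = g y \<Longrightarrow> D f z = D g z"
  unfolding eventually_nhds by (metis frechet_derivative_cong_open)

text \<open>Turns an identity of germs at \<open>z\<close> into one of germs at all nearby points,
  so that it can be differentiated more than once.\<close>

lemma ev_nhds2: "eventually P (nhds z) \<Longrightarrow> \<forall>\<^sub>F y in nhds z. eventually P (nhds y)"
  by (simp add: eventually_eventually)

lemma D_const [simp]: "D (\<lambda>z. c) z v = 0"
  by simp

lemma D_id [simp]: "D (\<lambda>z. z) z v = v"
  by (subst D_eqI[OF has_derivative_ident]) simp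

lemma D_add: "smooth_at f z \<Longrightarrow> smooth_at g z \<Longrightarrow> D (\<lambda>z. f z + g z) z v = D f z v + D g z v"
  by (subst D_eqI[OF has_derivative_add[OF smooth_at_has_derivative smooth_at_has_derivative]]) auto

lemma D_diff: "smooth_at f z \<Longrightarrow> smooth_at g z \<Longrightarrow> D (\<lambda>z. f z - g z) z v = D f z v - D g z v"
  by (subst D_eqI[OF has_derivative_diff[OF smooth_at_has_derivative smooth_at_has_derivative]]) auto

lemma D_sum: "(\<And>i. i \<in> I \<Longrightarrow> smooth_at (f i) z) \<Longrightarrow> D (\<lambda>z. \<Sum>i\<in>I. f i z) z v = (\<Sum>i\<in>I. D (f i) z v)"
  by (subst D_eqI[OF has_derivative_sum[OF smooth_at_has_derivative]]) auto

lemma D_mult: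
  fixes f g :: "'a::real_normed_vector \<Rightarrow> real"
  shows "smooth_at f z \<Longrightarrow> smooth_at g z \<Longrightarrow> D (\<lambda>z. f z * g z) z v = D f z v * g z + f z * D g z v"
  by (subst D_eqI[OF has_derivative_mult[OF smooth_at_has_derivative smooth_at_has_derivative]]) auto

lemma D_scaleR:
  "smooth_at f z \<Longrightarrow> smooth_at g z \<Longrightarrow> D (\<lambda>z. f z *\<^sub>R g z) z v = D f z v *\<^sub>R g z + f z *\<^sub>R D g z v"
  by (subst D_eqI[OF has_derivative_scaleR[OF smooth_at_has_derivative smooth_at_has_derivative]]) auto

lemma D_power2:
  fixes f :: "'a::real_normed_vector \<Rightarrow> real"
  shows "smooth_at f z \<Longrightarrow> D (\<lambda>z. (f z)\<^sup>2) z v = 2 * f z * D f z v"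
  using D_mult[of f z f v] by (simp add: power2_eq_square)

lemma D_compose:
  "smooth_at g (f z) \<Longrightarrow> smooth_at f z \<Longrightarrow> D (\<lambda>z. g (f z)) z v = D g (f z) (D f z v)"
  by (subst D_eqI[OF has_derivative_compose[OF smooth_at_has_derivative smooth_at_has_derivative]]) auto

lemma D_linear: "bounded_linear g \<Longrightarrow> D g z v = g v"
  by (subst D_eqI[OF bounded_linear_imp_has_derivative]) auto

lemma D_nth:
  fixes f :: "'a::real_normed_vector \<Rightarrow> real^'n"
  shows "smooth_at f z \<Longrightarrow> D (\<lambda>z. f z $ i) z v = D f z v $ i"
  by (subst D_eqI[OF bounded_linear.has_derivative[OF bounded_linear_vec_nth smooth_at_has_derivative]]) auto

lemma D_nth_id [simp]: "D (\<lambda>z::real^'n. z $ i) z v = v $ i"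
  by (rule D_linear[OF bounded_linear_vec_nth])

section \<open>The smooth inverse function theorem\<close>

lemma hd_of_smooth_at:
  assumes "open S" "\<And>z. z \<in> S \<Longrightarrow> smooth_at f z" shows "higher_differentiable_on S k f"
  using assms smooth_on_iff_smooth_at smooth_on_open_iff by metis

text \<open>The theorem for continuously differentiable maps supplies \<open>g\<close> with
  derivative \<open>inv (D f (g y))\<close>. By Cramer's rule this derivative has the form
  \<open>S v (g y)\<close> with \<open>S v\<close> smooth, so differentiability of order
  \<open>k\<close> passes from \<open>g\<close> to its derivative and raises the order of
  \<open>g\<close> to \<open>Suc k\<close>.\<close>

lemma smooth_inverse_function:
  fixes f :: "real^'n \<Rightarrow> real^'n"
  assumes f: "smooth_at f p" and inj: "inj (D f p)"
  obtains V W g where "open V" "open W" "p \<in> V" "homeomorphism V W f g"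
    "\<And>z. z \<in> V \<Longrightarrow> smooth_at f z" "\<And>y. y \<in> W \<Longrightarrow> smooth_at g y"
    "\<And>z. z \<in> V \<Longrightarrow> inj (D f z)"
proof -
  obtain N where N: "open N" "p \<in> N" "\<And>z. z \<in> N \<Longrightarrow> smooth_at f z"
    using smooth_at_eventually[OF f] unfolding eventually_nhds by blast
  define f' where "f' z = Blinfun (D f z)" for z
  have f': "blinfun_apply (f' z) = D f z" if "z \<in> N" for z
    unfolding f'_def by (rule bounded_linear_Blinfun_apply)
      (use N(3)[OF that] smooth_at_has_derivative has_derivative_bounded_linear in blast)
  have cont: "continuous_on N f'"
  proof (rule continuous_on_blinfun_componentwise)
    fix i :: "real^'n"
    have "continuous_on N (\<lambda>z. D f z i)"
      by (intro continuous_at_imp_continuous_on ballI smooth_at_isCont smooth_at_D N)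
    then show "continuous_on N (\<lambda>z. blinfun_apply (f' z) i)"
      by (simp add: f' cong: continuous_on_cong)
  qed
  obtain L where L: "linear L" "L \<circ> D f p = id"
    using linear_injective_left_inverse[OF smooth_at_linear_D[OF f] inj] by blast
  have "Blinfun L o\<^sub>L f' p = id_blinfun"
    using L by (intro blinfun_eqI)
      (simp add: f' N bounded_linear_Blinfun_apply linear_conv_bounded_linear pointfree_idE)
  then obtain V W g g' where VW: "open V" "V \<subseteq> N" "p \<in> V" "open W" "homeomorphism V W f g"
    and g': "\<And>y. y \<in> W \<Longrightarrow> (g has_derivative g' y) (at y)"
    "\<And>y. y \<in> W \<Longrightarrow> g' y = inv (blinfun_apply (f' (g y)))"
    "\<And>y. y \<in> W \<Longrightarrow> bij (blinfun_apply (f' (g y)))"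
    using inverse_function_theorem[OF N(1) _ cont N(2)] f' N(3) smooth_at_has_derivative by metis
  have gW: "g y \<in> V" if "y \<in> W" for y
    using VW(5) that by (auto simp: homeomorphism_def)
  have bij: "bij (D f z)" if "z \<in> V" for z
  proof -
    have "f z \<in> W" "g (f z) = z" using VW(5) that by (auto simp: homeomorphism_def)
    then show ?thesis using g'(3)[of "f z"] f'[of z] VW(2) that by auto
  qed
  define A where "A z = matrix (D f z)" for z
  have A: "A z *v w = D f z w" if "z \<in> V" for z w
    unfolding A_def using N(3) VW(2) that by (simp add: matrix_works smooth_at_linear_D subset_iff)
  have detA: "det (A z) \<noteq> 0" if "z \<in> V" for z
    using bij[OF that] N(3)[THEN smooth_at_linear_D] VW(2) that
    unfolding A_def by (metis bij_is_inj det_nz_iff_inj subsetD)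
  \<comment> \<open>Cramer's rule for the solution of \<open>A z *v w = v\<close>; a quotient of
    determinants of smooth entries is visibly smooth in \<open>z\<close>.\<close>
  define S where "S v z = (\<chi> k. det (\<chi> i j. if j = k then v $ i else A z $ i $ j) / det (A z))"
    for v :: "real^'n" and z
  have A_smooth: "smooth_at (\<lambda>z. A z $ i $ j) z" if "z \<in> V" for z i j
    unfolding A_def matrix_def using N(3) VW(2) that by (auto intro!: sm)
  have S_smooth: "smooth_at (S v) z" if "z \<in> V" for v z
  proof -
    have "smooth_at (\<lambda>z. if j = k then v $ i else A z $ i $ j) z" for i j k
      using A_smooth[OF that] by (cases "j = k") (auto intro: sm)
    then show ?thesis
      unfolding S_def by (intro smooth_at_vec_lambda smooth_at_divide smooth_at_det detA that)
        (simp_all add: A_smooth that)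
  qed
  have S: "S v (g y) = g' y v" if y: "y \<in> W" for y v
  proof -
    have "A (g y) *v (g' y v) = v"
      using A[OF gW[OF y]] g'(2,3)[OF y] f'[of "g y"] gW[OF y] VW(2)
      by (metis bij_is_surj subsetD surj_f_inv_f)
    from iffD1[OF cramer[OF detA[OF gW[OF y]]] this] show ?thesis
      unfolding S_def by (rule sym)
  qed
  have "higher_differentiable_on W k g" for k
  proof (induction k)
    case 0
    then show ?case using VW(5) by (simp add: homeomorphism_def)
  next
    case (Suc k)
    show ?case
    proof (rule hd_SucI[OF VW(4) g'(1)])
      fix v
      have "higher_differentiable_on W k (\<lambda>y. S v (g y))"
        by (rule hd_compose[OF VW(4,1) _ Suc hd_of_smooth_at[OF VW(1) S_smooth]]) (use gW in auto)
      then show "higher_differentiable_on W k (\<lambda>y. g' y v)"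
        by (rule hd_cong[OF VW(4), rotated]) (simp add: S)
    qed
  qed
  then have gs: "smooth_at g y" if "y \<in> W" for y
    by (rule smooth_at_openI[OF VW(4) that])
  have fs: "smooth_at f z" "inj (D f z)" if "z \<in> V" for z
    using N(3) VW(2) bij_is_inj[OF bij] that by auto
  show ?thesis
    by (rule that[OF VW(1,4,3,5) fs(1) gs fs(2)])
qed

section \<open>Symmetry of second derivatives\<close>

lemma has_real_derivative_along_line:
  fixes f :: "'a::euclidean_space \<Rightarrow> real"
  assumes "smooth_at f (c + s *\<^sub>R a)"
  shows "((\<lambda>s. f (c + s *\<^sub>R a)) has_real_derivative D f (c + s *\<^sub>R a) a) (at s)"
proof -
  have "((\<lambda>s. f (c + s *\<^sub>R a)) has_derivative (\<lambda>t. D f (c + s *\<^sub>R a) (t *\<^sub>R a))) (at s)"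
    by (rule has_derivative_compose[where g=f and f="\<lambda>s. c + s *\<^sub>R a", OF _ smooth_at_has_derivative[OF assms]])
      (auto intro!: derivative_eq_intros)
  then show ?thesis
    by (simp add: has_field_derivative_def linear_scale[OF smooth_at_linear_D[OF assms]] mult_commute_abs)
qed

text \<open>The mean value theorem is applied in direction \<open>a\<close> to the difference
  \<open>k\<close>, then in direction \<open>b\<close> to the derivative of \<open>f\<close> along
  \<open>a\<close>. The second difference is symmetric in \<open>a\<close> and \<open>b\<close>, the
  right-hand side is not, which gives \<open>D2_symmetric\<close>.\<close>

lemma second_difference_mean_value:
  fixes f :: "'a::euclidean_space \<Rightarrow> real"
  assumes f: "\<And>y. y \<in> ball z r \<Longrightarrow> smooth_at f y" and h: "0 < h" "h * (norm a + norm b) < r"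
  shows "\<exists>y. dist z y \<le> h * (norm a + norm b) \<and>
    f (z + h *\<^sub>R a + h *\<^sub>R b) - f (z + h *\<^sub>R a) - f (z + h *\<^sub>R b) + f z =
      h * (h * D (\<lambda>y. D f y a) y b)"
proof -
  have dist: "dist z (z + s *\<^sub>R a + t *\<^sub>R b) \<le> h * (norm a + norm b)" if "0 \<le> s" "s \<le> h" "0 \<le> t" "t \<le> h" for s t
  proof -
    have "dist z (z + s *\<^sub>R a + t *\<^sub>R b) \<le> norm (s *\<^sub>R a) + norm (t *\<^sub>R b)"
      by (metis (no_types, lifting) add.assoc add_diff_cancel_left' dist_commute dist_norm norm_triangle_ineq)
    also have "\<dots> = s * norm a + t * norm b" using that by simp
    also have "\<dots> \<le> h * norm a + h * norm b" using that by (intro add_mono mult_right_mono) auto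
    finally show ?thesis by (simp add: algebra_simps)
  qed
  have sm: "smooth_at f (z + s *\<^sub>R a + t *\<^sub>R b)" if "0 \<le> s" "s \<le> h" "0 \<le> t" "t \<le> h" for s t
    using f dist[OF that] h by (simp add: mem_ball)
  define k where "k s = f ((z + h *\<^sub>R b) + s *\<^sub>R a) - f (z + s *\<^sub>R a)" for s
  have "(k has_real_derivative (D f ((z + h *\<^sub>R b) + s *\<^sub>R a) a - D f (z + s *\<^sub>R a) a)) (at s)"
    if "0 \<le> s" "s \<le> h" for s
    unfolding k_def using sm[of s h] sm[of s 0] that h
    by (intro DERIV_diff has_real_derivative_along_line) (simp_all add: algebra_simps)
  from MVT2[OF h(1), of k, OF this] obtain s where s: "0 < s" "s < h"
    "k h - k 0 = h * (D f ((z + h *\<^sub>R b) + s *\<^sub>R a) a - D f (z + s *\<^sub>R a) a)"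
    by auto
  have "((\<lambda>t. D f (z + s *\<^sub>R a + t *\<^sub>R b) a) has_real_derivative
      D (\<lambda>y. D f y a) (z + s *\<^sub>R a + t *\<^sub>R b) b) (at t)" if "0 \<le> t" "t \<le> h" for t
    using sm[of s t] that s by (intro has_real_derivative_along_line smooth_at_D) simp
  from MVT2[OF h(1), OF this] obtain t where t: "0 < t" "t < h"
    "D f (z + s *\<^sub>R a + h *\<^sub>R b) a - D f (z + s *\<^sub>R a) a = h * D (\<lambda>y. D f y a) (z + s *\<^sub>R a + t *\<^sub>R b) b"
    by auto
  show ?thesis
    using dist[of s t] s t unfolding k_def
    by (intro exI[of _ "z + s *\<^sub>R a + t *\<^sub>R b"]) (simp add: algebra_simps)
qed

text \<open>The same second differences are expressed through either mixed derivative at points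
  converging to \<open>z\<close>; continuity of both derivatives then identifies their values at
  \<open>z\<close>.\<close>

lemma D2_symmetric:
  fixes f :: "'a::euclidean_space \<Rightarrow> real"
  assumes f: "smooth_at f z"
  shows "D (\<lambda>y. D f y a) z b = D (\<lambda>y. D f y b) z a"
proof -
  obtain r where r: "r > 0" "\<And>y. y \<in> ball z r \<Longrightarrow> smooth_at f y"
    using smooth_at_eventually[OF f] unfolding eventually_nhds by (meson open_contains_ball subsetD)
  \<comment> \<open>The summand \<open>1\<close> keeps \<open>M\<close> positive when
    \<open>a\<close> and \<open>b\<close> are both zero.\<close>
  define M where "M = norm a + norm b + 1"
  have M: "M > 0" unfolding M_def by (simp add: add_nonneg_pos)
  define h where "h n = r / M / real (Suc (Suc n))" for n
  have h: "0 < h n" "h n * (norm a + norm b) < r" for n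
  proof -
    show "0 < h n" using r M by (simp add: h_def)
    have "h n * (norm a + norm b) < h n * M" using \<open>0 < h n\<close> by (simp add: M_def)
    also have "\<dots> = r / real (Suc (Suc n))" using M by (simp add: h_def)
    also have "\<dots> \<le> r" using r(1) by (simp add: field_simps)
    finally show "h n * (norm a + norm b) < r" .
  qed
  have "(\<lambda>n. r / M * (norm a + norm b) * inverse (real (Suc (Suc n)))) \<longlonglongrightarrow> r / M * (norm a + norm b) * 0"
    by (intro tendsto_mult_left LIMSEQ_Suc[OF LIMSEQ_inverse_real_of_nat])
  then have h0: "(\<lambda>n. h n * (norm a + norm b)) \<longlonglongrightarrow> 0"
    by (simp add: h_def divide_inverse mult_ac)
  have lim: "(\<lambda>n. D (\<lambda>y. D f y c) (y n) d) \<longlonglongrightarrow> D (\<lambda>y. D f y c) z d"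
    if "\<And>n. dist z (y n) \<le> h n * (norm a + norm b)" for y c d
  proof (rule isCont_tendsto_compose[where g="\<lambda>y. D (\<lambda>y. D f y c) y d" and f=y])
    show "isCont (\<lambda>y. D (\<lambda>y. D f y c) y d) z" by (intro smooth_at_isCont smooth_at_D f)
    have "(\<lambda>n. dist (y n) z) \<longlonglongrightarrow> 0"
      by (rule Lim_null_comparison[OF _ h0]) (use that in \<open>simp add: dist_commute\<close>)
    then show "y \<longlonglongrightarrow> z" using tendsto_dist_iff by blast
  qed
  obtain y1 where y1: "\<And>n. dist z (y1 n) \<le> h n * (norm a + norm b)"
    "\<And>n. f (z + h n *\<^sub>R a + h n *\<^sub>R b) - f (z + h n *\<^sub>R a) - f (z + h n *\<^sub>R b) + f z =
      h n * (h n * D (\<lambda>y. D f y a) (y1 n) b)"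
    using second_difference_mean_value[OF r(2) h] by metis
  have h': "h n * (norm b + norm a) < r" for n using h by (simp add: add.commute)
  obtain y2 where y2: "\<And>n. dist z (y2 n) \<le> h n * (norm b + norm a)"
    "\<And>n. f (z + h n *\<^sub>R b + h n *\<^sub>R a) - f (z + h n *\<^sub>R b) - f (z + h n *\<^sub>R a) + f z =
      h n * (h n * D (\<lambda>y. D f y b) (y2 n) a)"
    using second_difference_mean_value[OF r(2) h(1) h'] by metis
  have E: "h n * (h n * D (\<lambda>y. D f y a) (y1 n) b) = h n * (h n * D (\<lambda>y. D f y b) (y2 n) a)" for n
    using y1(2)[of n] y2(2)[of n] by (simp add: algebra_simps)
  have "D (\<lambda>y. D f y a) (y1 n) b = D (\<lambda>y. D f y b) (y2 n) a" for n
    using E[of n] h(1)[of n] by simp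
  then show ?thesis
    using LIMSEQ_unique[OF lim[OF y1(1), of a b]] lim[of y2 b a] y2(1) by (simp add: add.commute)
qed

section \<open>Classes of functions closed under partial derivatives\<close>

lemma continuous_on_vector2 [continuous_intros]:
  fixes f g :: "'a::topological_space \<Rightarrow> real"
  assumes "continuous_on S f" "continuous_on S g"
  shows "continuous_on S (\<lambda>z. vector [f z, g z] :: real^2)"
proof -
  have "(vector [f z, g z] :: real^2) = (\<chi> i. if i = 1 then f z else g z)" for z
    by (simp add: vec_eq_iff forall_2)
  moreover have "continuous_on S (\<lambda>z. if i = 1 then f z else g z)" for i :: 2
    using assms by (cases "i = 1") auto
  ultimately show ?thesis by (simp add: continuous_on_vec_lambda)
qed

lemma vector2_eta [simp]: "vector [z $ 1, z $ 2] = (z :: real^2)"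
  by (simp add: vec_eq_iff forall_2)

text \<open>Endpoints in either order, so that increments of both signs are treated at once.\<close>

lemma MVT_closed_segment:
  fixes g :: "real \<Rightarrow> real"
  assumes "\<And>s. s \<in> closed_segment a b \<Longrightarrow> (g has_real_derivative g' s) (at s)"
  shows "\<exists>s\<in>closed_segment a b. g b - g a = (b - a) * g' s"
proof -
  consider "a < b" | "a = b" | "b < a" by linarith
  then show ?thesis
  proof cases
    case 1
    then show ?thesis
      using MVT2[OF 1, of g g'] assms by (force simp: closed_segment_eq_real_ivl)
  next
    case 3
    then obtain s where "b < s" "s < a" "g a - g b = (a - b) * g' s"
      using MVT2[OF 3, of g g'] assms by (force simp: closed_segment_eq_real_ivl)
    then show ?thesis
      by (intro bexI[of _ s]) (auto simp: closed_segment_eq_real_ivl algebra_simps)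
  qed auto
qed

definition has_partials :: "(real^2 \<Rightarrow> real) \<Rightarrow> real \<Rightarrow> real \<Rightarrow> real^2 \<Rightarrow> bool" where
  "has_partials f A B y \<longleftrightarrow>
     ((\<lambda>s. f (vector [s, y $ 2])) has_real_derivative A) (at (y $ 1)) \<and>
     ((\<lambda>t. f (vector [y $ 1, t])) has_real_derivative B) (at (y $ 2))"

text \<open>The increment is split at the corner \<open>(z $ 1, y $ 2)\<close> and the mean value
  theorem is applied on both legs. The intermediate points are no farther from \<open>z\<close> than
  \<open>y\<close> is, so continuity of \<open>A\<close> and \<open>B\<close> at \<open>z\<close>
  controls the error.\<close>

lemma has_derivative_of_partials:
  fixes f :: "real^2 \<Rightarrow> real"
  assumes "open N" "z \<in> N" and part: "\<And>y. y \<in> N \<Longrightarrow> has_partials f (A y) (B y) y"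
    and "continuous_on N A" "continuous_on N B"
  shows "(f has_derivative (\<lambda>w. w $ 1 * A z + w $ 2 * B z)) (at z)"
  unfolding has_derivative_at_alt
proof (intro conjI allI impI)
  show "bounded_linear (\<lambda>w::real^2. w $ 1 * A z + w $ 2 * B z)"
    by (intro bounded_linear_add bounded_linear_mult_left bounded_linear_compose[OF bounded_linear_mult_left]
        bounded_linear_vec_nth)
  fix e :: real assume e: "e > 0"
  have "isCont A z" "isCont B z"
    using assms continuous_on_eq_continuous_at by blast+
  then have "(A \<longlongrightarrow> A z) (nhds z)" "(B \<longlongrightarrow> B z) (nhds z)"
    by (simp_all add: isCont_def tendsto_at_iff_tendsto_nhds)
  moreover have "\<forall>\<^sub>F y in nhds z. y \<in> N"
    using assms(1,2) eventually_nhds by blast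
  ultimately have "\<forall>\<^sub>F y in nhds z. dist (A y) (A z) < e / 2 \<and> dist (B y) (B z) < e / 2 \<and> y \<in> N"
    using e by (intro eventually_conj tendstoD) auto
  then obtain d where d: "d > 0"
    "\<And>y. dist y z < d \<Longrightarrow> \<bar>A y - A z\<bar> < e / 2 \<and> \<bar>B y - B z\<bar> < e / 2 \<and> y \<in> N"
    unfolding eventually_nhds_metric dist_real_def by blast
  show "\<exists>d>0. \<forall>y. norm (y - z) < d \<longrightarrow>
      norm (f y - f z - ((y - z) $ 1 * A z + (y - z) $ 2 * B z)) \<le> e * norm (y - z)"
  proof (intro exI[of _ d] conjI d(1) allI impI)
    fix y :: "real^2" assume y: "norm (y - z) < d"
    have near: "dist (vector [s, t]) z < d"
      if "s \<in> closed_segment (z $ 1) (y $ 1)" "t \<in> closed_segment (z $ 2) (y $ 2)" for s t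
    proof -
      have "norm (vector [s, t] - z) \<le> norm (y - z)"
      proof (rule norm_le_componentwise_cart)
        fix i :: 2
        show "norm ((vector [s, t] - z) $ i) \<le> norm ((y - z) $ i)"
          using that exhaust_2[of i] by (auto simp: closed_segment_eq_real_ivl split: if_splits)
      qed
      then show ?thesis using y by (simp add: dist_norm)
    qed
    have "((\<lambda>s. f (vector [s, y $ 2])) has_real_derivative A (vector [s, y $ 2])) (at s)"
      if "s \<in> closed_segment (z $ 1) (y $ 1)" for s
      using part[of "vector [s, y $ 2]"] d(2)[OF near[OF that]] by (simp add: has_partials_def)
    then obtain s where s: "s \<in> closed_segment (z $ 1) (y $ 1)"
      "f y - f (vector [z $ 1, y $ 2]) = (y $ 1 - z $ 1) * A (vector [s, y $ 2])"
      using MVT_closed_segment[of "z $ 1" "y $ 1" "\<lambda>s. f (vector [s, y $ 2])"] by force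
    have "((\<lambda>t. f (vector [z $ 1, t])) has_real_derivative B (vector [z $ 1, t])) (at t)"
      if "t \<in> closed_segment (z $ 2) (y $ 2)" for t
      using part[of "vector [z $ 1, t]"] d(2)[OF near[OF _ that]] by (simp add: has_partials_def)
    then obtain t where t: "t \<in> closed_segment (z $ 2) (y $ 2)"
      "f (vector [z $ 1, y $ 2]) - f z = (y $ 2 - z $ 2) * B (vector [z $ 1, t])"
      using MVT_closed_segment[of "z $ 2" "y $ 2" "\<lambda>t. f (vector [z $ 1, t])"] by force
    have "f y - f z - ((y - z) $ 1 * A z + (y - z) $ 2 * B z) =
      (y - z) $ 1 * (A (vector [s, y $ 2]) - A z) + (y - z) $ 2 * (B (vector [z $ 1, t]) - B z)"
      using s(2) t(2) by (simp add: algebra_simps)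
    also have "\<bar>\<dots>\<bar> \<le> norm (y - z) * (e / 2) + norm (y - z) * (e / 2)"
    proof (intro order_trans[OF abs_triangle_ineq] add_mono)
      show "\<bar>(y - z) $ 1 * (A (vector [s, y $ 2]) - A z)\<bar> \<le> norm (y - z) * (e / 2)"
        unfolding abs_mult using d(2)[OF near[OF s(1)], of "y $ 2"] component_le_norm_cart[of "y - z" 1]
        by (intro mult_mono) auto
      show "\<bar>(y - z) $ 2 * (B (vector [z $ 1, t]) - B z)\<bar> \<le> norm (y - z) * (e / 2)"
        unfolding abs_mult using d(2)[OF near[OF _ t(1)], of "z $ 1"] component_le_norm_cart[of "y - z" 2]
        by (intro mult_mono) auto
    qed
    finally show "norm (f y - f z - ((y - z) $ 1 * A z + (y - z) $ 2 * B z)) \<le> e * norm (y - z)"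
      by (simp add: algebra_simps)
  qed
qed

text \<open>Serves for functions given by integrals or series: their partial derivatives have the
  same shape with other data, so one differentiation under the sign proves smoothness of all
  orders.\<close>

lemma hd_of_partials_class:
  fixes C :: "(real^2 \<Rightarrow> real) set"
  assumes N: "open N" and cont: "\<And>f. f \<in> C \<Longrightarrow> continuous_on N f"
    and part: "\<And>f. f \<in> C \<Longrightarrow> \<exists>A\<in>C. \<exists>B\<in>C. \<forall>y\<in>N. has_partials f (A y) (B y) y"
    and "f \<in> C"
  shows "higher_differentiable_on N k f"
  using \<open>f \<in> C\<close>
proof (induction k arbitrary: f)
  case 0
  then show ?case using cont by simp
next
  case (Suc k)
  then obtain A B where AB: "A \<in> C" "B \<in> C" "\<forall>y\<in>N. has_partials f (A y) (B y) y"
    using part by blast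
  show ?case
  proof (rule hd_SucI[OF N, where f'="\<lambda>z w. w $ 1 * A z + w $ 2 * B z"])
    show "(f has_derivative (\<lambda>w. w $ 1 * A z + w $ 2 * B z)) (at z)" if "z \<in> N" for z
      by (rule has_derivative_of_partials[OF N that]) (use AB cont in auto)
    show "higher_differentiable_on N k (\<lambda>z. v $ 1 * A z + v $ 2 * B z)" for v :: "real^2"
      by (intro hd_add[OF N] hd_bilinear[OF bounded_bilinear_mult N] hd_const Suc.IH AB)
  qed
qed

text \<open>Boxes are invariant under reflection in the first axis and contain the vertical segment
  from each of their points to that axis.\<close>

definition box2 :: "real \<Rightarrow> real \<Rightarrow> (real^2) set" where
  "box2 r R = {z. \<bar>z $ 1\<bar> < r \<and> \<bar>z $ 2\<bar> < R}"

lemma open_box2: "open (box2 r R)"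
  unfolding box2_def by (intro open_Collect_conj open_Collect_less continuous_intros)

lemma smooth_at_partials:
  fixes f :: "real^2 \<Rightarrow> real"
  assumes "smooth_at f y"
  shows "has_partials f (D f y (axis 1 1)) (D f y (axis 2 1)) y"
proof -
  have "(vector [0, y $ 2] + s *\<^sub>R axis 1 1 :: real^2) = vector [s, y $ 2]"
    "(vector [y $ 1, 0] + s *\<^sub>R axis 2 1 :: real^2) = vector [y $ 1, s]" for s
    by (auto simp: vec_eq_iff forall_2 axis_def)
  then show ?thesis
    using has_real_derivative_along_line[of f "vector [0, y $ 2]" "y $ 1" "axis 1 1"]
      has_real_derivative_along_line[of f "vector [y $ 1, 0]" "y $ 2" "axis 2 1"] assms
    unfolding has_partials_def by simp
qed

section \<open>Hadamard's lemma\<close>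

text \<open>Differentiation in \<open>z $ 2\<close> produces a factor \<open>t\<close>. The
  integrals \<open>I n g\<close> with weight \<open>t ^ n\<close> are therefore closed under both
  partial derivatives, and \<open>hd_of_partials_class\<close> applies to them.\<close>

lemma smooth_integral_mean:
  fixes g :: "real^2 \<Rightarrow> real"
  assumes "\<And>z. z \<in> box2 r R \<Longrightarrow> smooth_at g z" and z: "z \<in> box2 r R"
  shows "smooth_at (\<lambda>z. integral {0..1} (\<lambda>t. g (vector [z $ 1, t * z $ 2]))) z"
proof -
  define I where "I n g z = integral (cbox 0 1) (\<lambda>t. t ^ n * g (vector [z $ 1, t * z $ 2]))"
    for n :: nat and g :: "real^2 \<Rightarrow> real" and z :: "real^2"
  define C where "C = {I n g | n g. \<forall>z\<in>box2 r R. smooth_at g z}"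
  have in_box: "vector [u, t * v] \<in> box2 r R" if "\<bar>u\<bar> < r" "\<bar>v\<bar> < R" "t \<in> cbox 0 1" for u v t :: real
  proof -
    have "\<bar>t * v\<bar> \<le> \<bar>v\<bar>" using that by (auto simp: abs_mult intro: mult_left_le_one_le)
    then show ?thesis using that by (simp add: box2_def)
  qed
  have cont: "continuous_on (box2 r R) g" if "\<forall>z\<in>box2 r R. smooth_at g z" for g :: "real^2 \<Rightarrow> real"
    using that by (auto intro!: continuous_at_imp_continuous_on smooth_at_isCont)
  have cont2: "continuous_on (X \<times> cbox 0 1) (\<lambda>(x, t). t ^ n * g (vector [p x, t * q x]))"
    if g: "\<forall>z\<in>box2 r R. smooth_at g z" and "continuous_on X p" "continuous_on X q"
      and "\<And>x. x \<in> X \<Longrightarrow> \<bar>p x\<bar> < r \<and> \<bar>q x\<bar> < R"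
    for X :: "'x::topological_space set" and p q n and g :: "real^2 \<Rightarrow> real"
    unfolding case_prod_unfold
    by (intro continuous_intros continuous_on_compose2[OF cont[OF g]] continuous_on_compose2[OF that(2)]
        continuous_on_compose2[OF that(3)]) (use that(4) in_box in auto)
  have cont_slice: "(\<lambda>t. t ^ n * g (vector [u, t * v])) integrable_on cbox 0 1"
    if g: "\<forall>z\<in>box2 r R. smooth_at g z" and "\<bar>u\<bar> < r" "\<bar>v\<bar> < R" for n u v and g :: "real^2 \<Rightarrow> real"
    by (intro integrable_continuous continuous_intros continuous_on_compose2[OF cont[OF g]])
      (use in_box that in auto)
  have "higher_differentiable_on (box2 r R) k f" if "f \<in> C" for k f
  proof (rule hd_of_partials_class[where C=C, OF open_box2 _ _ that])
    fix f assume "f \<in> C"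
    then obtain n g where f: "f = I n g" and g: "\<forall>z\<in>box2 r R. smooth_at g z"
      unfolding C_def by blast
    show "continuous_on (box2 r R) f"
      unfolding f I_def
      by (rule integral_continuous_on_param[where f="\<lambda>z t. t ^ n * g (vector [z $ 1, t * z $ 2])"],
          rule cont2[OF g, of _ "\<lambda>z. z $ 1" "\<lambda>z. z $ 2"])
        (auto intro!: continuous_intros simp: box2_def)
    have gD: "\<forall>z\<in>box2 r R. smooth_at (\<lambda>z. D g z w) z" for w
      using g by (auto intro: sm)
    show "\<exists>A\<in>C. \<exists>B\<in>C. \<forall>y\<in>box2 r R. has_partials f (A y) (B y) y"
    proof (rule bexI[of _ "I n (\<lambda>z. D g z (axis 1 1))"], rule bexI[of _ "I (Suc n) (\<lambda>z. D g z (axis 2 1))"], rule ballI)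
      show "I n (\<lambda>z. D g z (axis 1 1)) \<in> C" "I (Suc n) (\<lambda>z. D g z (axis 2 1)) \<in> C"
        unfolding C_def using gD by blast+
      fix y assume y: "y \<in> box2 r R"
      have y12: "\<bar>y $ 1\<bar> < r" "\<bar>y $ 2\<bar> < R" using y by (auto simp: box2_def)
      have m: "y $ 1 \<in> {-r<..<r}" "y $ 2 \<in> {-R<..<R}" using y12 by auto
      have part: "has_partials g (D g z (axis 1 1)) (D g z (axis 2 1)) z" if "z \<in> box2 r R" for z
        using smooth_at_partials g that by blast
      have 1: "((\<lambda>s. I n g (vector [s, y $ 2])) has_real_derivative I n (\<lambda>z. D g z (axis 1 1)) y) (at (y $ 1))"
      proof -
        have "((\<lambda>s. integral (cbox 0 1) (\<lambda>t. t ^ n * g (vector [s, t * y $ 2]))) has_real_derivative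
           integral (cbox 0 1) (\<lambda>t. t ^ n * D g (vector [y $ 1, t * y $ 2]) (axis 1 1))) (at (y $ 1) within {-r<..<r})"
        proof (rule leibniz_rule_field_derivative[where fx="\<lambda>s t. t ^ n * D g (vector [s, t * y $ 2]) (axis 1 1)"])
          fix s t :: real assume st: "s \<in> {-r<..<r}" "t \<in> cbox 0 1"
          then show "((\<lambda>s. t ^ n * g (vector [s, t * y $ 2])) has_real_derivative
              t ^ n * D g (vector [s, t * y $ 2]) (axis 1 1)) (at s within {-r<..<r})"
            using part[OF in_box[of s "y $ 2" t]] y12
            by (auto simp: has_partials_def intro!: DERIV_cmult intro: has_field_derivative_at_within)
        next
          show "continuous_on ({-r<..<r} \<times> cbox 0 1) (\<lambda>(s, t). t ^ n * D g (vector [s, t * y $ 2]) (axis 1 1))"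
            by (rule cont2[OF gD, of _ "\<lambda>s. s" "\<lambda>s. y $ 2"]) (use y12 in \<open>auto intro!: continuous_intros\<close>)
        qed (use y12 in \<open>auto intro!: cont_slice[OF g, simplified]\<close>)
        then show ?thesis
          using y12 by (simp add: I_def at_within_open[OF m(1) open_greaterThanLessThan])
      qed
      have 2: "((\<lambda>s. I n g (vector [y $ 1, s])) has_real_derivative I (Suc n) (\<lambda>z. D g z (axis 2 1)) y) (at (y $ 2))"
      proof -
        have "((\<lambda>s. integral (cbox 0 1) (\<lambda>t. t ^ n * g (vector [y $ 1, t * s]))) has_real_derivative
           integral (cbox 0 1) (\<lambda>t. t ^ Suc n * D g (vector [y $ 1, t * y $ 2]) (axis 2 1))) (at (y $ 2) within {-R<..<R})"
        proof (rule leibniz_rule_field_derivative[where fx="\<lambda>s t. t ^ Suc n * D g (vector [y $ 1, t * s]) (axis 2 1)"])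
          fix s t :: real assume st: "s \<in> {-R<..<R}" "t \<in> cbox 0 1"
          have "((\<lambda>v. g (vector [y $ 1, v])) has_real_derivative D g (vector [y $ 1, t * s]) (axis 2 1)) (at (t * s))"
            using part[OF in_box[of "y $ 1" s t]] y12 st by (auto simp: has_partials_def)
          moreover have "((\<lambda>s. t * s) has_real_derivative t) (at s)"
            by (auto intro!: derivative_eq_intros)
          ultimately have "((\<lambda>s. g (vector [y $ 1, t * s])) has_real_derivative D g (vector [y $ 1, t * s]) (axis 2 1) * t) (at s)"
            by (rule DERIV_chain2)
          then show "((\<lambda>s. t ^ n * g (vector [y $ 1, t * s])) has_real_derivative
              t ^ Suc n * D g (vector [y $ 1, t * s]) (axis 2 1)) (at s within {-R<..<R})"
            by (auto intro!: derivative_eq_intros intro: has_field_derivative_at_within)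
        next
          show "continuous_on ({-R<..<R} \<times> cbox 0 1) (\<lambda>(s, t). t ^ Suc n * D g (vector [y $ 1, t * s]) (axis 2 1))"
            by (rule cont2[OF gD, of _ "\<lambda>s. y $ 1" "\<lambda>s. s"]) (use y12 in \<open>auto intro!: continuous_intros\<close>)
        qed (use y12 in \<open>auto intro!: cont_slice[OF g, simplified]\<close>)
        then show ?thesis
          using y12 by (simp add: I_def at_within_open[OF m(2) open_greaterThanLessThan])
      qed
      show "has_partials f (I n (\<lambda>z. D g z (axis 1 1)) y) (I (Suc n) (\<lambda>z. D g z (axis 2 1)) y) y"
        unfolding has_partials_def f using 1 2 by simp
    qed
  qed
  moreover have "I 0 g \<in> C" unfolding C_def using assms(1) by blast
  ultimately show ?thesis
    using smooth_at_openI[OF open_box2 z, of "I 0 g"] by (simp add: I_def[abs_def])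
qed

text \<open>The quotient is the mean of the second partial derivative over the segment from
  \<open>(z $ 1, 0)\<close> to \<open>z\<close>, by the fundamental theorem of calculus. It is kept
  on a whole box, because the extension theorem below uses it on a box of fixed height.\<close>

lemma Hadamard:
  fixes g :: "real^2 \<Rightarrow> real"
  assumes g: "\<And>z. z \<in> box2 r R \<Longrightarrow> smooth_at g z"
  obtains k where "\<And>z. z \<in> box2 r R \<Longrightarrow> smooth_at k z"
    "\<And>z. z \<in> box2 r R \<Longrightarrow> g z - g (vector [z $ 1, 0]) = z $ 2 * k z"
proof
  let ?k = "\<lambda>z. integral {0..1} (\<lambda>t. D g (vector [z $ 1, t * z $ 2]) (axis 2 1))"
  show "smooth_at ?k z" if "z \<in> box2 r R" for z
    by (rule smooth_integral_mean[OF _ that]) (auto intro: sm g)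
  fix z assume z: "z \<in> box2 r R"
  have "((\<lambda>t. z $ 2 * D g (vector [z $ 1, t * z $ 2]) (axis 2 1)) has_integral
     g (vector [z $ 1, 1 * z $ 2]) - g (vector [z $ 1, 0 * z $ 2])) {0..1}"
  proof (rule fundamental_theorem_of_calculus)
    fix t :: real assume t: "t \<in> {0..1}"
    have "\<bar>t * z $ 2\<bar> \<le> \<bar>z $ 2\<bar>" using t by (auto simp: abs_mult intro: mult_left_le_one_le)
    then have "vector [z $ 1, t * z $ 2] \<in> box2 r R" using z by (simp add: box2_def)
    then have "((\<lambda>v. g (vector [z $ 1, v])) has_real_derivative
        D g (vector [z $ 1, t * z $ 2]) (axis 2 1)) (at (t * z $ 2))"
      using smooth_at_partials[OF g] by (force simp: has_partials_def)
    moreover have "((\<lambda>t. t * z $ 2) has_real_derivative z $ 2) (at t)"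
      by (auto intro!: derivative_eq_intros)
    ultimately have "((\<lambda>t. g (vector [z $ 1, t * z $ 2])) has_real_derivative
        D g (vector [z $ 1, t * z $ 2]) (axis 2 1) * z $ 2) (at t)"
      by (rule DERIV_chain2)
    then show "((\<lambda>t. g (vector [z $ 1, t * z $ 2])) has_vector_derivative
        z $ 2 * D g (vector [z $ 1, t * z $ 2]) (axis 2 1)) (at t within {0..1})"
      by (simp add: has_real_derivative_iff_has_vector_derivative mult.commute has_vector_derivative_at_within)
  qed simp
  from integral_unique[OF this] show "g z - g (vector [z $ 1, 0]) = z $ 2 * ?k z"
    by simp
qed

section \<open>Whitney's theorem on even functions\<close>

text \<open>
  The power series with coefficients \<open>c\<close> satisfies \<open>f (8 z) = (1 - z) f z\<close> and hence vanishes
  at all \<open>8 ^ Suc n\<close>, so that \<open>c j * 8 ^ j\<close> has vanishing moments with respect to the nodes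
  \<open>8 ^ j\<close>. Dividing by \<open>1 + 8 ^ j\<close> makes consecutive moments opposite to each other.
\<close>

lemma reflection_weights:
  obtains a :: "nat \<Rightarrow> real" where "\<And>n. summable (\<lambda>j. \<bar>a j * (- (8 ^ j)) ^ n\<bar>)"
    "\<And>n. (\<Sum>j. a j * (- (8 ^ j)) ^ n) = 1"
proof -
  \<comment> \<open>Comparing the coefficients of \<open>z ^ Suc j\<close> in
    \<open>f (8 z) = (1 - z) f z\<close>, normalised by \<open>f 0 = 1\<close>.\<close>
  define c :: "nat \<Rightarrow> real" where "c = rec_nat 1 (\<lambda>j x. x / (1 - 8 ^ Suc j))"
  have c0: "c 0 = 1" and cS: "c (Suc j) = c j / (1 - 8 ^ Suc j)" for j
    by (simp_all add: c_def)
  have p8: "(8::real) ^ Suc j > 1" for j by (rule one_less_power) auto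
  have cS': "c (Suc j) * (1 - 8 ^ Suc j) = c j" for j
    using cS[of j] p8[of j] by (simp add: field_simps)
  have summ: "summable (\<lambda>j. \<bar>c j * (8 ^ n) ^ j\<bar>)" for n :: nat
  proof (rule summable_ratio_test[of "1 / 2" n])
    fix j assume "n \<le> j"
    then have "(8::real) ^ Suc j \<ge> 8 ^ Suc n" by (intro power_increasing) auto
    moreover have "(8::real) ^ n \<ge> 1" by simp
    ultimately have le: "2 * 8 ^ n \<le> (8::real) ^ Suc j - 1" unfolding power_Suc by linarith
    then have pos: "(8::real) ^ Suc j - 1 > 0" using p8[of j] by simp
    have "\<bar>c (Suc j) * (8 ^ n) ^ Suc j\<bar> = \<bar>c j * (8 ^ n) ^ j\<bar> * (8 ^ n / (8 ^ Suc j - 1))"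
      unfolding cS using pos by (simp add: abs_mult abs_divide)
    also have "\<dots> \<le> \<bar>c j * (8 ^ n) ^ j\<bar> * (1 / 2)"
      using le pos by (intro mult_left_mono) (auto simp: field_simps)
    also have "\<dots> = 1 / 2 * \<bar>c j * (8 ^ n) ^ j\<bar>" by (rule mult.commute)
    finally show "norm \<bar>c (Suc j) * (8 ^ n) ^ Suc j\<bar> \<le> 1 / 2 * norm \<bar>c j * (8 ^ n) ^ j\<bar>"
      unfolding real_norm_def abs_idempotent .
  qed simp
  have summ': "summable (\<lambda>j. c j * (8 ^ n) ^ j)" for n :: nat
    by (rule summable_rabs_cancel[OF summ])
  \<comment> \<open>The value of the power series at \<open>8 ^ n\<close>. In the recursion
    \<open>mS\<close> the factor \<open>1 - 8 ^ n\<close> is zero for \<open>n = 0\<close>, which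
    starts the chain of zeros from \<open>m 1\<close> on.\<close>
  define m where "m n = (\<Sum>j. c j * (8 ^ n) ^ j)" for n :: nat
  have mS: "m (Suc n) = (1 - 8 ^ n) * m n" for n
  proof -
    have e: "c j * (8 ^ n) ^ j - c j * (8 ^ Suc n) ^ j = c j * (1 - 8 ^ j) * (8 ^ n) ^ j" for j
      unfolding power_Suc power_mult_distrib by (simp add: algebra_simps)
    have "m n - m (Suc n) = (\<Sum>j. c j * (1 - 8 ^ j) * (8 ^ n) ^ j)"
      using suminf_diff[OF summ'[of n] summ'[of "Suc n"]] by (simp only: m_def e)
    also have "\<dots> = (\<Sum>j. c (Suc j) * (1 - 8 ^ Suc j) * (8 ^ n) ^ Suc j)"
      using suminf_split_head[OF summable_diff[OF summ'[of n] summ'[of "Suc n"], unfolded e]] by simp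
    also have "\<dots> = 8 ^ n * m n"
      unfolding cS' m_def suminf_mult[OF summ', symmetric] by (simp add: mult_ac)
    finally show ?thesis by (simp add: algebra_simps)
  qed
  have m0: "m (Suc n) = 0" for n by (induction n) (auto simp: mS)
  define b where "b j = c j * 8 ^ j / (1 + 8 ^ j)" for j
  have pos: "1 + (8::real) ^ j > 0" for j by (simp add: add_pos_pos)
  have b_summ: "summable (\<lambda>j. \<bar>b j * (8 ^ j) ^ n\<bar>)" for n
  proof (rule summable_comparison_test'[OF summ[of "Suc n"]])
    fix j
    have "\<bar>b j * (8 ^ j) ^ n\<bar> = \<bar>c j * (8 ^ Suc n) ^ j\<bar> / (1 + 8 ^ j)"
      using pos[of j] by (simp add: b_def abs_mult power_mult_distrib mult_ac flip: power_mult)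
    also have "\<dots> \<le> \<bar>c j * (8 ^ Suc n) ^ j\<bar> / 1"
      by (rule divide_left_mono) (use pos[of j] in auto)
    finally show "norm \<bar>b j * (8 ^ j) ^ n\<bar> \<le> \<bar>c j * (8 ^ Suc n) ^ j\<bar>" by simp
  qed
  have b_summ': "summable (\<lambda>j. b j * (8 ^ j) ^ n)" for n
    by (rule summable_rabs_cancel[OF b_summ])
  define q where "q n = (\<Sum>j. b j * (8 ^ j) ^ n)" for n
  have "q (Suc n) + q n = m (Suc n)" for n
  proof -
    have "b j * (8 ^ j) ^ Suc n + b j * (8 ^ j) ^ n = c j * (8 ^ Suc n) ^ j" for j
    proof -
      have "b j * (8 ^ j) ^ Suc n + b j * (8 ^ j) ^ n = b j * (1 + 8 ^ j) * (8 ^ j) ^ n"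
        by (simp add: algebra_simps)
      also have "\<dots> = c j * (8 ^ j * (8 ^ j) ^ n)" using pos[of j] by (simp add: b_def)
      also have "8 ^ j * (8 ^ j) ^ n = ((8::real) ^ Suc n) ^ j"
        by (simp add: power_mult_distrib mult.commute flip: power_mult)
      finally show ?thesis .
    qed
    then show ?thesis
      using suminf_add[OF b_summ'[of "Suc n"] b_summ'[of n]] by (simp only: q_def m_def)
  qed
  then have "q (Suc n) = - q n" for n using m0 by (simp add: eq_neg_iff_add_eq_0)
  then have q: "q n = (- 1) ^ n * q 0" for n by (induction n) auto
  \<comment> \<open>Normalisation requires \<open>q 0\<close> to be nonzero. Here
    \<open>b 0 = 1 / 2\<close>, while the remaining \<open>b j\<close> are bounded by
    \<open>(1 / 7) ^ j\<close> and add up to at most \<open>1 / 6\<close>; the base \<open>8\<close>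
    is large enough for this gap.\<close>
  have cb: "\<bar>c j\<bar> \<le> (1 / 7) ^ j" for j
  proof (induction j)
    case (Suc j)
    have "(8::real) ^ j \<ge> 1" by simp
    then have "(7::real) \<le> 8 ^ Suc j - 1" by simp
    then have "\<bar>c j\<bar> / (8 ^ Suc j - 1) \<le> (1 / 7) ^ j / 7"
      using Suc by (intro frac_le) auto
    moreover have "\<bar>c (Suc j)\<bar> = \<bar>c j\<bar> / (8 ^ Suc j - 1)"
      unfolding cS using p8[of j] by (simp add: abs_divide)
    ultimately show ?case by simp
  qed (simp add: c0)
  have geo: "(\<lambda>j. (1 / 7 :: real) ^ Suc j) sums (1 / 6)"
    using sums_mult[OF geometric_sums[of "1 / 7 :: real"], of "1 / 7"] by simp
  have "norm (\<Sum>j. b (Suc j)) \<le> (\<Sum>j. (1 / 7) ^ Suc j)"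
  proof (rule norm_suminf_le[OF _ sums_summable[OF geo]])
    fix j
    have "\<bar>b (Suc j)\<bar> = \<bar>c (Suc j)\<bar> * (8 ^ Suc j / (1 + 8 ^ Suc j))"
      using pos[of "Suc j"] by (simp only: b_def abs_mult abs_divide) simp
    also have "\<dots> \<le> \<bar>c (Suc j)\<bar>"
      using pos[of "Suc j"] by (intro mult_left_le) (simp_all add: field_simps)
    also have "\<dots> \<le> (1 / 7) ^ Suc j" by (rule cb)
    finally show "norm (b (Suc j)) \<le> (1 / 7) ^ Suc j" by simp
  qed
  moreover have "(\<Sum>j. b (Suc j)) = q 0 - b 0"
    using suminf_split_head[OF b_summ'[of 0]] by (simp add: q_def)
  moreover have "b 0 = 1 / 2" by (simp add: b_def c0)
  ultimately have q0: "q 0 \<noteq> 0" unfolding sums_unique[OF geo, symmetric] by auto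
  have a: "b j / q 0 * (- (8 ^ j)) ^ n = (- 1) ^ n / q 0 * (b j * (8 ^ j) ^ n)" for j n
    by (simp add: power_minus[of "8 ^ j"])
  show ?thesis
  proof (rule that[of "\<lambda>j. b j / q 0"])
    show "summable (\<lambda>j. \<bar>b j / q 0 * (- (8 ^ j)) ^ n\<bar>)" for n
      unfolding a abs_mult[of "(- 1) ^ n / q 0"] by (intro summable_mult b_summ)
    show "(\<Sum>j. b j / q 0 * (- (8 ^ j)) ^ n) = 1" for n
      unfolding a suminf_mult[OF b_summ'] q_def[symmetric] using q[of n] q0
      by (simp flip: power_mult_distrib)
  qed
qed

text \<open>The difference quotient at \<open>a\<close> is a value of \<open>g\<close> at an
  intermediate point by the mean value theorem. Used to glue the extension to the original function
  across the first axis, where one-sided formulas meet.\<close>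

lemma has_real_derivative_of_limit:
  fixes f g :: "real \<Rightarrow> real"
  assumes d: "d > 0" and cont: "\<And>t. \<bar>t - a\<bar> < d \<Longrightarrow> isCont f t"
    and der: "\<And>t. \<bar>t - a\<bar> < d \<Longrightarrow> t \<noteq> a \<Longrightarrow> (f has_real_derivative g t) (at t)"
    and g: "isCont g a"
  shows "(f has_real_derivative g a) (at a)"
  unfolding has_field_derivative_iff
proof (rule tendstoI)
  fix e :: real assume "e > 0"
  then obtain d' where d': "d' > 0" "\<And>t. \<bar>t - a\<bar> < d' \<Longrightarrow> \<bar>g t - g a\<bar> < e"
    using g unfolding continuous_at_eps_delta dist_real_def by blast
  show "\<forall>\<^sub>F y in at a. dist ((f y - f a) / (y - a)) (g a) < e"
    unfolding eventually_at
  proof (intro exI[of _ "min d d'"] conjI ballI impI)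
    fix y assume y: "y \<noteq> a \<and> dist y a < min d d'"
    then have y': "\<bar>y - a\<bar> < d" "\<bar>y - a\<bar> < d'" by (auto simp: dist_real_def)
    have "\<exists>t. \<bar>t - a\<bar> < \<bar>y - a\<bar> \<and> f y - f a = (y - a) * g t"
    proof (cases "a < y")
      case True
      have "continuous_on {a..y} f"
        by (intro continuous_at_imp_continuous_on ballI cont) (use y' True in auto)
      moreover have "f differentiable (at t)" if "a < t" "t < y" for t
        unfolding real_differentiable_def using der[of t] y' that by auto
      ultimately obtain l t where "a < t" "t < y" "DERIV f t :> l" "f y - f a = (y - a) * l"
        using MVT[OF True] by blast
      moreover from this have "l = g t" using der[of t] y' True DERIV_unique by fastforce
      ultimately show ?thesis by (intro exI[of _ t]) auto
    next
      case False
      then have l: "y < a" using y by auto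
      have "continuous_on {y..a} f"
        by (intro continuous_at_imp_continuous_on ballI cont) (use y' l in auto)
      moreover have "f differentiable (at t)" if "y < t" "t < a" for t
        unfolding real_differentiable_def using der[of t] y' that by auto
      ultimately obtain l t where "y < t" "t < a" "DERIV f t :> l" "f a - f y = (a - y) * l"
        using MVT[OF l] by blast
      moreover from this have "l = g t" using der[of t] y' l DERIV_unique by fastforce
      ultimately show ?thesis by (intro exI[of _ t]) (auto simp: algebra_simps)
    qed
    then obtain t where t: "\<bar>t - a\<bar> < \<bar>y - a\<bar>" "f y - f a = (y - a) * g t" by blast
    then have "(f y - f a) / (y - a) = g t" using y by simp
    then show "dist ((f y - f a) / (y - a)) (g a) < e"
      using d'(2)[of t] t(1) y' by (simp add: dist_real_def)
  qed (use d d' in auto)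
qed

definition reflect2 :: "real^2 \<Rightarrow> real^2" where
  "reflect2 z = vector [z $ 1, - (z $ 2)]"

lemma reflect2_nth [simp]: "reflect2 z $ 1 = z $ 1" "reflect2 z $ 2 = - (z $ 2)"
  by (simp_all add: reflect2_def)

lemma reflect2_axis [simp]: "reflect2 (axis 1 1) = axis 1 1" "reflect2 (axis 2 1) = - axis 2 1"
  by (simp_all add: vec_eq_iff forall_2 axis_def)

lemma bounded_linear_reflect2: "bounded_linear reflect2"
  by (intro linear_conv_bounded_linear[THEN iffD1] linearI) (simp_all add: vec_eq_iff forall_2)

text \<open>The chain rule for \<open>k = k o reflect2\<close>: the derivative of an even function
  along the first axis is even, along the second axis odd.\<close>

lemma D_even:
  fixes k :: "real^2 \<Rightarrow> real"
  assumes "\<And>z. z \<in> N \<Longrightarrow> smooth_at k z" "\<And>z. z \<in> N \<Longrightarrow> k (reflect2 z) = k z" "open N" "z \<in> N" "reflect2 z \<in> N"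
  shows "D k z v = D k (reflect2 z) (reflect2 v)"
proof -
  have "D k z v = D (\<lambda>z. k (reflect2 z)) z v"
    by (rule fun_cong[OF D_cong_ev]) (use assms eventually_nhds in \<open>metis (mono_tags, lifting)\<close>)
  also have "\<dots> = D k (reflect2 z) (D reflect2 z v)"
    by (rule D_compose) (use assms smooth_at_bounded_linear[OF bounded_linear_reflect2] in auto)
  finally show ?thesis by (simp add: D_linear[OF bounded_linear_reflect2])
qed

text \<open>
  Seeley's extension of \<open>k0 (u, s Y)\<close>, where \<open>s Y = sqrt (Y / (1 + Y))\<close>, to negative \<open>Y\<close>. As \<open>s\<close> has
  values in a bounded interval, no cutoff function is needed. The functions \<open>E n k\<close> of the proof
  form a class closed under partial derivatives: differentiation in \<open>u\<close> replaces \<open>k\<close> by its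
  derivative, and differentiation in \<open>Y\<close> leads to \<open>E (Suc n) k'\<close> with another even \<open>k'\<close>.
\<close>

lemma reflection_extension:
  fixes k0 :: "real^2 \<Rightarrow> real"
  assumes r: "0 < r'" "r' < r" "1 < R"
    and k0: "\<And>z. z \<in> box2 r R \<Longrightarrow> smooth_at k0 z" "\<And>z. z \<in> box2 r R \<Longrightarrow> k0 (reflect2 z) = k0 z"
  obtains F :: "real^2 \<Rightarrow> real" where "\<And>z. \<bar>z $ 1\<bar> < r' \<Longrightarrow> smooth_at F z"
    "\<And>z. 0 \<le> z $ 2 \<Longrightarrow> F z = k0 (vector [z $ 1, sqrt (z $ 2 / (1 + z $ 2))])"
proof -
  obtain a :: "nat \<Rightarrow> real" where a: "\<And>n. summable (\<lambda>j. \<bar>a j * (- (8 ^ j)) ^ n\<bar>)"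
    "\<And>n. (\<Sum>j. a j * (- (8 ^ j)) ^ n) = 1"
    using reflection_weights by blast
  define s where "s T = sqrt (T / (1 + T))" for T :: real
  have s01: "0 \<le> s T" "s T < 1" if "0 \<le> T" for T using that by (auto simp: s_def)
  have s0 [simp]: "s 0 = 0" by (simp add: s_def)
  have s_cont: "continuous_on {0..} s"
    unfolding s_def by (auto intro!: continuous_intros)
  have s_pos: "s T > 0" if "T > 0" for T using that by (simp add: s_def)
  \<comment> \<open>The derivative is expressed through \<open>s T\<close> itself: the numerator is
    polynomial in \<open>s T\<close>, and the factor \<open>1 / s T\<close> will be absorbed by the
    oddness of the second partial derivative.\<close>
  have s_der: "(s has_real_derivative (1 - (s T)\<^sup>2)\<^sup>2 / (2 * s T)) (at T)" if T: "T > 0" for T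
  proof -
    have "((\<lambda>T. T / (1 + T)) has_real_derivative (1 + T - T) / (1 + T)\<^sup>2) (at T)"
      using T by (auto intro!: derivative_eq_intros simp: power2_eq_square)
    from DERIV_chain2[OF DERIV_real_sqrt this]
    have "(s has_real_derivative inverse (sqrt (T / (1 + T))) / 2 * ((1 + T - T) / (1 + T)\<^sup>2)) (at T)"
      unfolding s_def using T by simp
    moreover have "(s T)\<^sup>2 = T / (1 + T)"
      unfolding s_def by (rule real_sqrt_pow2) (use T in simp)
    then have q: "1 - (s T)\<^sup>2 = 1 / (1 + T)" using T by (simp add: field_simps)
    have "inverse (s T) / 2 * ((1 + T - T) / (1 + T)\<^sup>2) = (1 - (s T)\<^sup>2)\<^sup>2 / (2 * s T)"
      unfolding q power_one_over by (simp add: inverse_eq_divide)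
    ultimately show ?thesis unfolding s_def[symmetric] by simp
  qed
  \<comment> \<open>Each differentiation in the second variable on the negative side produces the
    inner factor \<open>- (8 ^ j)\<close>; \<open>n\<close> counts these differentiations.\<close>
  define w where "w n j = a j * (- (8 ^ j)) ^ n" for n j
  have wS: "w (Suc n) j = - (8 ^ j) * w n j" for n j by (simp add: w_def)
  have w: "summable (\<lambda>j. \<bar>w n j\<bar>)" "(\<Sum>j. w n j) = 1" for n
    using a by (simp_all add: w_def)
  define K where "K = {k :: real^2 \<Rightarrow> real. (\<forall>z\<in>box2 r R. smooth_at k z) \<and> (\<forall>z\<in>box2 r R. k (reflect2 z) = k z)}"
  have refl_box: "reflect2 z \<in> box2 r R" if "z \<in> box2 r R" for z
    using that by (simp add: box2_def)
  have Kc: "continuous_on (box2 r R) k" if "k \<in> K" for k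
    using that unfolding K_def by (auto intro!: continuous_at_imp_continuous_on smooth_at_isCont)
  have in_box: "vector [u, \<sigma>] \<in> box2 r R" if "\<bar>u\<bar> \<le> r'" "0 \<le> \<sigma>" "\<sigma> \<le> 1" for u \<sigma>
    using that r by (simp add: box2_def)
  \<comment> \<open>The values of \<open>s\<close> lie in \<open>[0, 1]\<close>, so all arguments
    stay in a compact rectangle; \<open>r' < r\<close> and \<open>1 < R\<close> put it inside the
    open box. This makes the series uniformly convergent.\<close>
  have K_bound: "\<exists>B. \<forall>u \<sigma>. \<bar>u\<bar> \<le> r' \<longrightarrow> 0 \<le> \<sigma> \<longrightarrow> \<sigma> \<le> 1 \<longrightarrow> \<bar>k (vector [u, \<sigma>])\<bar> \<le> B" if "k \<in> K" for k
  proof -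
    let ?Q = "cbox (vector [-r', 0]) (vector [r', 1]) :: (real^2) set"
    have "?Q \<subseteq> box2 r R" using r by (auto simp: mem_box_cart forall_2 box2_def)
    then have "bounded (k ` ?Q)"
      using Kc[OF that] by (intro compact_imp_bounded compact_continuous_image continuous_on_subset[of _ k ?Q]) auto
    then obtain B where B: "\<forall>x\<in>?Q. \<bar>k x\<bar> \<le> B" by (auto simp: bounded_iff)
    have "vector [u, \<sigma>] \<in> ?Q" if "\<bar>u\<bar> \<le> r'" "0 \<le> \<sigma>" "\<sigma> \<le> 1" for u \<sigma>
      using that by (auto simp: mem_box_cart forall_2)
    then show ?thesis using B by blast
  qed
  define S where "S n k u T = (\<Sum>j. w n j * k (vector [u, s (8 ^ j * T)]))"
    for n :: nat and k :: "real^2 \<Rightarrow> real" and u T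
  have s8: "0 \<le> s (8 ^ j * T)" "s (8 ^ j * T) \<le> 1" if "0 \<le> T" for j :: nat and T
    using s01[of "8 ^ j * T"] that by auto
  have S_unif: "uniform_limit Z (\<lambda>N z. \<Sum>j<N. w n j * k (vector [U z, s (8 ^ j * T z)]))
      (\<lambda>z. S n k (U z) (T z)) sequentially"
    if k: "k \<in> K" and Z: "\<And>z. z \<in> Z \<Longrightarrow> \<bar>U z\<bar> < r' \<and> 0 \<le> T z"
    for Z :: "'z::topological_space set" and U T n k
  proof -
    obtain B where B: "\<And>u \<sigma>. \<bar>u\<bar> \<le> r' \<Longrightarrow> 0 \<le> \<sigma> \<Longrightarrow> \<sigma> \<le> 1 \<Longrightarrow> \<bar>k (vector [u, \<sigma>])\<bar> \<le> B"
      using K_bound[OF k] by blast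
    show ?thesis
      unfolding S_def
    proof (rule Weierstrass_m_test[where M="\<lambda>j. \<bar>w n j\<bar> * B"])
      show "norm (w n j * k (vector [U z, s (8 ^ j * T z)])) \<le> \<bar>w n j\<bar> * B" if "z \<in> Z" for j z
        unfolding real_norm_def abs_mult
        by (intro mult_left_mono B) (use Z[OF that] s8 in auto)
      show "summable (\<lambda>j. \<bar>w n j\<bar> * B)" by (intro summable_mult2 w)
    qed
  qed
  have S_summable: "summable (\<lambda>j. w n j * k (vector [u, s (8 ^ j * T)]))"
    if k: "k \<in> K" "\<bar>u\<bar> < r'" "0 \<le> T" for n k u T
  proof -
    obtain B where B: "\<And>u \<sigma>. \<bar>u\<bar> \<le> r' \<Longrightarrow> 0 \<le> \<sigma> \<Longrightarrow> \<sigma> \<le> 1 \<Longrightarrow> \<bar>k (vector [u, \<sigma>])\<bar> \<le> B"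
      using K_bound[OF k(1)] by blast
    show ?thesis
    proof (rule summable_comparison_test'[where g="\<lambda>j. \<bar>w n j\<bar> * B"])
      show "norm (w n j * k (vector [u, s (8 ^ j * T)])) \<le> \<bar>w n j\<bar> * B" for j
        unfolding real_norm_def abs_mult
        by (intro mult_left_mono B) (use k s8 in auto)
      show "summable (\<lambda>j. \<bar>w n j\<bar> * B)" by (intro summable_mult2 w)
    qed
  qed
  define E where "E n k z = (if z $ 2 \<le> 0 then S n k (z $ 1) (- (z $ 2)) else k (vector [z $ 1, s (z $ 2)]))"
    for n k and z :: "real^2"
  \<comment> \<open>At \<open>T = 0\<close> all nodes collapse and the sum of the weights remains,
    which is \<open>1\<close> for every \<open>n\<close>. Hence the two branches of
    \<open>E n k\<close> agree on the first axis at every stage of differentiation.\<close>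
  have S0: "S n k u 0 = k (vector [u, 0])" for n k u
    using suminf_mult2[OF summable_rabs_cancel[OF w(1)], of n "k (vector [u, 0])"] by (simp add: S_def w)
  have E_pos: "E n k z = k (vector [z $ 1, s (z $ 2)])" if "0 \<le> z $ 2" for n k z
    using that S0 by (simp add: E_def)
  define M where "M = {z :: real^2. \<bar>z $ 1\<bar> < r'}"
  have M: "open M" unfolding M_def by (intro open_Collect_less continuous_intros)
  have E_cont: "continuous_on M (E n k)" if k: "k \<in> K" for n k
    unfolding E_def
  proof (rule continuous_on_cases_le)
    let ?Z = "{z \<in> M. z $ 2 \<le> 0}"
    show "continuous_on ?Z (\<lambda>z. S n k (z $ 1) (- (z $ 2)))"
    proof (rule uniform_limit_theorem[OF _ S_unif[OF k]])
      show "\<forall>\<^sub>F N in sequentially. continuous_on ?Z (\<lambda>z. \<Sum>j<N. w n j * k (vector [z $ 1, s (8 ^ j * - (z $ 2))]))"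
      proof (intro always_eventually allI continuous_intros continuous_on_compose2[OF Kc[OF k]]
            continuous_on_compose2[OF s_cont])
        fix j
        show "(\<lambda>z. vector [z $ 1, s (8 ^ j * - (z $ 2))]) ` ?Z \<subseteq> box2 r R"
        proof (rule image_subsetI)
          fix z assume "z \<in> ?Z"
          then show "vector [z $ 1, s (8 ^ j * - (z $ 2))] \<in> box2 r R"
            using s8[of "- (z $ 2)" j] by (intro in_box) (auto simp: M_def)
        qed
      qed (auto simp: mult_nonneg_nonpos)
    qed (auto simp: M_def)
    show "continuous_on {z \<in> M. 0 \<le> z $ 2} (\<lambda>z. k (vector [z $ 1, s (z $ 2)]))"
    proof (intro continuous_intros continuous_on_compose2[OF Kc[OF k]] continuous_on_compose2[OF s_cont])
      show "(\<lambda>z. vector [z $ 1, s (z $ 2)]) ` {z \<in> M. 0 \<le> z $ 2} \<subseteq> box2 r R"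
      proof (rule image_subsetI)
        fix z assume "z \<in> {z \<in> M. 0 \<le> z $ 2}"
        then show "vector [z $ 1, s (z $ 2)] \<in> box2 r R"
          using s01[of "z $ 2"] by (intro in_box) (auto simp: M_def)
      qed
    qed auto
  qed (use S0 in \<open>auto intro!: continuous_intros\<close>)
  have k_part: "((\<lambda>u. k (vector [u, \<sigma>])) has_real_derivative D k (vector [u, \<sigma>]) (axis 1 1)) (at u)"
    "((\<lambda>\<sigma>. k (vector [u, \<sigma>])) has_real_derivative D k (vector [u, \<sigma>]) (axis 2 1)) (at \<sigma>)"
    if "k \<in> K" "\<bar>u\<bar> < r'" "0 \<le> \<sigma>" "\<sigma> \<le> 1" for k u \<sigma>
    using smooth_at_partials[of k "vector [u, \<sigma>]"] in_box[of u \<sigma>] that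
    by (auto simp: K_def has_partials_def)
  have K1: "(\<lambda>z. D k z (axis 1 1)) \<in> K" if "k \<in> K" for k
    using that D_even[OF _ _ open_box2, of r R k _ "axis 1 1"] refl_box unfolding K_def by (auto intro!: sm)
  \<comment> \<open>The second partial derivative is odd, so by \<open>Hadamard\<close> it is
    \<open>z $ 2\<close> times an even function. The factor
    \<open>(1 - (z $ 2)\<^sup>2)\<^sup>2\<close> comes from \<open>s_der\<close>, and
    \<open>k'\<close> is chosen so that the \<open>T\<close>-derivative of
    \<open>k (vector [u, s T])\<close> is \<open>k' (vector [u, s T])\<close>.\<close>
  have K2: "\<exists>k'\<in>K. \<forall>z\<in>box2 r R. D k z (axis 2 1) * (1 - (z $ 2)\<^sup>2)\<^sup>2 = 2 * z $ 2 * k' z" if "k \<in> K" for k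
  proof -
    let ?g = "\<lambda>z. D k z (axis 2 1)"
    have gs: "\<And>z. z \<in> box2 r R \<Longrightarrow> smooth_at ?g z" using that unfolding K_def by (auto intro: sm)
    have godd: "?g (reflect2 z) = - ?g z" if z: "z \<in> box2 r R" for z
    proof -
      have "smooth_at k (reflect2 z)" using \<open>k \<in> K\<close> refl_box[OF z] by (simp add: K_def)
      from linear_neg[OF smooth_at_linear_D[OF this]] show ?thesis
        using \<open>k \<in> K\<close> D_even[OF _ _ open_box2 z refl_box[OF z], of k "axis 2 1"] by (auto simp: K_def)
    qed
    obtain \<kappa> where \<kappa>: "\<And>z. z \<in> box2 r R \<Longrightarrow> smooth_at \<kappa> z"
      "\<And>z. z \<in> box2 r R \<Longrightarrow> ?g z - ?g (vector [z $ 1, 0]) = z $ 2 * \<kappa> z"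
      using Hadamard[OF gs] by blast
    have g0: "?g (vector [z $ 1, 0]) = 0" if "z \<in> box2 r R" for z
    proof -
      have "vector [z $ 1, 0] \<in> box2 r R" "reflect2 (vector [z $ 1, 0]) = vector [z $ 1, 0]"
        using that r by (auto simp: box2_def vec_eq_iff forall_2)
      then show ?thesis using godd[of "vector [z $ 1, 0]"] by simp
    qed
    have \<kappa>g: "?g z = z $ 2 * \<kappa> z" if "z \<in> box2 r R" for z using \<kappa>(2) g0 that by simp
    have \<kappa>even: "\<kappa> (reflect2 z) = \<kappa> z" if "z \<in> box2 r R" for z
    proof (cases "z $ 2 = 0")
      case True
      then have "reflect2 z = z" by (simp add: vec_eq_iff forall_2)
      then show ?thesis by simp
    next
      case False
      then show ?thesis using \<kappa>g[OF that] \<kappa>g[OF refl_box[OF that]] godd[OF that] by simp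
    qed
    show ?thesis
    proof (rule bexI[of _ "\<lambda>z. \<kappa> z / 2 * (1 - (z $ 2)\<^sup>2)\<^sup>2"])
      show "(\<lambda>z. \<kappa> z / 2 * (1 - (z $ 2)\<^sup>2)\<^sup>2) \<in> K"
        unfolding K_def using \<kappa>(1) \<kappa>even by (auto intro!: sm)
    qed (simp add: \<kappa>g)
  qed
  define C where "C = {E n k | n k. k \<in> K}"
  have C_hd: "higher_differentiable_on M m f" if "f \<in> C" for m f
  proof (rule hd_of_partials_class[where C=C, OF M _ _ that])
    fix f assume "f \<in> C"
    then obtain n k where f: "f = E n k" and k: "k \<in> K" unfolding C_def by blast
    show "continuous_on M f" unfolding f by (rule E_cont[OF k])
    obtain k' where k': "k' \<in> K"
      and k'eq: "\<And>z. z \<in> box2 r R \<Longrightarrow> D k z (axis 2 1) * (1 - (z $ 2)\<^sup>2)\<^sup>2 = 2 * z $ 2 * k' z"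
      using K2[OF k] by blast
    let ?k1 = "\<lambda>z. D k z (axis 1 1)"
    have ks: "((\<lambda>T. k (vector [u, s T])) has_real_derivative k' (vector [u, s T])) (at T)"
      if "\<bar>u\<bar> < r'" "T > 0" for u T
    proof -
      have sT: "0 < s T" "s T \<le> 1" using s_pos s01(2)[of T] that by auto
      have "((\<lambda>T. k (vector [u, s T])) has_real_derivative
          D k (vector [u, s T]) (axis 2 1) * ((1 - (s T)\<^sup>2)\<^sup>2 / (2 * s T))) (at T)"
        by (rule DERIV_chain2[OF k_part(2)[OF k that(1)] s_der[OF that(2)]]) (use sT in auto)
      moreover have "D k (vector [u, s T]) (axis 2 1) * ((1 - (s T)\<^sup>2)\<^sup>2 / (2 * s T)) = k' (vector [u, s T])"
        using k'eq[OF in_box[of u "s T"]] that sT by (simp add: field_simps)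
      ultimately show ?thesis by simp
    qed
    show "\<exists>A\<in>C. \<exists>B\<in>C. \<forall>y\<in>M. has_partials f (A y) (B y) y"
    proof (rule bexI[of _ "E n ?k1"], rule bexI[of _ "E (Suc n) k'"], rule ballI)
      show "E n ?k1 \<in> C" "E (Suc n) k' \<in> C" unfolding C_def using K1[OF k] k' by blast+
      fix y assume "y \<in> M"
      then have y: "\<bar>y $ 1\<bar> < r'" by (simp add: M_def)
      have 1: "((\<lambda>u. E n k (vector [u, y $ 2])) has_real_derivative E n ?k1 y) (at (y $ 1))"
      proof (cases "y $ 2 \<le> 0")
        case True
        let ?S = "{-r'<..<r'}"
        have "((\<lambda>u. \<Sum>j. w n j * k (vector [u, s (8 ^ j * - (y $ 2))])) has_real_derivative
            (\<Sum>j. w n j * ?k1 (vector [y $ 1, s (8 ^ j * - (y $ 2))]))) (at (y $ 1))"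
        proof (rule has_field_derivative_series'(2)[where S="?S" and ?x0.0="y $ 1"])
          fix j u assume "u \<in> ?S"
          then have "\<bar>u\<bar> < r'" by auto
          moreover have "0 \<le> - (y $ 2)" using True by simp
          ultimately show "((\<lambda>u. w n j * k (vector [u, s (8 ^ j * - (y $ 2))])) has_real_derivative
            w n j * ?k1 (vector [u, s (8 ^ j * - (y $ 2))])) (at u within ?S)"
            by (intro has_field_derivative_at_within[OF DERIV_cmult[OF k_part(1)[OF k]]] s8)
        next
          show "uniformly_convergent_on ?S (\<lambda>N u. \<Sum>j<N. w n j * ?k1 (vector [u, s (8 ^ j * - (y $ 2))]))"
            by (rule uniformly_convergentI, rule S_unif[OF K1[OF k], of _ "\<lambda>u. u" "\<lambda>u. - (y $ 2)"]) (use True in auto)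
          show "summable (\<lambda>j. w n j * k (vector [y $ 1, s (8 ^ j * - (y $ 2))]))"
            by (rule S_summable[OF k y]) (use True in auto)
        qed (use y in auto)
        then show ?thesis using True by (simp add: E_def S_def)
      next
        case False
        then show ?thesis using k_part(1)[OF k y] s01[of "y $ 2"] by (simp add: E_def)
      qed
      have 2: "((\<lambda>t. E n k (vector [y $ 1, t])) has_real_derivative E (Suc n) k' (vector [y $ 1, t])) (at t)"
        if t: "t \<noteq> 0" for t
      proof (cases "t < 0")
        case True
        let ?S = "{..<0 :: real}"
        have "((\<lambda>t. \<Sum>j. w n j * k (vector [y $ 1, s (8 ^ j * - t)])) has_real_derivative
            (\<Sum>j. w (Suc n) j * k' (vector [y $ 1, s (8 ^ j * - t)]))) (at t)"
        proof (rule has_field_derivative_series'(2)[where S="?S" and ?x0.0=t])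
          fix j and t :: real assume "t \<in> ?S"
          then have "8 ^ j * - t > 0" by (simp add: mult_pos_neg)
          moreover have "((\<lambda>t. 8 ^ j * - t) has_real_derivative - (8 ^ j)) (at t)"
            by (auto intro!: derivative_eq_intros)
          ultimately have "((\<lambda>t. k (vector [y $ 1, s (8 ^ j * - t)])) has_real_derivative
              k' (vector [y $ 1, s (8 ^ j * - t)]) * - (8 ^ j)) (at t)"
            by (intro DERIV_chain2[OF ks[OF y]])
          then show "((\<lambda>t. w n j * k (vector [y $ 1, s (8 ^ j * - t)])) has_real_derivative
            w (Suc n) j * k' (vector [y $ 1, s (8 ^ j * - t)])) (at t within ?S)"
            unfolding wS by (auto intro!: derivative_eq_intros intro: has_field_derivative_at_within)
        next
          show "uniformly_convergent_on ?S (\<lambda>N t. \<Sum>j<N. w (Suc n) j * k' (vector [y $ 1, s (8 ^ j * - t)]))"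
            by (rule uniformly_convergentI, rule S_unif[OF k', of _ "\<lambda>t. y $ 1" "\<lambda>t. - t"]) (use y in auto)
          show "summable (\<lambda>j. w n j * k (vector [y $ 1, s (8 ^ j * - t)]))"
            by (rule S_summable[OF k y]) (use True in auto)
        qed (use True in \<open>auto simp: interior_open\<close>)
        then have "((\<lambda>t. \<Sum>j. w n j * k (vector [y $ 1, s (8 ^ j * - t)])) has_real_derivative E (Suc n) k' (vector [y $ 1, t])) (at t)"
          using True by (simp add: E_def S_def)
        then show ?thesis
          by (rule has_field_derivative_transform_within_open[where S="?S"]) (use True in \<open>auto simp: E_def S_def\<close>)
      next
        case False
        then have "((\<lambda>t. k (vector [y $ 1, s t])) has_real_derivative E (Suc n) k' (vector [y $ 1, t])) (at t)"
          using ks[OF y, of t] t by (simp add: E_def)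
        then show ?thesis
          by (rule has_field_derivative_transform_within_open[where S="{0<..}"]) (use False t in \<open>auto simp: E_def\<close>)
      qed
      have cont: "isCont (\<lambda>t. E m k (vector [y $ 1, t])) t" if "k \<in> K" for m k t
      proof -
        have "continuous_on UNIV (\<lambda>t. E m k (vector [y $ 1, t]))"
          by (rule continuous_on_compose2[OF E_cont[OF that, of m]])
            (use y in \<open>auto intro!: continuous_intros simp: M_def\<close>)
        then show ?thesis by (simp add: continuous_on_eq_continuous_at)
      qed
      \<comment> \<open>Off the axis both branches are differentiable; at \<open>t = 0\<close>
        continuity of the candidate derivative \<open>E (Suc n) k'\<close> suffices.\<close>
      have 3: "((\<lambda>t. E n k (vector [y $ 1, t])) has_real_derivative E (Suc n) k' (vector [y $ 1, t])) (at t)" for t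
      proof (cases "t = 0")
        case True
        show ?thesis
          unfolding True
          by (rule has_real_derivative_of_limit[where d=1 and g="\<lambda>t. E (Suc n) k' (vector [y $ 1, t])"])
            (use cont[OF k] cont[OF k'] 2 in auto)
      qed (use 2 in auto)
      show "has_partials f (E n ?k1 y) (E (Suc n) k' y) y"
        unfolding has_partials_def f using 1 3[of "y $ 2"] by simp
    qed
  qed
  have E0: "E 0 k0 \<in> C" unfolding C_def K_def using k0 by blast
  show ?thesis
  proof (rule that[of "E 0 k0"])
    fix z :: "real^2" assume "\<bar>z $ 1\<bar> < r'"
    then show "smooth_at (E 0 k0) z"
      using smooth_at_openI[OF M _ C_hd[OF E0]] by (simp add: M_def)
  qed (simp add: E_pos s_def)
qed

lemma box2_nhds:
  assumes "eventually P (nhds (0 :: real^2))"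
  obtains d where "d > 0" "\<And>z. z \<in> box2 d d \<Longrightarrow> P z"
proof -
  obtain e where e: "e > 0" "\<And>z::real^2. dist z 0 < e \<Longrightarrow> P z"
    using assms unfolding eventually_nhds_metric by blast
  have "dist z 0 < e" if "z \<in> box2 (e / 2) (e / 2)" for z
    using that norm_le_l1_cart[of z] by (simp add: box2_def UNIV_2)
  then show ?thesis using e that[of "e / 2"] by simp
qed

text \<open>Rescaling the second variable by \<open>d / 2\<close> creates a box of height
  \<open>2\<close>, as \<open>reflection_extension\<close> asks for a height above \<open>1\<close>.
  Evenness replaces the absolute value of \<open>z $ 2\<close>, which the square root returns, by
  \<open>z $ 2\<close>.\<close>

lemma even_function:
  fixes g :: "real^2 \<Rightarrow> real"
  assumes g: "smooth_at g 0" and even: "\<forall>\<^sub>F z in nhds 0. g (reflect2 z) = g z"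
  obtains G :: "real^2 \<Rightarrow> real" where "smooth_at G 0" "\<forall>\<^sub>F z in nhds 0. g z = G (vector [z $ 1, (z $ 2)\<^sup>2])"
proof -
  obtain d where d: "d > 0" "\<And>z. z \<in> box2 d d \<Longrightarrow> smooth_at g z \<and> g (reflect2 z) = g z"
    using eventually_conj[OF smooth_at_eventually[OF g] even] by (rule box2_nhds) blast
  define k where "k z = g (vector [z $ 1, d / 2 * z $ 2])" for z :: "real^2"
  have sc: "vector [z $ 1, d / 2 * z $ 2] \<in> box2 d d" if "z \<in> box2 d 2" for z :: "real^2"
    using that d(1) by (simp add: box2_def abs_mult)
  have 1: "smooth_at k z" if "z \<in> box2 d 2" for z
    unfolding k_def by (rule smooth_at_compose) (use d(2)[OF sc[OF that]] in \<open>auto intro!: sm\<close>)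
  have 2: "k (reflect2 z) = k z" if "z \<in> box2 d 2" for z
    using d(2)[OF sc[OF that]] by (simp add: k_def reflect2_def)
  obtain F :: "real^2 \<Rightarrow> real" where F: "\<And>z. \<bar>z $ 1\<bar> < d / 2 \<Longrightarrow> smooth_at F z"
    "\<And>z. 0 \<le> z $ 2 \<Longrightarrow> F z = k (vector [z $ 1, sqrt (z $ 2 / (1 + z $ 2))])"
    by (rule reflection_extension[of "d / 2" d 2 k]) (use d(1) 1 2 in auto)
  \<comment> \<open>At \<open>(z $ 1, (z $ 2)\<^sup>2)\<close> the value of \<open>q\<close> is the
    square of \<open>2 * z $ 2 / d\<close>. The substitution \<open>q / (1 - q)\<close> in
    \<open>G\<close> inverts \<open>Y / (1 + Y)\<close>.\<close>
  define q where "q z = 4 / d\<^sup>2 * z $ 2" for z :: "real^2"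
  define G where "G z = F (vector [z $ 1, q z / (1 - q z)])" for z
  have "smooth_at G 0"
    unfolding G_def
  proof (rule smooth_at_compose[where g=F])
    show "smooth_at F (vector [0 $ 1, q 0 / (1 - q 0)])" using d(1) by (intro F) simp
    show "smooth_at (\<lambda>z. vector [z $ 1, q z / (1 - q z)] :: real^2) 0"
      unfolding q_def by (intro sm) simp
  qed
  moreover have "\<forall>\<^sub>F z in nhds 0. g z = G (vector [z $ 1, (z $ 2)\<^sup>2])"
    unfolding eventually_nhds
  proof (intro exI[of _ "box2 (d / 2) (d / 2)"] conjI ballI)
    fix z assume z: "z \<in> box2 (d / 2) (d / 2)"
    have zd: "z \<in> box2 d d" using z by (auto simp: box2_def)
    define Q where "Q = (2 * \<bar>z $ 2\<bar> / d)\<^sup>2"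
    have "2 * \<bar>z $ 2\<bar> / d < 1" using z d(1) by (simp add: box2_def field_simps)
    then have Q: "0 \<le> Q" "Q < 1" unfolding Q_def using d(1) by (auto intro: power_less_one_iff[THEN iffD2])
    have "q (vector [z $ 1, (z $ 2)\<^sup>2]) = Q" by (simp add: q_def Q_def power_divide power_mult_distrib)
    moreover have "Q / (1 - Q) / (1 + Q / (1 - Q)) = Q" using Q by (simp add: field_simps)
    moreover have "sqrt Q = 2 * \<bar>z $ 2\<bar> / d" using d(1) by (simp add: Q_def)
    ultimately have "G (vector [z $ 1, (z $ 2)\<^sup>2]) = g (vector [z $ 1, \<bar>z $ 2\<bar>])"
      using Q d(1) by (simp add: G_def F(2) k_def)
    also have "\<dots> = g z"
      using d(2)[OF zd] by (cases "z $ 2 \<ge> 0") (auto simp: reflect2_def)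
    finally show "g z = G (vector [z $ 1, (z $ 2)\<^sup>2])" ..
  qed (rule open_box2, use d(1) in \<open>simp add: box2_def\<close>)
  ultimately show ?thesis by (rule that)
qed

section \<open>Local diffeomorphisms and presentations of germs\<close>

lemma smooth_inverse_function_within:
  fixes f :: "real^'n \<Rightarrow> real^'n"
  assumes f: "smooth_at f p" "inj (D f p)" and P: "eventually P (nhds p)"
  obtains V W g where "open V" "open W" "p \<in> V" "homeomorphism V W f g" "\<And>z. z \<in> V \<Longrightarrow> P z"
    "\<And>z. z \<in> V \<Longrightarrow> smooth_at f z" "\<And>y. y \<in> W \<Longrightarrow> smooth_at g y"
proof -
  obtain O1 where O1: "open O1" "p \<in> O1" "\<And>z. z \<in> O1 \<Longrightarrow> P z"
    using P unfolding eventually_nhds by blast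
  obtain V W g where VW: "open V" "open W" "p \<in> V" "homeomorphism V W f g"
    "\<And>z. z \<in> V \<Longrightarrow> smooth_at f z" "\<And>y. y \<in> W \<Longrightarrow> smooth_at g y"
    by (rule smooth_inverse_function[OF f]) blast
  have "continuous_on W g" using VW(4) by (simp add: homeomorphism_def)
  then have o: "open (W \<inter> g -` (V \<inter> O1))"
    by (metis continuous_on_open_vimage VW(1,2) O1(1) open_Int Int_commute)
  have img: "f ` (V \<inter> O1) = W \<inter> g -` (V \<inter> O1)"
    using VW(4) by (auto simp: homeomorphism_def image_iff)
  show ?thesis
  proof (rule that[of "V \<inter> O1" "W \<inter> g -` (V \<inter> O1)" g])
    show "homeomorphism (V \<inter> O1) (W \<inter> g -` (V \<inter> O1)) f g"
      by (rule homeomorphism_of_subsets[OF VW(4)]) (use img in auto)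
  qed (use VW O1 o in auto)
qed

lemma eventually_nhds_smooth:
  assumes "smooth_at f z" "eventually P (nhds (f z))" shows "\<forall>\<^sub>F y in nhds z. P (f y)"
proof -
  have "(f \<longlongrightarrow> f z) (nhds z)"
    using smooth_at_isCont[OF assms(1)] by (simp add: isCont_def tendsto_at_iff_tendsto_nhds)
  then show ?thesis using assms(2) by (rule eventually_compose_filterlim[rotated])
qed

text \<open>Differentiates \<open>g (f z) = z\<close>. This spares computing derivatives of
  diffeomorphisms and charts whose left inverse is at hand.\<close>

lemma inj_D_of_left_inverse:
  fixes f :: "'a::euclidean_space \<Rightarrow> 'b::euclidean_space" and g :: "'b \<Rightarrow> 'a"
  assumes "smooth_at f p" "smooth_at g (f p)" "\<forall>\<^sub>F z in nhds p. g (f z) = z"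
  shows "inj (D f p)"
proof (rule inj_on_inverseI[where g = "D g (f p)"])
  fix v
  have "D (\<lambda>z. g (f z)) p v = D (\<lambda>z. z) p v" using D_cong_ev[OF assms(3)] by simp
  then show "D g (f p) (D f p v) = v" using D_compose[OF assms(2,1)] by simp
qed

lemma local_inverse:
  fixes f :: "real^'n \<Rightarrow> real^'n"
  assumes f: "smooth_at f p" "inj (D f p)"
  obtains g where "smooth_at g (f p)" "inj (D g (f p))" "g (f p) = p"
    "\<forall>\<^sub>F z in nhds p. g (f z) = z" "\<forall>\<^sub>F y in nhds (f p). f (g y) = y"
proof -
  obtain V W g where VW: "open V" "open W" "p \<in> V" "homeomorphism V W f g"
    "\<And>z. z \<in> V \<Longrightarrow> smooth_at f z" "\<And>y. y \<in> W \<Longrightarrow> smooth_at g y"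
    by (rule smooth_inverse_function[OF f]) blast
  have fp: "f p \<in> W" "g (f p) = p" using VW(3,4) by (auto simp: homeomorphism_def)
  have 1: "\<forall>\<^sub>F z in nhds p. g (f z) = z"
    unfolding eventually_nhds using VW(1,3,4) by (auto simp: homeomorphism_def)
  have 2: "\<forall>\<^sub>F y in nhds (f p). f (g y) = y"
    unfolding eventually_nhds using VW(2,4) fp by (auto simp: homeomorphism_def)
  have "inj (D g (f p))"
    by (rule inj_D_of_left_inverse[where g=f]) (use VW fp 2 in auto)
  then show ?thesis using that[of g] VW fp 1 2 by blast
qed

text \<open>A germ version of \<open>A_equivalent\<close> without domains: \<theta> is the source
  change, and \<Phi> plays the part of the inverse of the target change, as an immersion germ of
  \<open>real^3\<close> into the hyperboloid. All later coordinate changes thus take place in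
  \<open>real^2\<close> and \<open>real^3\<close>.\<close>

definition presents :: "(real^2 \<Rightarrow> real^4) \<Rightarrow> real^2 \<Rightarrow> (real^2 \<Rightarrow> real^3) \<Rightarrow> bool" where
  "presents x p F \<longleftrightarrow> smooth_at F 0 \<and> F 0 = 0 \<and>
    (\<exists>\<Phi> \<theta>. smooth_at \<Phi> 0 \<and> inj (D \<Phi> 0) \<and> (\<forall>\<^sub>F w in nhds 0. \<Phi> w \<in> H3) \<and>
       smooth_at \<theta> p \<and> inj (D \<theta> p) \<and> \<theta> p = 0 \<and> (\<forall>\<^sub>F z in nhds p. x z = \<Phi> (F (\<theta> z))))"

text \<open>The change \<sigma> is absorbed into \<theta>. The relation
  \<open>F z = G (\<sigma> z)\<close> avoids any mention of the inverse of \<sigma>.\<close>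

lemma presents_source:
  fixes \<sigma> :: "real^2 \<Rightarrow> real^2"
  assumes "presents x p F" and \<sigma>: "smooth_at \<sigma> 0" "inj (D \<sigma> 0)" "\<sigma> 0 = 0"
    and G: "smooth_at G 0" "\<forall>\<^sub>F z in nhds 0. F z = G (\<sigma> z)"
  shows "presents x p G"
proof -
  obtain \<Phi> \<theta> where \<Phi>: "smooth_at \<Phi> 0" "inj (D \<Phi> 0)" "\<forall>\<^sub>F w in nhds 0. \<Phi> w \<in> H3"
    and \<theta>: "smooth_at \<theta> p" "inj (D \<theta> p)" "\<theta> p = 0"
    and x: "\<forall>\<^sub>F z in nhds p. x z = \<Phi> (F (\<theta> z))" and F: "F 0 = 0"
    using assms(1) unfolding presents_def by blast
  have "D (\<lambda>z. \<sigma> (\<theta> z)) p = D \<sigma> 0 \<circ> D \<theta> p"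
    using D_compose[of \<sigma> \<theta> p] \<sigma> \<theta> by (auto simp: fun_eq_iff)
  then have "inj (D (\<lambda>z. \<sigma> (\<theta> z)) p)" using \<sigma> \<theta> inj_compose by metis
  moreover have "smooth_at (\<lambda>z. \<sigma> (\<theta> z)) p"
    by (rule smooth_at_compose) (use \<sigma> \<theta> in auto)
  moreover have "\<forall>\<^sub>F z in nhds p. F (\<theta> z) = G (\<sigma> (\<theta> z))"
    by (rule eventually_nhds_smooth[OF \<theta>(1)]) (use G \<theta> in auto)
  then have "\<forall>\<^sub>F z in nhds p. x z = \<Phi> (G (\<sigma> (\<theta> z)))"
    using x by eventually_elim simp
  moreover have "G 0 = 0" using eventually_nhds_x_imp_x[OF G(2)] F \<sigma> by simp
  ultimately show ?thesis
    unfolding presents_def using \<Phi> G \<theta> \<sigma>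
    by (intro conjI exI[of _ \<Phi>] exI[of _ "\<lambda>z. \<sigma> (\<theta> z)"]) auto
qed

text \<open>The change \<Psi> is absorbed into \<Phi>.\<close>

lemma presents_target:
  fixes \<Psi> :: "real^3 \<Rightarrow> real^3"
  assumes "presents x p F" and \<Psi>: "smooth_at \<Psi> 0" "inj (D \<Psi> 0)" "\<Psi> 0 = 0"
    and G: "smooth_at G 0" "G 0 = 0" "\<forall>\<^sub>F z in nhds 0. F z = \<Psi> (G z)"
  shows "presents x p G"
proof -
  obtain \<Phi> \<theta> where \<Phi>: "smooth_at \<Phi> 0" "inj (D \<Phi> 0)" "\<forall>\<^sub>F w in nhds 0. \<Phi> w \<in> H3"
    and \<theta>: "smooth_at \<theta> p" "inj (D \<theta> p)" "\<theta> p = 0"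
    and x: "\<forall>\<^sub>F z in nhds p. x z = \<Phi> (F (\<theta> z))"
    using assms(1) unfolding presents_def by blast
  have "D (\<lambda>z. \<Phi> (\<Psi> z)) 0 = D \<Phi> 0 \<circ> D \<Psi> 0"
    using D_compose[of \<Phi> \<Psi> 0] \<Phi> \<Psi> by (auto simp: fun_eq_iff)
  then have "inj (D (\<lambda>z. \<Phi> (\<Psi> z)) 0)" using \<Phi> \<Psi> inj_compose by metis
  moreover have "smooth_at (\<lambda>z. \<Phi> (\<Psi> z)) 0"
    by (rule smooth_at_compose) (use \<Phi> \<Psi> in auto)
  moreover have "\<forall>\<^sub>F w in nhds 0. \<Phi> (\<Psi> w) \<in> H3"
    by (rule eventually_nhds_smooth[OF \<Psi>(1)]) (use \<Phi> \<Psi> in auto)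
  moreover have "\<forall>\<^sub>F z in nhds p. F (\<theta> z) = \<Psi> (G (\<theta> z))"
    by (rule eventually_nhds_smooth[OF \<theta>(1)]) (use G \<theta> in auto)
  then have "\<forall>\<^sub>F z in nhds p. x z = \<Phi> (\<Psi> (G (\<theta> z)))"
    using x by eventually_elim simp
  ultimately show ?thesis
    unfolding presents_def using G \<theta>
    by (intro conjI exI[of _ "\<lambda>z. \<Phi> (\<Psi> z)"] exI[of _ \<theta>]) auto
qed

text \<open>Converse direction to \<open>presents_source\<close>, obtained by applying that lemma to
  a local inverse of \<sigma>.\<close>

lemma presents_compose_source:
  fixes \<sigma> :: "real^2 \<Rightarrow> real^2"
  assumes x: "presents x p F" and \<sigma>: "smooth_at \<sigma> 0" "inj (D \<sigma> 0)" "\<sigma> 0 = 0"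
  shows "presents x p (\<lambda>z. F (\<sigma> z))"
proof -
  obtain g where g: "smooth_at g (\<sigma> 0)" "inj (D g (\<sigma> 0))" "g (\<sigma> 0) = 0"
    "\<forall>\<^sub>F z in nhds 0. g (\<sigma> z) = z" "\<forall>\<^sub>F y in nhds (\<sigma> 0). \<sigma> (g y) = y"
    by (rule local_inverse[OF \<sigma>(1,2)]) blast
  have F: "smooth_at F 0" using x by (simp add: presents_def)
  show ?thesis
  proof (rule presents_source[OF x])
    show "smooth_at (\<lambda>z. F (\<sigma> z)) 0" by (rule smooth_at_compose) (use F \<sigma> in auto)
    show "\<forall>\<^sub>F z in nhds 0. F z = F (\<sigma> (g z))" using g(5) \<sigma>(3) by (auto elim: eventually_mono)
  qed (use g \<sigma> in auto)
qed

lemma presents_compose_target: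
  fixes \<kappa> :: "real^3 \<Rightarrow> real^3"
  assumes x: "presents x p F" and \<kappa>: "smooth_at \<kappa> 0" "inj (D \<kappa> 0)" "\<kappa> 0 = 0"
  shows "presents x p (\<lambda>z. \<kappa> (F z))"
proof -
  obtain g where g: "smooth_at g (\<kappa> 0)" "inj (D g (\<kappa> 0))" "g (\<kappa> 0) = 0"
    "\<forall>\<^sub>F z in nhds 0. g (\<kappa> z) = z" "\<forall>\<^sub>F y in nhds (\<kappa> 0). \<kappa> (g y) = y"
    by (rule local_inverse[OF \<kappa>(1,2)]) blast
  have F: "smooth_at F 0" "F 0 = 0" using x by (simp_all add: presents_def)
  show ?thesis
  proof (rule presents_target[OF x])
    show "smooth_at (\<lambda>z. \<kappa> (F z)) 0" by (rule smooth_at_compose) (use F \<kappa> in auto)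
    show "\<forall>\<^sub>F z in nhds 0. F z = g (\<kappa> (F z))"
      by (rule eventually_nhds_smooth[OF F(1)]) (use g(4) F in \<open>auto elim: eventually_mono\<close>)
  qed (use g \<kappa> F in auto)
qed

lemma presents_cong:
  assumes "presents x p F" "\<forall>\<^sub>F z in nhds 0. F z = G z" shows "presents x p G"
proof -
  have "inj (D (\<lambda>z::real^2. z) 0)" by (simp add: inj_def)
  then show ?thesis
    using presents_source[OF assms(1), of "\<lambda>z. z" G] assms smooth_at_cong_ev[of F 0 G]
    by (auto simp: presents_def)
qed

section \<open>The hyperboloid chart\<close>

text \<open>The hyperboloid is the graph of \<open>sqrt (1 + norm w ^ 2)\<close> over the last three
  coordinates, so forgetting the first coordinate is a global chart, with inverse
  \<open>lift4\<close>.\<close>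

definition proj3 :: "real^4 \<Rightarrow> real^3" where
  "proj3 x = vector [x $ 2, x $ 3, x $ 4]"

definition lift4 :: "real^3 \<Rightarrow> real^4" where
  "lift4 w = vector [sqrt (1 + (w $ 1)\<^sup>2 + (w $ 2)\<^sup>2 + (w $ 3)\<^sup>2), w $ 1, w $ 2, w $ 3]"

lemma proj3_nth [simp]: "proj3 x $ 1 = x $ 2" "proj3 x $ 2 = x $ 3" "proj3 x $ 3 = x $ 4"
  by (simp_all add: proj3_def)

lemma bounded_linear_proj3: "bounded_linear proj3"
  by (intro linear_conv_bounded_linear[THEN iffD1] linearI) (simp_all add: vec_eq_iff forall_3)

lemma sum_squares_pos: "1 + (a::real)\<^sup>2 + b\<^sup>2 + c\<^sup>2 > 0"
  by (intro add_pos_nonneg) auto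

lemma smooth_at_lift4: "smooth_at lift4 w"
  unfolding lift4_def by (intro sm sum_squares_pos)

lemma lift4_H3: "lift4 w \<in> H3"
  using sum_squares_pos[of "w $ 1" "w $ 2" "w $ 3"]
  by (simp add: H3_def mink_def lift4_def power2_eq_square[symmetric] flip: power2_eq_square)

lemma proj3_lift4 [simp]: "proj3 (lift4 w) = w"
  by (simp add: lift4_def vec_eq_iff forall_3)

lemma lift4_proj3: assumes "x \<in> H3" shows "lift4 (proj3 x) = x"
proof -
  have "x $ 1 * x $ 1 = 1 + (x $ 2)\<^sup>2 + (x $ 3)\<^sup>2 + (x $ 4)\<^sup>2" "x $ 1 > 0"
    using assms by (auto simp: H3_def mink_def power2_eq_square)
  then have "sqrt (1 + (x $ 2)\<^sup>2 + (x $ 3)\<^sup>2 + (x $ 4)\<^sup>2) = x $ 1"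
    by (intro real_sqrt_unique) (auto simp: power2_eq_square)
  then show ?thesis by (simp add: lift4_def vec_eq_iff forall_4)
qed

lemma bounded_bilinear_mink: "bounded_bilinear mink"
  by (intro bilinear_conv_bounded_bilinear[THEN iffD1])
    (simp add: bilinear_def linear_iff mink_def algebra_simps)

lemma D_bilinear:
  assumes "bounded_bilinear p" "smooth_at f z" "smooth_at g z"
  shows "D (\<lambda>z. p (f z) (g z)) z v = p (f z) (D g z v) + p (D f z v) (g z)"
  by (subst D_eqI[OF bounded_bilinear.FDERIV[OF assms(1) smooth_at_has_derivative[OF assms(2)]
          smooth_at_has_derivative[OF assms(3)]]]) simp

lemma mink_commute: "mink x y = mink y x"
  by (simp add: mink_def mult.commute)

text \<open>Differentiates the constant \<open>mink (f y) (f y)\<close>.\<close>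

lemma D_tangent_H3:
  assumes "smooth_at f z" "\<forall>\<^sub>F y in nhds z. f y \<in> H3" shows "mink (f z) (D f z v) = 0"
proof -
  have "\<forall>\<^sub>F y in nhds z. mink (f y) (f y) = -1"
    using assms(2) by eventually_elim (simp add: H3_def)
  from D_cong_ev[OF this] have "D (\<lambda>y. mink (f y) (f y)) z v = D (\<lambda>y. -1) z v" by simp
  then show ?thesis
    using D_bilinear[OF bounded_bilinear_mink assms(1) assms(1), of v] by (simp add: mink_commute)
qed

lemma inj_proj3_tangent:
  assumes "x \<in> H3" "mink x v = 0" "proj3 v = 0" shows "v = 0"
proof -
  have "v $ 2 = 0" "v $ 3 = 0" "v $ 4 = 0" using assms(3) by (simp_all add: vec_eq_iff forall_3)
  moreover from this have "v $ 1 = 0" using assms(1,2) by (auto simp: mink_def H3_def)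
  ultimately show ?thesis by (simp add: vec_eq_iff forall_4)
qed

text \<open>A tangent vector of the hyperboloid is determined by its last three components, so an
  immersion into it remains one after projection, and the inverse function theorem in
  \<open>real^3\<close> becomes available.\<close>

lemma inj_D_proj3:
  fixes \<Phi> :: "real^3 \<Rightarrow> real^4"
  assumes "smooth_at \<Phi> w" "inj (D \<Phi> w)" "\<forall>\<^sub>F y in nhds w. \<Phi> y \<in> H3"
  shows "inj (D (\<lambda>y. proj3 (\<Phi> y)) w)"
proof -
  have D: "D (\<lambda>y. proj3 (\<Phi> y)) w v = proj3 (D \<Phi> w v)" for v
    by (subst D_compose[OF smooth_at_bounded_linear[OF bounded_linear_proj3] assms(1)])
      (simp add: D_linear[OF bounded_linear_proj3])
  have lin: "linear (D (\<lambda>y. proj3 (\<Phi> y)) w)"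
    by (intro smooth_at_linear_D smooth_at_compose[OF smooth_at_bounded_linear[OF bounded_linear_proj3]] assms)
  have "v = 0" if "proj3 (D \<Phi> w v) = 0" for v
  proof -
    have "D \<Phi> w v = 0"
      using inj_proj3_tangent[OF _ D_tangent_H3[OF assms(1,3)] that] eventually_nhds_x_imp_x[OF assms(3)] by blast
    then show ?thesis
      using linear_injective_0[OF smooth_at_linear_D[OF assms(1)]] assms(2) by blast
  qed
  then show ?thesis using linear_injective_0[OF lin] D by simp
qed

text \<open>The inverse \<Psi>i of the target diffeomorphism serves as \<Phi>.\<close>

lemma A_equivalent_imp_presents:
  assumes U: "open U" "p \<in> U" and g: "smooth_at g 0" "g 0 = 0"
    and A: "A_equivalent U H3 x p UNIV UNIV g 0"
  shows "presents x p g"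
proof -
  obtain V W V' W' \<theta> \<Psi> where V: "openin (top_of_set U) V" "p \<in> V"
    and W: "openin (top_of_set H3) W" "x ` V \<subseteq> W"
    and V': "open V'" "0 \<in> V'" and W': "open W'" "g ` V' \<subseteq> W'"
    and \<theta>: "diffeomorphism V V' \<theta>" "\<theta> p = 0"
    and \<Psi>: "diffeomorphism W W' \<Psi>" "\<Psi> (x p) = 0"
    and eq: "\<forall>z\<in>V. \<Psi> (x z) = g (\<theta> z)"
    using A g(2) unfolding A_equivalent_def by (auto simp: g(2))
  have oV: "open V" using V U by (metis openin_open_eq)
  obtain \<theta>i where \<theta>i: "homeomorphism V V' \<theta> \<theta>i" "smooth_on V \<theta>" "smooth_on V' \<theta>i"
    using \<theta> unfolding diffeomorphism_def by blast
  obtain \<Psi>i where \<Psi>i: "homeomorphism W W' \<Psi> \<Psi>i" "smooth_on W \<Psi>" "smooth_on W' \<Psi>i"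
    using \<Psi> unfolding diffeomorphism_def by blast
  have \<theta>s: "smooth_at \<theta> p" "smooth_at \<theta>i (\<theta> p)"
    using \<theta>i V V' oV \<theta> by (auto simp: smooth_on_iff_smooth_at)
  have "\<forall>\<^sub>F z in nhds p. \<theta>i (\<theta> z) = z"
    unfolding eventually_nhds using \<theta>i(1) oV V by (auto simp: homeomorphism_def)
  then have inj\<theta>: "inj (D \<theta> p)" using inj_D_of_left_inverse[OF \<theta>s] by blast
  have 0: "0 \<in> W'" using W'(2) V'(2) g(2) by force
  have \<Psi>is: "smooth_at \<Psi>i 0" using \<Psi>i(3) W'(1) 0 by (simp add: smooth_on_iff_smooth_at)
  have \<Psi>iW: "\<Psi>i w \<in> W" "\<Psi> (\<Psi>i w) = w" if "w \<in> W'" for w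
    using \<Psi>i(1) that by (auto simp: homeomorphism_def)
  \<comment> \<open>Smoothness of \<Psi> on the thin set \<open>W\<close> means that it extends
    locally to an open subset of \<open>real^4\<close>. The extension is a left inverse of \<Psi>i
    and shows that the derivative of \<Psi>i is injective.\<close>
  obtain N F where N: "open N" "\<Psi>i 0 \<in> N" "\<forall>k. higher_differentiable_on N k F" "\<forall>y\<in>N \<inter> W. F y = \<Psi> y"
    using \<Psi>i(2) \<Psi>iW(1)[OF 0] unfolding smooth_on_def by blast
  have "\<forall>\<^sub>F w in nhds 0. \<Psi>i w \<in> N"
    by (rule eventually_nhds_smooth[OF \<Psi>is]) (use N eventually_nhds in blast)
  moreover have ev: "\<forall>\<^sub>F w in nhds 0. w \<in> W'" using W'(1) 0 eventually_nhds by blast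
  ultimately have "\<forall>\<^sub>F w in nhds 0. F (\<Psi>i w) = w"
    by eventually_elim (use N(4) \<Psi>iW in simp)
  moreover have "smooth_at F (\<Psi>i 0)" using N smooth_at_openI by blast
  ultimately have inj\<Psi>: "inj (D \<Psi>i 0)" using inj_D_of_left_inverse[OF \<Psi>is] by blast
  have H: "\<forall>\<^sub>F w in nhds 0. \<Psi>i w \<in> H3"
    using ev by eventually_elim (use \<Psi>iW(1) W(1) openin_imp_subset in blast)
  have "\<forall>\<^sub>F z in nhds p. z \<in> V" using oV V eventually_nhds by blast
  then have "\<forall>\<^sub>F z in nhds p. x z = \<Psi>i (g (\<theta> z))"
  proof eventually_elim
    case (elim z)
    then have "\<Psi>i (\<Psi> (x z)) = x z" using \<Psi>i(1) W(2) by (auto simp: homeomorphism_def)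
    then show ?case using eq elim by simp
  qed
  then show ?thesis
    unfolding presents_def using g \<Psi>is inj\<Psi> H \<theta>s(1) inj\<theta> \<theta>(2) by blast
qed

text \<open>With \<open>h\<close> a local inverse of \<open>proj3\<close> after \<Phi>, the target
  diffeomorphism is \<open>h (proj3 y)\<close>. Its domain \<open>W\<close> is cut out of the
  hyperboloid by an open condition on the chart, hence relatively open, and the formula itself is
  smooth on an open subset of \<open>real^4\<close>.\<close>

lemma presents_imp_A_equivalent:
  assumes U: "open U" "p \<in> U" and x: "\<And>z. z \<in> U \<Longrightarrow> x z \<in> H3" and pr: "presents x p g"
  shows "A_equivalent U H3 x p UNIV UNIV g 0"
proof -
  obtain \<Phi> \<theta> where \<Phi>: "smooth_at \<Phi> 0" "inj (D \<Phi> 0)" "\<forall>\<^sub>F w in nhds 0. \<Phi> w \<in> H3"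
    and \<theta>: "smooth_at \<theta> p" "inj (D \<theta> p)" "\<theta> p = 0"
    and xe: "\<forall>\<^sub>F z in nhds p. x z = \<Phi> (g (\<theta> z))" and g: "smooth_at g 0" "g 0 = 0"
    using pr unfolding presents_def by blast
  let ?f = "\<lambda>w. proj3 (\<Phi> w)"
  have f: "smooth_at ?f 0" "inj (D ?f 0)"
    using inj_D_proj3[OF \<Phi>] smooth_at_compose[OF smooth_at_bounded_linear[OF bounded_linear_proj3] \<Phi>(1)] by auto
  obtain W' O3 h where O3: "open W'" "open O3" "0 \<in> W'" "homeomorphism W' O3 ?f h"
    and W': "\<And>w. w \<in> W' \<Longrightarrow> \<Phi> w \<in> H3 \<and> smooth_at \<Phi> w" and h: "\<And>y. y \<in> O3 \<Longrightarrow> smooth_at h y"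
    by (rule smooth_inverse_function_within[OF f eventually_conj[OF \<Phi>(3) smooth_at_eventually[OF \<Phi>(1)]]]) blast
  define W where "W = {y \<in> H3. proj3 y \<in> O3}"
  have "\<forall>\<^sub>F z in nhds p. g (\<theta> z) \<in> W'"
    by (rule eventually_nhds_smooth[OF \<theta>(1)], rule eventually_nhds_smooth)
      (use g \<theta>(3) O3 eventually_nhds in auto)
  moreover have "\<forall>\<^sub>F z in nhds p. z \<in> U" using U eventually_nhds by blast
  ultimately have "\<forall>\<^sub>F z in nhds p. z \<in> U \<and> g (\<theta> z) \<in> W' \<and> x z = \<Phi> (g (\<theta> z))"
    using xe by eventually_elim simp
  then obtain V V' \<theta>i where V: "open V" "open V'" "p \<in> V" "homeomorphism V V' \<theta> \<theta>i"
    and VP: "\<And>z. z \<in> V \<Longrightarrow> z \<in> U \<and> g (\<theta> z) \<in> W' \<and> x z = \<Phi> (g (\<theta> z))"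
    and Vs: "\<And>z. z \<in> V \<Longrightarrow> smooth_at \<theta> z" "\<And>y. y \<in> V' \<Longrightarrow> smooth_at \<theta>i y"
    by (rule smooth_inverse_function_within[OF \<theta>(1,2)]) blast
  have cproj: "continuous_on S proj3" for S
    using bounded_linear_proj3 linear_continuous_on by blast
  have hf: "h (?f w) = w" "?f w \<in> O3" if "w \<in> W'" for w
    using O3(4) that by (auto simp: homeomorphism_def)
  have fh: "?f (h y) = y" "h y \<in> W'" if "y \<in> O3" for y
    using O3(4) that by (auto simp: homeomorphism_def)
  \<comment> \<open>Both points lie on the hyperboloid and have the same image in the chart.\<close>
  have \<Phi>h: "\<Phi> (h (proj3 y)) = y" if "y \<in> W" for y
    using that fh[of "proj3 y"] W'[of "h (proj3 y)"] lift4_proj3[of y] lift4_proj3[of "\<Phi> (h (proj3 y))"]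
    by (simp add: W_def)
  have hom: "homeomorphism W W' (\<lambda>y. h (proj3 y)) \<Phi>"
  proof (rule homeomorphismI)
    show "continuous_on W (\<lambda>y. h (proj3 y))"
      by (rule continuous_on_compose2[OF _ cproj]) (use O3(4) in \<open>auto simp: homeomorphism_def W_def\<close>)
    show "continuous_on W' \<Phi>"
      using W' by (auto intro!: continuous_at_imp_continuous_on smooth_at_isCont)
  qed (use fh hf W' \<Phi>h in \<open>auto simp: W_def\<close>)
  have oN: "open (proj3 -` O3)" using O3(2) cproj by (metis open_vimage)
  have diffW: "diffeomorphism W W' (\<lambda>y. h (proj3 y))"
    unfolding diffeomorphism_def
  proof (intro exI[of _ \<Phi>] conjI hom)
    have hs: "smooth_at (\<lambda>y. h (proj3 y)) y" if "y \<in> proj3 -` O3" for y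
      using that by (intro smooth_at_compose[OF h] smooth_at_bounded_linear bounded_linear_proj3) auto
    show "smooth_on W (\<lambda>y. h (proj3 y))"
      unfolding smooth_on_def using oN hd_of_smooth_at[OF oN hs] by (auto simp: W_def)
    show "smooth_on W' \<Phi>" using W' O3(1) by (simp add: smooth_on_iff_smooth_at)
  qed
  have diffV: "diffeomorphism V V' \<theta>"
    unfolding diffeomorphism_def using V Vs by (auto simp: smooth_on_iff_smooth_at)
  have "openin (top_of_set H3) W"
    unfolding W_def using oN by (auto simp: openin_open)
  moreover have "openin (top_of_set U) V" using V(1) VP by (auto simp: openin_open_eq U)
  moreover have "x ` V \<subseteq> W" using VP W' hf by (auto simp: W_def)
  moreover have V'im: "V' = \<theta> ` V" using V(4) by (auto simp: homeomorphism_def)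
  then have "0 \<in> V'" "g ` V' \<subseteq> W'" using \<theta>(3) V(3) VP by force+
  moreover have "h (proj3 (x z)) = g (\<theta> z)" if "z \<in> V" for z
    using VP[OF that] hf by simp
  ultimately show ?thesis
    unfolding A_equivalent_def
    using diffV diffW V O3 \<theta>(3) g(2)
    by (intro exI[of _ V] exI[of _ W] exI[of _ V'] exI[of _ W'] exI[of _ \<theta>] exI[of _ "\<lambda>y. h (proj3 y)"]) auto
qed

text \<open>Starting point of the reductions: translation of \<open>p\<close> to the origin and the
  global chart of the hyperboloid.\<close>

lemma presents_initial:
  assumes x: "smooth_at x p" and H: "\<forall>\<^sub>F z in nhds p. x z \<in> H3"
  shows "presents x p (\<lambda>z. proj3 (x (z + p)) - proj3 (x p))"
proof -
  let ?\<Phi> = "\<lambda>w. lift4 (w + proj3 (x p))"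
  have \<Phi>: "smooth_at ?\<Phi> 0" by (rule smooth_at_compose[OF smooth_at_lift4]) (intro sm)
  have ps: "smooth_at proj3 y" for y using smooth_at_bounded_linear bounded_linear_proj3 .
  have inj: "inj (D ?\<Phi> 0)"
    by (rule inj_D_of_left_inverse[OF \<Phi>, of "\<lambda>y. proj3 y - proj3 (x p)"]) (auto intro!: sm ps)
  have "smooth_at (\<lambda>z. x (z + p)) 0"
    by (rule smooth_at_compose[where f="\<lambda>z. z + p"]) (use x in \<open>auto intro!: smooth_at_add\<close>)
  then have "smooth_at (\<lambda>z. proj3 (x (z + p)) - proj3 (x p)) 0"
    by (intro smooth_at_diff smooth_at_const smooth_at_compose[OF ps])
  moreover have "smooth_at (\<lambda>z. z - p) p" by (intro sm)
  moreover have "inj (D (\<lambda>z. z - p) p)" by (simp add: D_diff inj_def)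
  moreover have "\<forall>\<^sub>F z in nhds p. x z = ?\<Phi> (proj3 (x (z - p + p)) - proj3 (x p))"
    using H by eventually_elim (simp add: lift4_proj3)
  ultimately show ?thesis
    unfolding presents_def using \<Phi> inj lift4_H3
    by (intro conjI exI[of _ ?\<Phi>] exI[of _ "\<lambda>z. z - p"]) auto
qed

section \<open>Normal forms\<close>

lemma linear_basis2:
  fixes L :: "real^2 \<Rightarrow> 'b::real_vector"
  assumes "linear L" shows "L w = w $ 1 *\<^sub>R L (axis 1 1) + w $ 2 *\<^sub>R L (axis 2 1)"
proof -
  have "w = w $ 1 *\<^sub>R axis 1 1 + w $ 2 *\<^sub>R axis 2 1" by (simp add: vec_eq_iff forall_2 axis_def)
  then have "L w = L (w $ 1 *\<^sub>R axis 1 1 + w $ 2 *\<^sub>R axis 2 1)" by simp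
  then show ?thesis by (simp only: linear_add[OF assms] linear_scale[OF assms])
qed

lemma linear_basis3:
  fixes L :: "real^3 \<Rightarrow> 'b::real_vector"
  assumes "linear L"
  shows "L w = w $ 1 *\<^sub>R L (axis 1 1) + w $ 2 *\<^sub>R L (axis 2 1) + w $ 3 *\<^sub>R L (axis 3 1)"
proof -
  have "w = w $ 1 *\<^sub>R axis 1 1 + w $ 2 *\<^sub>R axis 2 1 + w $ 3 *\<^sub>R axis 3 1"
    by (simp add: vec_eq_iff forall_3 axis_def)
  then have "L w = L (w $ 1 *\<^sub>R axis 1 1 + w $ 2 *\<^sub>R axis 2 1 + w $ 3 *\<^sub>R axis 3 1)" by simp
  then show ?thesis by (simp only: linear_add[OF assms] linear_scale[OF assms])
qed

lemmas D_basis2 = linear_basis2[OF smooth_at_linear_D]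
lemmas D_basis3 = linear_basis3[OF smooth_at_linear_D]

lemma D_vector2:
  assumes "smooth_at f z" "smooth_at g z"
  shows "D (\<lambda>z. vector [f z, g z] :: real^2) z v = vector [D f z v, D g z v]"
  using D_nth[OF smooth_at_vector2[OF assms], of 1 v] D_nth[OF smooth_at_vector2[OF assms], of 2 v]
  by (simp add: vec_eq_iff forall_2)

lemma D_vector3:
  assumes "smooth_at f z" "smooth_at g z" "smooth_at h z"
  shows "D (\<lambda>z. vector [f z, g z, h z] :: real^3) z v = vector [D f z v, D g z v, D h z v]"
  using D_nth[OF smooth_at_vector3[OF assms], of 1 v] D_nth[OF smooth_at_vector3[OF assms], of 2 v]
    D_nth[OF smooth_at_vector3[OF assms], of 3 v]
  by (simp add: vec_eq_iff forall_3)

lemma vector_0 [simp]: "vector [0, 0] = (0 :: real^2)" "vector [0, 0, 0] = (0 :: real^3)"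
  by (simp_all add: vec_eq_iff forall_2 forall_3)

lemma inj_D_triangular2:
  fixes f g :: "real^2 \<Rightarrow> real"
  assumes "smooth_at f 0" "smooth_at g 0"
    and "D f 0 (axis 2 1) = 0 \<or> D g 0 (axis 1 1) = 0" "D f 0 (axis 1 1) \<noteq> 0" "D g 0 (axis 2 1) \<noteq> 0"
  shows "inj (D (\<lambda>z. vector [f z, g z] :: real^2) 0)"
proof -
  have "w = 0" if "D (\<lambda>z. vector [f z, g z] :: real^2) 0 w = 0" for w
  proof -
    have "D f 0 w = 0" "D g 0 w = 0"
      using that unfolding D_vector2[OF assms(1,2)] by (auto simp: vec_eq_iff forall_2)
    then show "w = 0"
      using assms(3-5) D_basis2[OF assms(1), of w] D_basis2[OF assms(2), of w]
      by (auto simp: vec_eq_iff forall_2)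
  qed
  then show ?thesis
    using linear_injective_0[OF smooth_at_linear_D] smooth_at_vector2[OF assms(1,2)] by blast
qed

lemma inj_D_triangular3:
  fixes f g h :: "real^3 \<Rightarrow> real"
  assumes "smooth_at f 0" "smooth_at g 0" "smooth_at h 0"
    and "\<And>w. D f 0 w = 0 \<Longrightarrow> D g 0 w = 0 \<Longrightarrow> D h 0 w = 0 \<Longrightarrow> w $ 1 = 0 \<and> w $ 2 = 0 \<and> w $ 3 = 0"
  shows "inj (D (\<lambda>z. vector [f z, g z, h z] :: real^3) 0)"
proof -
  have "w = 0" if "D (\<lambda>z. vector [f z, g z, h z] :: real^3) 0 w = 0" for w
    using that assms(4)[of w] unfolding D_vector3[OF assms(1-3)] by (auto simp: vec_eq_iff forall_3)
  then show ?thesis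
    using linear_injective_0[OF smooth_at_linear_D] smooth_at_vector3[OF assms(1-3)] by blast
qed

lemma axis_nth_simps [simp]:
  "(axis 1 1 :: real^2) $ 1 = 1" "(axis 1 1 :: real^2) $ 2 = 0"
  "(axis 2 1 :: real^2) $ 1 = 0" "(axis 2 1 :: real^2) $ 2 = 1"
  "(axis 1 1 :: real^3) $ 1 = 1" "(axis 1 1 :: real^3) $ 2 = 0" "(axis 1 1 :: real^3) $ 3 = 0"
  "(axis 2 1 :: real^3) $ 1 = 0" "(axis 2 1 :: real^3) $ 2 = 1" "(axis 2 1 :: real^3) $ 3 = 0"
  "(axis 3 1 :: real^3) $ 1 = 0" "(axis 3 1 :: real^3) $ 2 = 0" "(axis 3 1 :: real^3) $ 3 = 1"
  by (simp_all add: axis_def)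

lemma Hadamard_at:
  fixes g :: "real^2 \<Rightarrow> real"
  assumes "smooth_at g 0"
  obtains k where "smooth_at k 0" "\<forall>\<^sub>F z in nhds 0. g z - g (vector [z $ 1, 0]) = z $ 2 * k z"
proof -
  obtain d where d: "d > 0" "\<And>z. z \<in> box2 d d \<Longrightarrow> smooth_at g z"
    using smooth_at_eventually[OF assms] by (rule box2_nhds) blast
  obtain k where k: "\<And>z. z \<in> box2 d d \<Longrightarrow> smooth_at k z"
    "\<And>z. z \<in> box2 d d \<Longrightarrow> g z - g (vector [z $ 1, 0]) = z $ 2 * k z"
    using Hadamard[OF d(2)] by blast
  have 0: "0 \<in> box2 d d" using d(1) by (simp add: box2_def)
  show ?thesis
    using that[OF k(1)[OF 0]] k(2) 0 open_box2 unfolding eventually_nhds by blast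
qed

text \<open>After a shift by the critical point \<open>h\<close> of the function of the second
  variable, two applications of Hadamard's lemma give
  \<open>f1 z = m z + (z $ 2)\<^sup>2 * k2 z\<close> with \<open>2 * k2 0\<close> the second
  derivative. The new coordinate is \<open>z $ 2\<close> times the root of the absolute value of
  \<open>k2\<close>, with the shift undone.\<close>

lemma Morse_with_parameter:
  fixes f :: "real^2 \<Rightarrow> real"
  assumes f: "smooth_at f 0" and f1: "D f 0 (axis 2 1) = 0"
    and f2: "D (\<lambda>z. D f z (axis 2 1)) 0 (axis 2 1) \<noteq> 0"
  obtains s m :: "real^2 \<Rightarrow> real" where "smooth_at s 0" "smooth_at m 0" "s 0 = 0" "D s 0 (axis 2 1) \<noteq> 0"
    "\<forall>\<^sub>F z in nhds 0. f z = m (vector [z $ 1, 0]) + sgn (D (\<lambda>z. D f z (axis 2 1)) 0 (axis 2 1)) * (s z)\<^sup>2"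
proof -
  let ?fv = "\<lambda>z. D f z (axis 2 1)"
  define c where "c = D ?fv 0 (axis 2 1)"
  have fv: "smooth_at ?fv 0" using f by (rule smooth_at_D)
  \<comment> \<open>This map straightens the critical set to the first axis; the nonzero second
    derivative makes it a local diffeomorphism.\<close>
  let ?\<tau> = "\<lambda>z. vector [z $ 1, ?fv z] :: real^2"
  have \<tau>: "smooth_at ?\<tau> 0" by (intro sm fv)
  have inj: "inj (D ?\<tau> 0)" by (rule inj_D_triangular2) (use fv f2 in \<open>auto intro!: sm\<close>)
  have \<tau>0: "?\<tau> 0 = 0" using f1 by simp
  obtain g where g: "smooth_at g (?\<tau> 0)" "g (?\<tau> 0) = 0" "\<forall>\<^sub>F y in nhds (?\<tau> 0). ?\<tau> (g y) = y"
    by (rule local_inverse[OF \<tau> inj]) blast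
  note g = g[unfolded \<tau>0]
  define h where "h z = g (vector [z $ 1, 0]) $ 2" for z :: "real^2"
  have pr: "smooth_at (\<lambda>z. vector [z $ 1, 0] :: real^2) z" for z :: "real^2" by (intro sm)
  have h: "smooth_at h 0" unfolding h_def
    by (intro sm smooth_at_compose[where g=g, OF _ pr]) (simp add: g)
  have h0: "h 0 = 0" by (simp add: h_def g)
  have h_crit: "\<forall>\<^sub>F z in nhds 0. ?fv (vector [z $ 1, h z]) = 0"
  proof -
    have "\<forall>\<^sub>F z::real^2 in nhds 0. ?\<tau> (g (vector [z $ 1, 0])) = vector [z $ 1, 0]"
      by (rule eventually_nhds_smooth[OF pr]) (use g(3) in simp)
    then show ?thesis
    proof eventually_elim
      case (elim z)
      from arg_cong[OF elim, of "\<lambda>w. w $ 1"] arg_cong[OF elim, of "\<lambda>w. w $ 2"]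
      have *: "g (vector [z $ 1, 0]) $ 1 = z $ 1" "?fv (g (vector [z $ 1, 0])) = 0" by simp_all
      from *(1) have "g (vector [z $ 1, 0]) = vector [z $ 1, h z]" by (simp add: h_def vec_eq_iff forall_2)
      then show ?case using *(2) by simp
    qed
  qed
  have ev_pr: "\<forall>\<^sub>F z::real^2 in nhds 0. P (vector [z $ 1, 0])" if "eventually P (nhds 0)" for P :: "real^2 \<Rightarrow> bool"
    by (rule eventually_nhds_smooth[OF pr]) (use that in simp)
  have h_e2: "\<forall>\<^sub>F z in nhds 0. D h z (axis 2 1) = 0"
    using smooth_at_eventually[OF h] ev_pr[OF smooth_at_eventually[OF g(1)]]
  proof eventually_elim
    case (elim z)
    have "D h z (axis 2 1) = D (\<lambda>z. g (vector [z $ 1, 0])) z (axis 2 1) $ 2"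
      unfolding h_def by (rule D_nth, rule smooth_at_compose[OF elim(2) pr])
    also have "\<dots> = D g (vector [z $ 1, 0]) (D (\<lambda>z. vector [z $ 1, 0] :: real^2) z (axis 2 1)) $ 2"
      by (subst D_compose[OF elim(2) pr]) simp
    also have "D (\<lambda>z. vector [z $ 1, 0] :: real^2) z (axis 2 1) = 0"
      by (subst D_vector2) (auto intro!: sm)
    finally show ?case by (simp add: linear_0[OF smooth_at_linear_D[OF elim(2)]])
  qed
  define \<sigma> where "\<sigma> z = (vector [z $ 1, z $ 2 + h z] :: real^2)" for z
  have \<sigma>: "smooth_at \<sigma> 0" unfolding \<sigma>_def by (intro sm h)
  have \<sigma>0: "\<sigma> 0 = 0" by (simp add: \<sigma>_def h0)
  have \<sigma>_e2: "\<forall>\<^sub>F z in nhds 0. D \<sigma> z (axis 2 1) = axis 2 1"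
    using smooth_at_eventually[OF h] h_e2
  proof eventually_elim
    case (elim z)
    have "D \<sigma> z (axis 2 1) = vector [0, 1 + D h z (axis 2 1)]"
      unfolding \<sigma>_def using elim(1) by (subst D_vector2) (simp_all add: sm D_add)
    then show ?case by (simp add: elim(2) vec_eq_iff forall_2)
  qed
  define f1 where "f1 z = f (\<sigma> z)" for z
  have f1s: "smooth_at f1 0" unfolding f1_def by (rule smooth_at_compose) (use f \<sigma> \<sigma>0 in auto)
  have f1v: "\<forall>\<^sub>F z in nhds 0. D f1 z (axis 2 1) = ?fv (\<sigma> z)"
    using \<sigma>_e2 smooth_at_eventually[OF \<sigma>] eventually_nhds_smooth[OF \<sigma>, unfolded \<sigma>0, OF smooth_at_eventually[OF f]]
  proof eventually_elim
    case (elim z)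
    then show ?case unfolding f1_def by (subst D_compose) simp_all
  qed
  have f1vv: "D (\<lambda>z. D f1 z (axis 2 1)) 0 (axis 2 1) = c"
  proof -
    have "D (\<lambda>z. D f1 z (axis 2 1)) 0 (axis 2 1) = D (\<lambda>z. ?fv (\<sigma> z)) 0 (axis 2 1)"
      using D_cong_ev[OF f1v] by simp
    also have "\<dots> = D ?fv (\<sigma> 0) (D \<sigma> 0 (axis 2 1))"
      by (rule D_compose) (use \<sigma> \<sigma>0 fv in auto)
    finally show ?thesis using eventually_nhds_x_imp_x[OF \<sigma>_e2] by (simp add: \<sigma>0 c_def)
  qed
  obtain k1 where k1: "smooth_at k1 0" "\<forall>\<^sub>F z in nhds 0. f1 z - f1 (vector [z $ 1, 0]) = z $ 2 * k1 z"
    using Hadamard_at[OF f1s] by blast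
  define m where "m z = f1 (vector [z $ 1, 0])" for z :: "real^2"
  have m: "smooth_at m 0" unfolding m_def
    by (rule smooth_at_compose[OF _ pr]) (use f1s in simp)
  have m_e2: "\<forall>\<^sub>F z in nhds 0. D m z (axis 2 1) = 0"
    using ev_pr[OF smooth_at_eventually[OF f1s]]
  proof eventually_elim
    case (elim z)
    have "D m z (axis 2 1) = D f1 (vector [z $ 1, 0]) (D (\<lambda>z. vector [z $ 1, 0] :: real^2) z (axis 2 1))"
      unfolding m_def by (subst D_compose[OF elim pr]) simp
    also have "D (\<lambda>z. vector [z $ 1, 0] :: real^2) z (axis 2 1) = 0"
      by (subst D_vector2) (auto intro!: sm)
    finally show ?case by (simp add: linear_0[OF smooth_at_linear_D[OF elim]])
  qed
  have f1_eq: "\<forall>\<^sub>F z in nhds 0. f1 z = m z + z $ 2 * k1 z"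
    using k1(2) by eventually_elim (simp add: m_def)
  \<comment> \<open>On the first axis the product rule leaves \<open>k1\<close> as the second
    partial derivative of \<open>f1\<close>, which is that of \<open>f\<close> at a critical
    point.\<close>
  have k1_0: "\<forall>\<^sub>F z::real^2 in nhds 0. k1 (vector [z $ 1, 0]) = 0"
  proof -
    have "\<forall>\<^sub>F z in nhds 0. D f1 z (axis 2 1) = k1 z + z $ 2 * D k1 z (axis 2 1)"
      using ev_nhds2[OF f1_eq] smooth_at_eventually[OF k1(1)] smooth_at_eventually[OF m] m_e2
    proof eventually_elim
      case (elim z)
      have "D f1 z (axis 2 1) = D (\<lambda>z. m z + z $ 2 * k1 z) z (axis 2 1)" using D_cong_ev[OF elim(1)] by simp
      also have "\<dots> = k1 z + z $ 2 * D k1 z (axis 2 1)"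
        using elim by (simp add: D_add D_mult sm)
      finally show ?case .
    qed
    with f1v have "\<forall>\<^sub>F z in nhds 0. k1 z + z $ 2 * D k1 z (axis 2 1) = ?fv (\<sigma> z)"
      by eventually_elim simp
    from ev_pr[OF this] show ?thesis
      using h_crit by eventually_elim (simp add: \<sigma>_def h_def)
  qed
  obtain k2 where k2: "smooth_at k2 0" "\<forall>\<^sub>F z in nhds 0. k1 z - k1 (vector [z $ 1, 0]) = z $ 2 * k2 z"
    using Hadamard_at[OF k1(1)] by blast
  have f1_eq2: "\<forall>\<^sub>F z in nhds 0. f1 z = m z + (z $ 2)\<^sup>2 * k2 z"
    using f1_eq k1_0 k2(2) by eventually_elim (simp add: power2_eq_square)
  have k2_0: "2 * k2 0 = c"
  proof -
    have "\<forall>\<^sub>F z in nhds 0. D f1 z (axis 2 1) = 2 * z $ 2 * k2 z + (z $ 2)\<^sup>2 * D k2 z (axis 2 1)"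
      using ev_nhds2[OF f1_eq2] smooth_at_eventually[OF k2(1)] smooth_at_eventually[OF m] m_e2
    proof eventually_elim
      case (elim z)
      have "D f1 z (axis 2 1) = D (\<lambda>z. m z + (z $ 2)\<^sup>2 * k2 z) z (axis 2 1)" using D_cong_ev[OF elim(1)] by simp
      also have "\<dots> = 2 * z $ 2 * k2 z + (z $ 2)\<^sup>2 * D k2 z (axis 2 1)"
        using elim by (simp add: D_add D_mult D_power2 sm)
      finally show ?case .
    qed
    from D_cong_ev[OF this] f1vv have "c = D (\<lambda>z. 2 * z $ 2 * k2 z + (z $ 2)\<^sup>2 * D k2 z (axis 2 1)) 0 (axis 2 1)"
      by simp
    also have "\<dots> = 2 * k2 0"
      using k2(1) by (simp add: D_add D_mult D_power2 sm)
    finally show ?thesis by simp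
  qed
  define \<epsilon> where "\<epsilon> = sgn c"
  have c: "c \<noteq> 0" using f2 by (simp add: c_def)
  have \<epsilon>: "\<epsilon> * \<epsilon> = 1" "\<epsilon> * k2 0 > 0" using c k2_0 by (auto simp: \<epsilon>_def sgn_if)
  have k2p: "\<forall>\<^sub>F z in nhds 0. \<epsilon> * k2 z > 0"
  proof -
    have "smooth_at (\<lambda>z. \<epsilon> * k2 z) 0" by (intro sm k2)
    moreover have "\<forall>\<^sub>F t in nhds (\<epsilon> * k2 0). t > 0"
      using \<epsilon>(2) eventually_nhds open_greaterThan by (metis greaterThan_iff)
    ultimately show ?thesis by (rule eventually_nhds_smooth)
  qed
  define s1 where "s1 z = z $ 2 * sqrt (\<epsilon> * k2 z)" for z :: "real^2"
  have s1: "smooth_at s1 0" unfolding s1_def by (intro sm k2 \<epsilon>)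
  have s1v: "D s1 0 (axis 2 1) = sqrt (\<epsilon> * k2 0)"
    unfolding s1_def using \<epsilon>(2) by (subst D_mult) (auto intro!: sm k2)
  have s1_0: "s1 0 = 0" by (simp add: s1_def)
  \<comment> \<open>The inverse of the shift \<sigma>; both use the same \<open>h\<close> because it
    depends on the first coordinate only.\<close>
  define \<rho> where "\<rho> z = (vector [z $ 1, z $ 2 - h z] :: real^2)" for z
  have \<rho>: "smooth_at \<rho> 0" unfolding \<rho>_def by (intro sm h)
  have \<rho>0: "\<rho> 0 = 0" by (simp add: \<rho>_def h0)
  have \<sigma>\<rho>: "\<sigma> (\<rho> z) = z" for z by (simp add: \<sigma>_def \<rho>_def h_def vec_eq_iff forall_2)
  have \<rho>e2: "D \<rho> 0 (axis 2 1) = axis 2 1"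
    unfolding \<rho>_def using h eventually_nhds_x_imp_x[OF h_e2]
    by (subst D_vector2) (simp_all add: sm D_diff vec_eq_iff forall_2)
  have main: "\<forall>\<^sub>F z in nhds 0. f1 z = m z + \<epsilon> * (s1 z)\<^sup>2"
    using f1_eq2 k2p
  proof eventually_elim
    case (elim z)
    then have "\<epsilon> * (s1 z)\<^sup>2 = (\<epsilon> * \<epsilon>) * ((z $ 2)\<^sup>2 * k2 z)" by (simp add: s1_def power_mult_distrib)
    then show ?case using elim \<epsilon> by simp
  qed
  show ?thesis
  proof (rule that[of "\<lambda>z. s1 (\<rho> z)" m])
    show "smooth_at (\<lambda>z. s1 (\<rho> z)) 0" by (rule smooth_at_compose) (use s1 \<rho> \<rho>0 in auto)
    show "D (\<lambda>z. s1 (\<rho> z)) 0 (axis 2 1) \<noteq> 0"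
      by (subst D_compose) (use s1 \<rho> \<rho>0 \<rho>e2 s1v \<epsilon> in auto)
    have "\<forall>\<^sub>F z in nhds 0. f1 (\<rho> z) = m (\<rho> z) + \<epsilon> * (s1 (\<rho> z))\<^sup>2"
      by (rule eventually_nhds_smooth[OF \<rho>]) (use main \<rho>0 in simp)
    then show "\<forall>\<^sub>F z in nhds 0. f z = m (vector [z $ 1, 0]) + sgn (D ?fv 0 (axis 2 1)) * (s1 (\<rho> z))\<^sup>2"
      by eventually_elim (simp add: f1_def \<sigma>\<rho> \<epsilon>_def c_def m_def, simp add: \<rho>_def)
  qed (use m \<rho>0 s1_0 in auto)
qed

section \<open>Reduction of corank one germs to fold maps\<close>

definition fold_map :: "(real^2 \<Rightarrow> real) \<Rightarrow> real^2 \<Rightarrow> real^3" where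
  "fold_map G z = vector [z $ 1, (z $ 2)\<^sup>2, z $ 2 * G (vector [z $ 1, (z $ 2)\<^sup>2])]"

text \<open>Linear changes of source and target send \<open>e\<close> and \<open>k\<close> to the
  coordinate axes and the image direction to the first axis. The first component of the map then
  becomes the first coordinate of the source by \<open>\<tau>\<close>, whose derivative fixes the
  second axis, so the kernel stays in place.\<close>

lemma presents_rank_one:
  assumes x: "presents x p F" and k: "D F 0 k = 0" "k \<noteq> 0" and e: "D F 0 e \<noteq> 0"
  obtains G where "presents x p G" "\<forall>\<^sub>F z in nhds 0. G z $ 1 = z $ 1" "D G 0 (axis 2 1) = 0"
proof -
  have F: "smooth_at F 0" "F 0 = 0" using x by (simp_all add: presents_def)
  note lF = smooth_at_linear_D[OF F(1)]
  define \<sigma> where "\<sigma> z = z $ 1 *\<^sub>R e + z $ 2 *\<^sub>R k" for z :: "real^2"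
  have \<sigma>: "smooth_at \<sigma> z" for z unfolding \<sigma>_def by (intro sm)
  have D\<sigma>: "D \<sigma> 0 w = \<sigma> w" for w
    unfolding \<sigma>_def by (simp add: D_add D_scaleR sm)
  have "w = 0" if "\<sigma> w = 0" for w
  proof -
    have "D F 0 (\<sigma> w) = w $ 1 *\<^sub>R D F 0 e"
      by (simp add: \<sigma>_def linear_add[OF lF] linear_scale[OF lF] k)
    then have "w $ 1 = 0" using that e linear_0[OF lF] by simp
    moreover from this have "w $ 2 = 0" using that k(2) by (simp add: \<sigma>_def)
    ultimately show ?thesis by (simp add: vec_eq_iff forall_2)
  qed
  then have inj\<sigma>: "inj (D \<sigma> 0)"
    using linear_injective_0[OF smooth_at_linear_D[OF \<sigma>]] D\<sigma> by simp
  have \<sigma>0: "\<sigma> 0 = 0" by (simp add: \<sigma>_def)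
  obtain \<kappa> :: "real^3 \<Rightarrow> real^3" where \<kappa>: "orthogonal_transformation \<kappa>"
    "\<kappa> (D F 0 e /\<^sub>R norm (D F 0 e)) = axis 1 1"
    using orthogonal_transformation_exists_1[of "D F 0 e /\<^sub>R norm (D F 0 e)" "axis 1 1 :: real^3"] e by auto
  have l\<kappa>: "linear \<kappa>" using \<kappa>(1) orthogonal_transformation_linear by blast
  then have bl\<kappa>: "bounded_linear \<kappa>" by (simp add: linear_conv_bounded_linear)
  have "inj \<kappa>" using \<kappa>(1) orthogonal_transformation_inj by blast
  then have inj\<kappa>: "inj (D \<kappa> 0)" using D_linear[OF bl\<kappa>] by (simp add: inj_def)
  have \<kappa>e: "\<kappa> (D F 0 e) = norm (D F 0 e) *\<^sub>R axis 1 1"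
    using arg_cong[OF \<kappa>(2), of "\<lambda>v. norm (D F 0 e) *\<^sub>R v"] e by (simp add: linear_scale[OF l\<kappa>])
  define F2 where "F2 z = \<kappa> (F (\<sigma> z))" for z
  have x2: "presents x p F2"
    unfolding F2_def
    by (rule presents_compose_target[OF presents_compose_source[OF x \<sigma> inj\<sigma> \<sigma>0] smooth_at_bounded_linear[OF bl\<kappa>] inj\<kappa>])
      (simp add: linear_0[OF l\<kappa>])
  then have F2: "smooth_at F2 0" "F2 0 = 0" by (simp_all add: presents_def)
  have DF2: "D F2 0 w = \<kappa> (D F 0 (\<sigma> w))" for w
  proof -
    have Fs: "smooth_at (\<lambda>z. F (\<sigma> z)) 0" by (rule smooth_at_compose) (use F \<sigma> \<sigma>0 in auto)
    have "D F2 0 w = D \<kappa> (F (\<sigma> 0)) (D (\<lambda>z. F (\<sigma> z)) 0 w)"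
      unfolding F2_def by (rule D_compose[OF smooth_at_bounded_linear[OF bl\<kappa>] Fs])
    also have "D (\<lambda>z. F (\<sigma> z)) 0 w = D F (\<sigma> 0) (D \<sigma> 0 w)"
      by (rule D_compose) (use F \<sigma> \<sigma>0 in auto)
    finally show ?thesis by (simp add: \<sigma>0 D\<sigma> D_linear[OF bl\<kappa>])
  qed
  have DF2_1: "D F2 0 (axis 1 1) $ 1 \<noteq> 0" using e by (simp add: DF2 \<sigma>_def \<kappa>e)
  have DF2_2: "D F2 0 (axis 2 1) = 0" by (simp add: DF2 \<sigma>_def k linear_0[OF l\<kappa>])
  define \<tau> where "\<tau> z = (vector [F2 z $ 1, z $ 2] :: real^2)" for z
  have \<tau>: "smooth_at \<tau> 0" unfolding \<tau>_def by (intro sm F2)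
  have inj\<tau>: "inj (D \<tau> 0)"
    unfolding \<tau>_def by (rule inj_D_triangular2) (use F2 DF2_1 in \<open>auto simp: D_nth intro!: sm\<close>)
  have \<tau>0: "\<tau> 0 = 0" by (simp add: \<tau>_def F2)
  have D\<tau>2: "D \<tau> 0 (axis 2 1) = axis 2 1"
    unfolding \<tau>_def using F2 by (subst D_vector2) (simp_all add: sm D_nth DF2_2 vec_eq_iff forall_2)
  obtain g where g: "smooth_at g (\<tau> 0)" "g (\<tau> 0) = 0" "\<forall>\<^sub>F z in nhds 0. g (\<tau> z) = z"
    "\<forall>\<^sub>F y in nhds (\<tau> 0). \<tau> (g y) = y"
    by (rule local_inverse[OF \<tau> inj\<tau>]) blast
  note g = g[unfolded \<tau>0]
  have "D (\<lambda>z. g (\<tau> z)) 0 (axis 2 1) = D (\<lambda>z. z) 0 (axis 2 1)" using D_cong_ev[OF g(3)] by simp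
  moreover have "D (\<lambda>z. g (\<tau> z)) 0 (axis 2 1) = D g (\<tau> 0) (D \<tau> 0 (axis 2 1))"
    by (rule D_compose) (use g \<tau> \<tau>0 in auto)
  ultimately have Dg2: "D g 0 (axis 2 1) = axis 2 1" by (simp add: \<tau>0 D\<tau>2)
  have Gs: "smooth_at (\<lambda>z. F2 (g z)) 0" by (rule smooth_at_compose) (use g F2 in auto)
  show ?thesis
  proof (rule that[of "\<lambda>z. F2 (g z)"])
    show "presents x p (\<lambda>z. F2 (g z))"
      by (rule presents_source[OF x2 \<tau> inj\<tau> \<tau>0 Gs]) (use g(3) in eventually_elim, simp)
    show "\<forall>\<^sub>F z in nhds 0. F2 (g z) $ 1 = z $ 1"
      using g(4)
    proof eventually_elim
      case (elim z)
      from arg_cong[OF elim, of "\<lambda>w. w $ 1"] show ?case by (simp add: \<tau>_def)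
    qed
    have "D (\<lambda>z. F2 (g z)) 0 (axis 2 1) = D F2 (g 0) (D g 0 (axis 2 1))"
      by (rule D_compose) (use g F2 in auto)
    then show "D (\<lambda>z. F2 (g z)) 0 (axis 2 1) = 0" by (simp add: g Dg2 DF2_2)
  qed
qed

lemma smooth_pair3: "smooth_at (\<lambda>y::real^3. vector [y $ 1, y $ 2] :: real^2) z" by (intro sm)

lemma smooth_pair3_compose:
  "smooth_at A 0 \<Longrightarrow> smooth_at (\<lambda>y::real^3. A (vector [y $ 1, y $ 2] :: real^2)) 0"
  by (rule smooth_at_compose[OF _ smooth_pair3]) simp

lemma D_pair3_compose:
  assumes "smooth_at A 0"
  shows "D (\<lambda>y::real^3. A (vector [y $ 1, y $ 2] :: real^2)) 0 w = D A 0 (vector [w $ 1, w $ 2])"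
proof -
  have "D (\<lambda>y::real^3. A (vector [y $ 1, y $ 2] :: real^2)) 0 w =
      D A (vector [(0::real^3) $ 1, (0::real^3) $ 2]) (D (\<lambda>y::real^3. vector [y $ 1, y $ 2] :: real^2) 0 w)"
    by (rule D_compose[OF _ smooth_pair3]) (use assms in simp)
  also have "D (\<lambda>y::real^3. vector [y $ 1, y $ 2] :: real^2) 0 w = vector [w $ 1, w $ 2]"
    by (subst D_vector2) (simp_all add: sm)
  finally show ?thesis by simp
qed

lemma smooth_square_pair: "smooth_at (\<lambda>z::real^2. vector [z $ 1, (z $ 2)\<^sup>2] :: real^2) z" by (intro sm)

lemma smooth_square_compose:
  "smooth_at A 0 \<Longrightarrow> smooth_at (\<lambda>z::real^2. A (vector [z $ 1, (z $ 2)\<^sup>2] :: real^2)) 0"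
  by (rule smooth_at_compose[OF _ smooth_square_pair]) simp

lemma D_square_compose:
  assumes "smooth_at A 0"
  shows "D (\<lambda>z::real^2. A (vector [z $ 1, (z $ 2)\<^sup>2] :: real^2)) 0 w = D A 0 (vector [w $ 1, 0])"
proof -
  have "D (\<lambda>z::real^2. A (vector [z $ 1, (z $ 2)\<^sup>2] :: real^2)) 0 w =
      D A (vector [(0::real^2) $ 1, ((0::real^2) $ 2)\<^sup>2]) (D (\<lambda>z::real^2. vector [z $ 1, (z $ 2)\<^sup>2] :: real^2) 0 w)"
    by (rule D_compose[OF _ smooth_square_pair]) (use assms in simp)
  also have "D (\<lambda>z::real^2. vector [z $ 1, (z $ 2)\<^sup>2] :: real^2) 0 w = vector [w $ 1, 0]"
    by (subst D_vector2) (simp_all add: sm D_power2)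
  finally show ?thesis by simp
qed

lemma vector_10_scale: "vector [a, 0] = a *\<^sub>R (axis 1 1 :: real^2)"
  by (simp add: vec_eq_iff forall_2)

lemma ev_square:
  assumes "eventually P (nhds (0::real^2))"
  shows "\<forall>\<^sub>F z::real^2 in nhds 0. P (vector [z $ 1, (z $ 2)\<^sup>2])"
  by (rule eventually_nhds_smooth[OF smooth_square_pair]) (use assms in simp)

text \<open>Morse's lemma turns one target component into a function of the first coordinate plus a
  square. The remaining component is split into its even part, a function of the first two
  components and removable in the target, and its odd part, \<open>z $ 2\<close> times an even
  function.\<close>

lemma presents_fold:
  assumes x: "presents x p F" and F1: "\<forall>\<^sub>F z in nhds 0. F z $ 1 = z $ 1"
    and Fv: "D F 0 (axis 2 1) = 0"
    and Fvv: "D (\<lambda>z. D F z (axis 2 1)) 0 (axis 2 1) $ 2 \<noteq> 0 \<or> D (\<lambda>z. D F z (axis 2 1)) 0 (axis 2 1) $ 3 \<noteq> 0"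
  obtains G where "smooth_at G 0" "presents x p (fold_map G)"
proof -
  have F: "smooth_at F 0" "F 0 = 0" using x by (simp_all add: presents_def)
  define P where "P = D (\<lambda>z. D F z (axis 2 1)) 0 (axis 2 1) $ 2"
  define Q where "Q = D (\<lambda>z. D F z (axis 2 1)) 0 (axis 2 1) $ 3"
  have PQ: "P * P + Q * Q > 0" using Fvv unfolding P_def Q_def
    by (metis add_nonneg_pos add_pos_nonneg not_real_square_gt_zero zero_le_square)
  \<comment> \<open>A rotation and scaling of the last two target coordinates that moves
    \<open>(P, Q)\<close> to the positive first of these axes; thus the second derivative is
    \<open>P * P + Q * Q\<close> and the square in Morse's lemma has a positive sign.\<close>
  define \<kappa>1 where "\<kappa>1 y = (vector [y $ 1, P * y $ 2 + Q * y $ 3, P * y $ 3 - Q * y $ 2] :: real^3)" for y :: "real^3"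
  have \<kappa>1: "smooth_at \<kappa>1 0" unfolding \<kappa>1_def by (intro sm)
  have inj\<kappa>1: "inj (D \<kappa>1 0)"
    unfolding \<kappa>1_def
  proof (rule inj_D_triangular3)
    fix w :: "real^3"
    assume "D (\<lambda>y::real^3. y $ 1) 0 w = 0" "D (\<lambda>y. P * y $ 2 + Q * y $ 3) 0 w = 0" "D (\<lambda>y. P * y $ 3 - Q * y $ 2) 0 w = 0"
    then have w: "w $ 1 = 0" "P * w $ 2 + Q * w $ 3 = 0" "P * w $ 3 - Q * w $ 2 = 0"
      by (simp_all add: D_add D_diff D_mult sm)
    have "(P * P + Q * Q) * w $ 2 = P * (P * w $ 2 + Q * w $ 3) - Q * (P * w $ 3 - Q * w $ 2)"
      "(P * P + Q * Q) * w $ 3 = Q * (P * w $ 2 + Q * w $ 3) + P * (P * w $ 3 - Q * w $ 2)"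
      by (simp_all add: algebra_simps)
    then show "w $ 1 = 0 \<and> w $ 2 = 0 \<and> w $ 3 = 0" using w PQ by auto
  qed (intro sm)+
  have \<kappa>10: "\<kappa>1 0 = 0" by (simp add: \<kappa>1_def)
  define f where "f z = P * F z $ 2 + Q * F z $ 3" for z
  have f: "smooth_at f 0" unfolding f_def by (intro sm F)
  have f0: "f 0 = 0" by (simp add: f_def F)
  have Df: "\<forall>\<^sub>F z in nhds 0. D f z (axis 2 1) = P * D F z (axis 2 1) $ 2 + Q * D F z (axis 2 1) $ 3"
    using smooth_at_eventually[OF F(1)]
    by eventually_elim (simp add: f_def[abs_def] D_add D_mult D_nth sm)
  have fv: "D f 0 (axis 2 1) = 0" using eventually_nhds_x_imp_x[OF Df] Fv by simp
  have fvv: "D (\<lambda>z. D f z (axis 2 1)) 0 (axis 2 1) = P * P + Q * Q"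
  proof -
    have "D (\<lambda>z. D f z (axis 2 1)) 0 (axis 2 1) =
        D (\<lambda>z. P * D F z (axis 2 1) $ 2 + Q * D F z (axis 2 1) $ 3) 0 (axis 2 1)"
      using D_cong_ev[OF Df] by simp
    also have "\<dots> = P * P + Q * Q"
      using smooth_at_D[OF F(1)] by (simp add: D_add D_mult D_nth sm P_def Q_def)
    finally show ?thesis .
  qed
  have fvv0: "D (\<lambda>z. D f z (axis 2 1)) 0 (axis 2 1) \<noteq> 0" using PQ unfolding fvv by linarith
  obtain s m :: "real^2 \<Rightarrow> real" where s: "smooth_at s 0" "s 0 = 0" "D s 0 (axis 2 1) \<noteq> 0"
    and m: "smooth_at m 0" and fe: "\<forall>\<^sub>F z in nhds 0. f z = m (vector [z $ 1, 0]) + (s z)\<^sup>2"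
    using Morse_with_parameter[OF f fv fvv0, unfolded fvv sgn_pos[OF PQ] mult_1] by blast
  have m0: "m 0 = 0" using eventually_nhds_x_imp_x[OF fe] f0 s(2) by simp
  define \<tau> where "\<tau> z = (vector [z $ 1, s z] :: real^2)" for z
  have \<tau>: "smooth_at \<tau> 0" unfolding \<tau>_def by (intro sm s)
  have inj\<tau>: "inj (D \<tau> 0)"
    unfolding \<tau>_def by (rule inj_D_triangular2) (use s in \<open>auto intro!: sm\<close>)
  have \<tau>0: "\<tau> 0 = 0" by (simp add: \<tau>_def s)
  obtain g where g: "smooth_at g (\<tau> 0)" "g (\<tau> 0) = 0" "\<forall>\<^sub>F z in nhds 0. g (\<tau> z) = z"
    "\<forall>\<^sub>F y in nhds (\<tau> 0). \<tau> (g y) = y"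
    by (rule local_inverse[OF \<tau> inj\<tau>]) blast
  note g = g[unfolded \<tau>0]
  define F2 where "F2 z = \<kappa>1 (F (g z))" for z
  have x1: "presents x p (\<lambda>z. \<kappa>1 (F z))" by (rule presents_compose_target[OF x \<kappa>1 inj\<kappa>1 \<kappa>10])
  have F2s: "smooth_at F2 0"
    unfolding F2_def by (rule smooth_at_compose[where f=g]) (use x1 g in \<open>auto simp: presents_def\<close>)
  have x2: "presents x p F2"
    by (rule presents_source[OF x1 \<tau> inj\<tau> \<tau>0 F2s]) (use g(3) in eventually_elim, simp add: F2_def)
  have F2e: "\<forall>\<^sub>F z in nhds 0. F2 z $ 1 = z $ 1 \<and> F2 z $ 2 = m (vector [z $ 1, 0]) + (z $ 2)\<^sup>2"
    using g(4) eventually_nhds_smooth[OF g(1), unfolded g(2), OF fe]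
      eventually_nhds_smooth[OF g(1), unfolded g(2), OF F1]
  proof eventually_elim
    case (elim z)
    from arg_cong[OF elim(1), of "\<lambda>w. w $ 1"] arg_cong[OF elim(1), of "\<lambda>w. w $ 2"]
    have "g z $ 1 = z $ 1" "s (g z) = z $ 2" by (simp_all add: \<tau>_def)
    then show ?case using elim(2,3) by (simp add: F2_def \<kappa>1_def f_def)
  qed
  \<comment> \<open>The parameter term \<open>m\<close> depends on the first coordinate alone, which
    is also a target coordinate, so it can be subtracted there.\<close>
  define \<kappa>2 where "\<kappa>2 y = (vector [y $ 1, y $ 2 - m (vector [y $ 1, 0]), y $ 3] :: real^3)" for y :: "real^3"
  have pm: "smooth_at (\<lambda>y::real^3. vector [y $ 1, 0] :: real^2) z" for z by (intro sm)
  have ms: "smooth_at (\<lambda>y::real^3. m (vector [y $ 1, 0])) 0"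
    by (rule smooth_at_compose[OF _ pm]) (use m in simp)
  have Dms: "D (\<lambda>y::real^3. m (vector [y $ 1, 0])) 0 w = w $ 1 * D m 0 (axis 1 1)" for w
  proof -
    have "D (\<lambda>y::real^3. m (vector [y $ 1, 0])) 0 w = D m (vector [(0::real^3) $ 1, 0]) (D (\<lambda>y::real^3. vector [y $ 1, 0] :: real^2) 0 w)"
      by (rule D_compose[OF _ pm]) (use m in simp)
    also have "D (\<lambda>y::real^3. vector [y $ 1, 0] :: real^2) 0 w = w $ 1 *\<^sub>R axis 1 1"
      by (subst D_vector2) (simp_all add: sm vector_10_scale)
    finally show ?thesis by (simp add: linear_scale[OF smooth_at_linear_D[OF m]])
  qed
  have \<kappa>2: "smooth_at \<kappa>2 0" unfolding \<kappa>2_def by (intro sm ms)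
  have inj\<kappa>2: "inj (D \<kappa>2 0)"
    unfolding \<kappa>2_def by (rule inj_D_triangular3) (simp_all add: sm ms D_diff Dms)
  have \<kappa>20: "\<kappa>2 0 = 0" by (simp add: \<kappa>2_def m0)
  define F3 where "F3 z = \<kappa>2 (F2 z)" for z
  have x3: "presents x p F3" unfolding F3_def by (rule presents_compose_target[OF x2 \<kappa>2 inj\<kappa>2 \<kappa>20])
  have F3e: "\<forall>\<^sub>F z in nhds 0. F3 z $ 1 = z $ 1 \<and> F3 z $ 2 = (z $ 2)\<^sup>2"
    using F2e by eventually_elim (simp add: F3_def \<kappa>2_def)
  define h where "h z = F3 z $ 3" for z
  have h: "smooth_at h 0" "h 0 = 0" unfolding h_def using x3 by (auto simp: presents_def intro!: sm)
  have rs: "smooth_at reflect2 z" for z by (rule smooth_at_bounded_linear[OF bounded_linear_reflect2])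
  have r0 [simp]: "reflect2 0 = 0" by (simp add: vec_eq_iff forall_2)
  have rr [simp]: "reflect2 (reflect2 z) = z" for z by (simp add: vec_eq_iff forall_2)
  have hr: "smooth_at (\<lambda>z. h (reflect2 z)) 0" by (rule smooth_at_compose[OF _ rs]) (use h in simp)
  have "smooth_at (\<lambda>z. (h z + h (reflect2 z)) / 2) 0" by (intro sm h hr) simp
  then obtain G1 :: "real^2 \<Rightarrow> real" where G1: "smooth_at G1 0"
    "\<forall>\<^sub>F z in nhds 0. (h z + h (reflect2 z)) / 2 = G1 (vector [z $ 1, (z $ 2)\<^sup>2])"
    by (rule even_function[of "\<lambda>z. (h z + h (reflect2 z)) / 2"]) (auto simp: add.commute)
  have G10: "G1 0 = 0" using eventually_nhds_x_imp_x[OF G1(2)] by (simp add: h)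
  \<comment> \<open>The odd part vanishes on the first axis, so Hadamard's lemma divides it by
    \<open>z $ 2\<close>, and the quotient is even.\<close>
  define odd where "odd z = (h z - h (reflect2 z)) / 2" for z
  have odd: "smooth_at odd 0" unfolding odd_def by (intro sm h hr) simp
  obtain k where k: "smooth_at k 0" "\<forall>\<^sub>F z in nhds 0. odd z - odd (vector [z $ 1, 0]) = z $ 2 * k z"
    using Hadamard_at[OF odd] by blast
  have odd0: "odd (vector [u, 0]) = 0" for u by (simp add: odd_def reflect2_def)
  have ke: "\<forall>\<^sub>F z in nhds 0. odd z = z $ 2 * k z" using k(2) by (simp add: odd0)
  have ker: "\<forall>\<^sub>F z in nhds 0. odd (reflect2 z) = reflect2 z $ 2 * k (reflect2 z)"
    by (rule eventually_nhds_smooth[OF rs]) (use ke in simp)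
  have keven: "\<forall>\<^sub>F z in nhds 0. k (reflect2 z) = k z"
    using ke ker
  proof eventually_elim
    case (elim z)
    have "odd (reflect2 z) = - odd z" by (simp add: odd_def field_simps)
    then have "z $ 2 * k (reflect2 z) = z $ 2 * k z" using elim by simp
    moreover have "reflect2 z = z" if "z $ 2 = 0" using that by (simp add: vec_eq_iff forall_2)
    ultimately show ?case by (cases "z $ 2 = 0") auto
  qed
  obtain G2 :: "real^2 \<Rightarrow> real" where G2: "smooth_at G2 0" "\<forall>\<^sub>F z in nhds 0. k z = G2 (vector [z $ 1, (z $ 2)\<^sup>2])"
    by (rule even_function[OF k(1) keven]) blast
  \<comment> \<open>The even part is \<open>G1\<close> evaluated at the first two target components,
    hence removable by a target change.\<close>
  define \<kappa>3 where "\<kappa>3 y = (vector [y $ 1, y $ 2, y $ 3 - G1 (vector [y $ 1, y $ 2])] :: real^3)" for y :: "real^3"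
  have \<kappa>3: "smooth_at \<kappa>3 0" unfolding \<kappa>3_def by (intro sm smooth_pair3_compose G1)
  have inj\<kappa>3: "inj (D \<kappa>3 0)"
    unfolding \<kappa>3_def
    by (rule inj_D_triangular3)
      (simp_all add: sm D_diff D_pair3_compose smooth_pair3_compose G1 linear_0[OF smooth_at_linear_D])
  have \<kappa>30: "\<kappa>3 0 = 0" by (simp add: \<kappa>3_def G10)
  have x4: "presents x p (\<lambda>z. \<kappa>3 (F3 z))" by (rule presents_compose_target[OF x3 \<kappa>3 inj\<kappa>3 \<kappa>30])
  have "\<forall>\<^sub>F z in nhds 0. \<kappa>3 (F3 z) = fold_map G2 z"
    using F3e G1(2) G2(2) ke
  proof eventually_elim
    case (elim z)
    have "h z - G1 (vector [z $ 1, (z $ 2)\<^sup>2]) = odd z" using elim(2) by (simp add: odd_def field_simps)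
    then show ?case using elim by (simp add: \<kappa>3_def fold_map_def h_def[symmetric] vec_eq_iff forall_3)
  qed
  then show ?thesis using that[OF G2(1)] presents_cong[OF x4] by blast
qed

text \<open>Here \<open>A\<close> and \<open>B\<close> are functions of \<open>(u, Y)\<close> with
  \<open>Y = t\<^sup>2\<close>. The target change \<open>(A, y $ 2, y $ 3 * B)\<close> and the
  source change \<open>(A, z $ 2)\<close> both make sense because the first two components of a fold
  map are \<open>u\<close> and \<open>Y\<close>; \<open>Q\<close> is the resulting conjugacy written
  at \<open>(u, Y)\<close>.\<close>

lemma presents_fold_imp:
  assumes x: "presents x p (fold_map G)"
    and A: "smooth_at A 0" "A 0 = 0" "D A 0 (axis 1 1) \<noteq> 0" and B: "smooth_at B 0" "B 0 \<noteq> 0"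
    and H: "smooth_at H 0"
    and Q: "\<forall>\<^sub>F z in nhds 0. \<forall>t. z $ 2 = t\<^sup>2 \<longrightarrow> vector [A z, z $ 2, t * (G z * B z)] = H (vector [A z, t])"
  shows "presents x p H"
proof -
  define \<kappa> where "\<kappa> y = (vector [A (vector [y $ 1, y $ 2]), y $ 2, y $ 3 * B (vector [y $ 1, y $ 2])] :: real^3)" for y :: "real^3"
  have As: "smooth_at (\<lambda>y::real^3. A (vector [y $ 1, y $ 2])) 0" by (intro smooth_pair3_compose A)
  have Bs: "smooth_at (\<lambda>y::real^3. B (vector [y $ 1, y $ 2])) 0" by (intro smooth_pair3_compose B)
  have \<kappa>: "smooth_at \<kappa> 0" unfolding \<kappa>_def by (intro sm As Bs)
  have inj\<kappa>: "inj (D \<kappa> 0)"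
    unfolding \<kappa>_def
  proof (rule inj_D_triangular3)
    fix w :: "real^3"
    assume w: "D (\<lambda>y::real^3. A (vector [y $ 1, y $ 2])) 0 w = 0" "D (\<lambda>y::real^3. y $ 2) 0 w = 0"
      "D (\<lambda>y::real^3. y $ 3 * B (vector [y $ 1, y $ 2])) 0 w = 0"
    then have w23: "w $ 2 = 0" "w $ 3 = 0" using B by (simp_all add: D_mult Bs sm)
    then have "w $ 1 * D A 0 (axis 1 1) = 0"
      using w(1) by (simp add: D_pair3_compose[OF A(1)] vector_10_scale linear_scale[OF smooth_at_linear_D[OF A(1)]])
    then show "w $ 1 = 0 \<and> w $ 2 = 0 \<and> w $ 3 = 0" using w23 A(3) by simp
  qed (intro sm As Bs)+
  have \<kappa>0: "\<kappa> 0 = 0" by (simp add: \<kappa>_def A)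
  have x1: "presents x p (\<lambda>z. \<kappa> (fold_map G z))" by (rule presents_compose_target[OF x \<kappa> inj\<kappa> \<kappa>0])
  define \<sigma> where "\<sigma> z = (vector [A (vector [z $ 1, (z $ 2)\<^sup>2]), z $ 2] :: real^2)" for z :: "real^2"
  have Aq: "smooth_at (\<lambda>z::real^2. A (vector [z $ 1, (z $ 2)\<^sup>2])) 0" by (intro smooth_square_compose A)
  have \<sigma>: "smooth_at \<sigma> 0" unfolding \<sigma>_def by (intro sm Aq)
  have inj\<sigma>: "inj (D \<sigma> 0)"
    unfolding \<sigma>_def
    by (rule inj_D_triangular2)
      (use A Aq in \<open>auto intro!: sm simp: D_square_compose vector_10_scale\<close>)
  have \<sigma>0: "\<sigma> 0 = 0" by (simp add: \<sigma>_def A)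
  show ?thesis
  proof (rule presents_source[OF x1 \<sigma> inj\<sigma> \<sigma>0 H])
    show "\<forall>\<^sub>F z in nhds 0. \<kappa> (fold_map G z) = H (\<sigma> z)"
      using ev_square[OF Q]
    proof eventually_elim
      case (elim z)
      then show ?case
        by (simp add: \<kappa>_def fold_map_def \<sigma>_def mult.assoc)
    qed
  qed
qed

section \<open>Recognition of the cross cap and of the two S1 singularities\<close>

lemma smooth_cross_cap: "smooth_at cross_cap_map z"
  unfolding cross_cap_map_def by (intro sm)

lemma smooth_S1: "smooth_at S1_plus_map z" "smooth_at S1_minus_map z"
  unfolding S1_plus_map_def S1_minus_map_def by (intro sm)+

lemma fold_map_cross_cap: "fold_map (\<lambda>z. z $ 1) = cross_cap_map"
  by (simp add: fun_eq_iff fold_map_def cross_cap_map_def mult.commute)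

lemma fold_map_S1:
  "fold_map (\<lambda>z. (z $ 1)\<^sup>2 + z $ 2) = S1_plus_map"
  "fold_map (\<lambda>z. (z $ 1)\<^sup>2 - z $ 2) = S1_minus_map"
  by (simp_all add: fun_eq_iff fold_map_def S1_plus_map_def S1_minus_map_def)

text \<open>The function \<open>G\<close> itself is taken as new first coordinate, with
  \<open>B = 1\<close>.\<close>

lemma presents_cross_cap:
  assumes x: "presents x p (fold_map G)" and G: "smooth_at G 0" "G 0 = 0" "D G 0 (axis 1 1) \<noteq> 0"
  shows "presents x p cross_cap_map"
  by (rule presents_fold_imp[OF x G, of "\<lambda>z. 1"])
    (auto simp: smooth_cross_cap cross_cap_map_def mult.commute)

text \<open>Morse's lemma singles out the second variable, whereas \<open>G\<close> is to be made
  quadratic in its first one.\<close>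

definition swap2 :: "real^2 \<Rightarrow> real^2" where
  "swap2 z = vector [z $ 2, z $ 1]"

lemma swap2_simps [simp]: "swap2 z $ 1 = z $ 2" "swap2 z $ 2 = z $ 1" "swap2 (swap2 z) = z"
  "swap2 (axis 1 1) = axis 2 1" "swap2 (axis 2 1) = axis 1 1" "swap2 0 = 0"
  by (simp_all add: swap2_def vec_eq_iff forall_2)

lemma bounded_linear_swap2: "bounded_linear swap2"
  by (intro linear_conv_bounded_linear[THEN iffD1] linearI) (simp_all add: vec_eq_iff forall_2)

lemma smooth_swap2: "smooth_at swap2 z"
  by (rule smooth_at_bounded_linear[OF bounded_linear_swap2])

text \<open>Morse's lemma in \<open>u\<close> with parameter \<open>Y\<close> gives
  \<open>G = Y * n + sgn c * S\<^sup>2\<close>, where \<open>n 0\<close> is the derivative of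
  \<open>G\<close> in \<open>Y\<close>. Dividing by the absolute value of \<open>n\<close>, which
  \<open>A\<close> and \<open>B\<close> do, leaves \<open>A\<^sup>2\<close> plus or minus
  \<open>Y\<close>.\<close>

lemma presents_S1:
  assumes x: "presents x p (fold_map G)" and G: "smooth_at G 0" "G 0 = 0" "D G 0 (axis 1 1) = 0"
    and Guu: "D (\<lambda>z. D G z (axis 1 1)) 0 (axis 1 1) \<noteq> 0" and GY: "D G 0 (axis 2 1) \<noteq> 0"
  shows "presents x p
    (if D (\<lambda>z. D G z (axis 1 1)) 0 (axis 1 1) * D G 0 (axis 2 1) > 0 then S1_plus_map else S1_minus_map)"
proof -
  define f where "f z = G (swap2 z)" for z
  have f: "smooth_at f 0" unfolding f_def by (rule smooth_at_compose[OF _ smooth_swap2]) (use G in simp)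
  have Df: "\<forall>\<^sub>F z in nhds 0. D f z (axis 2 1) = D G (swap2 z) (axis 1 1)"
  proof -
    have "\<forall>\<^sub>F z in nhds 0. smooth_at G (swap2 z)"
      by (rule eventually_nhds_smooth[OF smooth_swap2]) (use smooth_at_eventually[OF G(1)] in simp)
    then show ?thesis
      by eventually_elim
        (simp add: f_def[abs_def] D_compose[OF _ smooth_swap2] D_linear[OF bounded_linear_swap2])
  qed
  have fv: "D f 0 (axis 2 1) = 0" using eventually_nhds_x_imp_x[OF Df] G by simp
  define c where "c = D (\<lambda>z. D G z (axis 1 1)) 0 (axis 1 1)"
  have fvv: "D (\<lambda>z. D f z (axis 2 1)) 0 (axis 2 1) = c"
  proof -
    have "D (\<lambda>z. D f z (axis 2 1)) 0 (axis 2 1) = D (\<lambda>z. D G (swap2 z) (axis 1 1)) 0 (axis 2 1)"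
      using D_cong_ev[OF Df] by simp
    also have "\<dots> = D (\<lambda>z. D G z (axis 1 1)) (swap2 0) (D swap2 0 (axis 2 1))"
      by (rule D_compose[OF _ smooth_swap2]) (use G in \<open>auto intro: smooth_at_D\<close>)
    finally show ?thesis by (simp add: D_linear[OF bounded_linear_swap2] c_def)
  qed
  have c0: "c \<noteq> 0" using Guu by (simp add: c_def)
  then have fvv0: "D (\<lambda>z. D f z (axis 2 1)) 0 (axis 2 1) \<noteq> 0" by (simp add: fvv)
  obtain s m :: "real^2 \<Rightarrow> real" where s: "smooth_at s 0" "s 0 = 0" "D s 0 (axis 2 1) \<noteq> 0"
    and m: "smooth_at m 0" and fe: "\<forall>\<^sub>F z in nhds 0. f z = m (vector [z $ 1, 0]) + sgn c * (s z)\<^sup>2"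
    using Morse_with_parameter[OF f fv fvv0, unfolded fvv] by blast
  have m0: "m 0 = 0" using eventually_nhds_x_imp_x[OF fe] s(2) G(2) by (simp add: f_def)
  define m' where "m' z = m (vector [z $ 2, 0])" for z :: "real^2"
  have p2: "smooth_at (\<lambda>z::real^2. vector [z $ 2, 0] :: real^2) z" for z by (intro sm)
  have m': "smooth_at m' 0" unfolding m'_def by (rule smooth_at_compose[OF _ p2]) (use m in simp)
  obtain k where k: "smooth_at k 0" "\<forall>\<^sub>F z in nhds 0. m' z - m' (vector [z $ 1, 0]) = z $ 2 * k z"
    using Hadamard_at[OF m'] by blast
  define n where "n z = k (vector [0, z $ 2])" for z :: "real^2"
  have p3: "smooth_at (\<lambda>z::real^2. vector [0, z $ 2] :: real^2) z" for z by (intro sm)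
  have n: "smooth_at n 0" unfolding n_def by (rule smooth_at_compose[OF _ p3]) (use k in simp)
  have "\<forall>\<^sub>F z::real^2 in nhds 0. m' (vector [0, z $ 2]) - m' (vector [(vector [0, z $ 2] :: real^2) $ 1, 0]) = (vector [0, z $ 2] :: real^2) $ 2 * k (vector [0, z $ 2])"
    by (rule eventually_nhds_smooth[OF p3]) (use k(2) in simp)
  then have mn: "\<forall>\<^sub>F z in nhds 0. m' z = z $ 2 * n z"
    by eventually_elim (simp add: m'_def n_def m0)
  define S where "S z = s (swap2 z)" for z
  have S: "smooth_at S 0" unfolding S_def by (rule smooth_at_compose[OF _ smooth_swap2]) (use s in simp)
  have S0: "S 0 = 0" by (simp add: S_def s)
  have DS: "D S 0 (axis 1 1) = D s 0 (axis 2 1)"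
    unfolding S_def by (subst D_compose[OF _ smooth_swap2]) (simp_all add: s D_linear[OF bounded_linear_swap2])
  have "\<forall>\<^sub>F z in nhds 0. f (swap2 z) = m (vector [swap2 z $ 1, 0]) + sgn c * (s (swap2 z))\<^sup>2"
    by (rule eventually_nhds_smooth[OF smooth_swap2]) (use fe in simp)
  then have Ge: "\<forall>\<^sub>F z in nhds 0. G z = z $ 2 * n z + sgn c * (S z)\<^sup>2"
    using mn by eventually_elim (simp add: f_def S_def m'_def)
  have n0: "n 0 = D G 0 (axis 2 1)"
  proof -
    have "D G 0 (axis 2 1) = D (\<lambda>z. z $ 2 * n z + sgn c * (S z)\<^sup>2) 0 (axis 2 1)"
      using D_cong_ev[OF Ge] by simp
    then show ?thesis using n S by (simp add: D_add D_mult D_power2 sm S0)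
  qed
  define \<gamma> where "\<gamma> = sgn (n 0)"
  have \<gamma>: "\<gamma> * \<gamma> = 1" "\<gamma> * n 0 > 0" using GY by (auto simp: \<gamma>_def n0 sgn_if)
  have \<epsilon>: "sgn c * sgn c = 1" using c0 by (simp add: sgn_if)
  have npos: "\<forall>\<^sub>F z in nhds 0. \<gamma> * n z > 0"
  proof -
    have "smooth_at (\<lambda>z. \<gamma> * n z) 0" by (intro sm n)
    moreover have "\<forall>\<^sub>F t in nhds (\<gamma> * n 0). t > 0"
      using \<gamma>(2) eventually_nhds open_greaterThan by (metis greaterThan_iff)
    ultimately show ?thesis by (rule eventually_nhds_smooth)
  qed
  define A where "A z = S z * inverse (sqrt (\<gamma> * n z))" for z
  define B where "B z = sgn c / (\<gamma> * n z)" for z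
  have r: "smooth_at (\<lambda>z. inverse (sqrt (\<gamma> * n z))) 0" using \<gamma>(2) by (intro sm n) auto
  have A: "smooth_at A 0" "A 0 = 0" unfolding A_def by (intro sm S r) (simp add: S0)
  have DA: "D A 0 (axis 1 1) \<noteq> 0"
    unfolding A_def using \<gamma>(2) s(3) by (subst D_mult[OF S r]) (auto simp: S0 DS)
  have B: "smooth_at B 0" "B 0 \<noteq> 0" unfolding B_def using \<gamma> c0 by (auto intro!: sm n simp: sgn_eq_0_iff)
  have key: "\<forall>\<^sub>F z in nhds 0. \<forall>t. z $ 2 = t\<^sup>2 \<longrightarrow>
      t * (G z * B z) = t * ((A z)\<^sup>2 + sgn c * \<gamma> * t\<^sup>2)"
    using Ge npos
  proof eventually_elim
    case (elim z)
    have "(A z)\<^sup>2 = (S z)\<^sup>2 / (\<gamma> * n z)"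
      using elim(2) by (simp add: A_def power_mult_distrib power_inverse divide_inverse)
    moreover have "G z * B z = (sgn c * sgn c) * (S z)\<^sup>2 / (\<gamma> * n z) + sgn c * (\<gamma> * \<gamma>) * z $ 2 * n z / (\<gamma> * n z)"
      unfolding \<gamma>(1) using elim(1) by (simp add: B_def algebra_simps add_divide_distrib)
    moreover have "sgn c * (\<gamma> * \<gamma>) * z $ 2 * n z / (\<gamma> * n z) = sgn c * \<gamma> * z $ 2"
      using elim(2) by (auto simp: field_simps)
    ultimately have "G z * B z = (A z)\<^sup>2 + sgn c * \<gamma> * z $ 2" using c0 by (simp add: \<epsilon>)
    then show ?case by simp
  qed
  \<comment> \<open>The sign that separates the two normal forms is that of the product of the
    second derivative in \<open>u\<close> and the first derivative in \<open>Y\<close>.\<close>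
  have sgn: "sgn c * \<gamma> = (if c * n 0 > 0 then 1 else -1)"
    using c0 GY by (auto simp: \<gamma>_def n0 sgn_if zero_less_mult_iff)
  show ?thesis
  proof (cases "c * n 0 > 0")
    case True
    have "presents x p S1_plus_map"
      by (rule presents_fold_imp[OF x A DA B smooth_S1(1)])
        (use key in eventually_elim, use True sgn in \<open>auto simp: S1_plus_map_def\<close>)
    then show ?thesis using True by (simp add: c_def n0)
  next
    case False
    have "presents x p S1_minus_map"
      by (rule presents_fold_imp[OF x A DA B smooth_S1(2)])
        (use key in eventually_elim, use False sgn in \<open>auto simp: S1_minus_map_def\<close>)
    then show ?thesis using False by (simp add: c_def n0)
  qed
qed

section \<open>Second derivatives and orders of vanishing\<close>

abbreviation D2 :: "('a::real_normed_vector \<Rightarrow> 'b::real_normed_vector) \<Rightarrow> 'a \<Rightarrow> 'a \<Rightarrow> 'a \<Rightarrow> 'b" where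
  "D2 f z a b \<equiv> D (\<lambda>z. D f z a) z b"

lemma linear_D2_left:
  assumes "smooth_at f z" shows "linear (\<lambda>a. D2 f z a b)"
proof (rule linearI)
  fix a a' and c :: real
  have ev: "\<forall>\<^sub>F y in nhds z. linear (D f y)"
    using smooth_at_eventually[OF assms] by eventually_elim (rule smooth_at_linear_D)
  have "\<forall>\<^sub>F y in nhds z. D f y (a + a') = D f y a + D f y a'"
    using ev by eventually_elim (rule linear_add)
  from D_cong_ev[OF this] show "D2 f z (a + a') b = D2 f z a b + D2 f z a' b"
    using D_add[OF smooth_at_D[OF assms] smooth_at_D[OF assms]] by simp
  have "\<forall>\<^sub>F y in nhds z. D f y (c *\<^sub>R a) = c *\<^sub>R D f y a"
    using ev by eventually_elim (rule linear_scale)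
  from D_cong_ev[OF this] show "D2 f z (c *\<^sub>R a) b = c *\<^sub>R D2 f z a b"
    using D_scaleR[OF smooth_at_const smooth_at_D[OF assms]] by simp
qed

lemma linear_D2_right: "smooth_at f z \<Longrightarrow> linear (D2 f z a)"
  by (intro smooth_at_linear_D smooth_at_D)

text \<open>The direction \<open>w\<close> is expanded in the basis, so that the base point and the
  direction can be differentiated separately.\<close>

lemma D_D_compose:
  fixes f :: "'a::euclidean_space \<Rightarrow> 'b::euclidean_space" and g :: "'b \<Rightarrow> 'c::real_normed_vector"
  assumes g: "smooth_at g (f z)" and f: "smooth_at f z" and w: "smooth_at w z"
  shows "D (\<lambda>z. D g (f z) (w z)) z v = D2 g (f z) (w z) (D f z v) + D g (f z) (D w z v)"
proof -
  have gf: "smooth_at (\<lambda>z. D g (f z) e) z" for e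
    by (rule smooth_at_compose[OF _ f]) (intro smooth_at_D g)
  have "\<forall>\<^sub>F y in nhds z. D g (f y) (w y) = (\<Sum>e\<in>Basis. (w y \<bullet> e) *\<^sub>R D g (f y) e)"
    using eventually_nhds_smooth[OF f smooth_at_eventually[OF g]]
    by eventually_elim (intro linear_basis_sum smooth_at_linear_D)
  then have "D (\<lambda>z. D g (f z) (w z)) z v = D (\<lambda>y. \<Sum>e\<in>Basis. (w y \<bullet> e) *\<^sub>R D g (f y) e) z v"
    using D_cong_ev by fastforce
  also have "\<dots> = (\<Sum>e\<in>Basis. D (\<lambda>y. (w y \<bullet> e) *\<^sub>R D g (f y) e) z v)"
    by (rule D_sum) (intro sm w gf)
  also have "\<dots> = (\<Sum>e\<in>Basis. (D w z v \<bullet> e) *\<^sub>R D g (f z) e + (w z \<bullet> e) *\<^sub>R D2 g (f z) e (D f z v))"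
  proof (rule sum.cong[OF refl])
    fix e :: 'b
    have "D (\<lambda>y. (w y \<bullet> e) *\<^sub>R D g (f y) e) z v = D (\<lambda>y. w y \<bullet> e) z v *\<^sub>R D g (f z) e + (w z \<bullet> e) *\<^sub>R D (\<lambda>y. D g (f y) e) z v"
      by (rule D_scaleR) (intro sm w gf)+
    also have "D (\<lambda>y. w y \<bullet> e) z v = D w z v \<bullet> e"
      using D_bilinear[OF bounded_bilinear_inner w smooth_at_const] by simp
    also have "D (\<lambda>y. D g (f y) e) z v = D2 g (f z) e (D f z v)"
      by (rule D_compose) (intro smooth_at_D g f)+
    finally show "D (\<lambda>y. (w y \<bullet> e) *\<^sub>R D g (f y) e) z v =
      (D w z v \<bullet> e) *\<^sub>R D g (f z) e + (w z \<bullet> e) *\<^sub>R D2 g (f z) e (D f z v)" .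
  qed
  also have "\<dots> = D g (f z) (D w z v) + D2 g (f z) (w z) (D f z v)"
    unfolding sum.distrib
    using linear_basis_sum[OF smooth_at_linear_D[OF g], of "D w z v"]
      linear_basis_sum[OF linear_D2_left[OF g], of "w z" "D f z v"] by simp
  finally show ?thesis by simp
qed

lemma D_D_dir:
  fixes g :: "'a::euclidean_space \<Rightarrow> 'b::real_normed_vector"
  assumes "smooth_at g z" "smooth_at w z"
  shows "D (\<lambda>z. D g z (w z)) z v = D2 g z (w z) v + D g z (D w z v)"
  using D_D_compose[of g "\<lambda>z. z" z w v] assms by simp

lemma D2_compose:
  fixes f :: "'a::euclidean_space \<Rightarrow> 'b::euclidean_space" and g :: "'b \<Rightarrow> 'c::real_normed_vector"
  assumes g: "smooth_at g (f z)" and f: "smooth_at f z"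
  shows "D2 (\<lambda>z. g (f z)) z a b = D2 g (f z) (D f z a) (D f z b) + D g (f z) (D2 f z a b)"
proof -
  have "\<forall>\<^sub>F y in nhds z. D (\<lambda>z. g (f z)) y a = D g (f y) (D f y a)"
    using eventually_nhds_smooth[OF f smooth_at_eventually[OF g]] smooth_at_eventually[OF f]
    by eventually_elim (rule D_compose)
  from D_cong_ev[OF this] show ?thesis
    using D_D_compose[OF g f smooth_at_D[OF f]] by simp
qed

lemma D2_symmetric_vec:
  fixes f :: "'a::euclidean_space \<Rightarrow> real^'n"
  assumes f: "smooth_at f z" shows "D2 f z a b = D2 f z b a"
proof -
  have "D2 f z a b $ i = D2 (\<lambda>z. f z $ i) z a b" for a b i
  proof -
    have "\<forall>\<^sub>F y in nhds z. D (\<lambda>z. f z $ i) y a = D f y a $ i"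
      using smooth_at_eventually[OF f] by eventually_elim (rule D_nth)
    from D_cong_ev[OF this] show ?thesis using D_nth[OF smooth_at_D[OF f]] by simp
  qed
  then show ?thesis using D2_symmetric[OF smooth_at_nth[OF f]] by (simp add: vec_eq_iff)
qed

text \<open>Vanishing of all derivatives of order below \<open>n\<close>: membership in the
  \<open>n\<close>-th power of the maximal ideal of smooth germs at \<open>p\<close>. The
  multiplicativity of these ideals is \<open>van_mult\<close>.\<close>

primrec van :: "nat \<Rightarrow> ('a::real_normed_vector \<Rightarrow> real) \<Rightarrow> 'a \<Rightarrow> bool" where
  "van 0 h p \<longleftrightarrow> smooth_at h p"
| "van (Suc n) h p \<longleftrightarrow> smooth_at h p \<and> h p = 0 \<and> (\<forall>v. van n (\<lambda>z. D h z v) p)"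

lemma van_smooth: "van n h p \<Longrightarrow> smooth_at h p"
  by (cases n) auto

lemma van_SucD: "van (Suc n) h p \<Longrightarrow> van n h p"
  by (induction n arbitrary: h) auto

lemma van_cong:
  assumes "\<forall>\<^sub>F z in nhds p. h z = k z" "van n h p" shows "van n k p"
  using assms
proof (induction n arbitrary: h k)
  case 0
  then show ?case using smooth_at_cong_ev by auto
next
  case (Suc n)
  have *: "\<forall>\<^sub>F z in nhds p. D h z v = D k z v" for v
    using ev_nhds2[OF Suc.prems(1)] by eventually_elim (simp add: D_cong_ev)
  have "van n (\<lambda>z. D k z v) p" for v
    by (rule Suc.IH[OF *]) (use Suc.prems(2) in simp)
  then show ?case
    using Suc.prems smooth_at_cong_ev eventually_nhds_x_imp_x[OF Suc.prems(1)] by auto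
qed

lemma van_add:
  "van n h p \<Longrightarrow> van n k p \<Longrightarrow> van n (\<lambda>z. h z + k z) p"
proof (induction n arbitrary: h k)
  case 0
  then show ?case by (auto intro: sm)
next
  case (Suc n)
  have "van n (\<lambda>z. D (\<lambda>z. h z + k z) z v) p" for v
  proof (rule van_cong)
    show "\<forall>\<^sub>F z in nhds p. D h z v + D k z v = D (\<lambda>z. h z + k z) z v"
      using smooth_at_eventually[OF van_smooth[OF Suc.prems(1)]] smooth_at_eventually[OF van_smooth[OF Suc.prems(2)]]
      by eventually_elim (simp add: D_add)
    show "van n (\<lambda>z. D h z v + D k z v) p" using Suc by auto
  qed
  then show ?case using Suc.prems by (auto intro: sm)
qed

lemma van_mult:
  assumes "van m h p" "van n k p" shows "van (m + n) (\<lambda>z. h z * k z) p"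
  using assms
proof (induction "m + n" arbitrary: m n h k)
  case 0
  then show ?case by (auto intro: sm)
next
  case (Suc l)
  note hs = van_smooth[OF Suc.prems(1)] and ks = van_smooth[OF Suc.prems(2)]
  have "van l (\<lambda>z. D (\<lambda>z. h z * k z) z v) p" for v
  proof (rule van_cong)
    show "\<forall>\<^sub>F z in nhds p. D h z v * k z + h z * D k z v = D (\<lambda>z. h z * k z) z v"
      using smooth_at_eventually[OF hs] smooth_at_eventually[OF ks]
      by eventually_elim (simp add: D_mult)
    show "van l (\<lambda>z. D h z v * k z + h z * D k z v) p"
    proof (rule van_add)
      show "van l (\<lambda>z. D h z v * k z) p"
      proof (cases m)
        \<comment> \<open>The factor \<open>h\<close> has no order to lose, but then
          \<open>k\<close> alone carries order \<open>Suc l\<close>.\<close>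
        case 0
        then have "n = Suc l" using Suc.hyps(2) by simp
        then have "van l k p" using van_SucD Suc.prems(2) by blast
        moreover have "van 0 (\<lambda>z. D h z v) p" using hs by (auto intro: smooth_at_D)
        ultimately show ?thesis using Suc.hyps(1)[of 0 l] by simp
      next
        case (Suc m')
        then show ?thesis using Suc.hyps(1)[of m' n] Suc.hyps(2) Suc.prems by auto
      qed
      show "van l (\<lambda>z. h z * D k z v) p"
      proof (cases n)
        case 0
        then have "m = Suc l" using Suc.hyps(2) by simp
        then have "van l h p" using van_SucD Suc.prems(1) by blast
        moreover have "van 0 (\<lambda>z. D k z v) p" using ks by (auto intro: smooth_at_D)
        ultimately show ?thesis using Suc.hyps(1)[of l 0] by simp
      next
        case (Suc n')
        then show ?thesis using Suc.hyps(1)[of m n'] Suc.hyps(2) Suc.prems by auto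
      qed
    qed
  qed
  moreover have "h p * k p = 0"
    using Suc by (cases m; cases n) auto
  moreover have "smooth_at (\<lambda>z. h z * k z) p" by (intro sm hs ks)
  ultimately show ?case unfolding Suc.hyps(2)[symmetric] by simp
qed

lemma van_1: "smooth_at h p \<Longrightarrow> h p = 0 \<Longrightarrow> van 1 h p"
  by (auto intro: smooth_at_D)

lemma van_mult_right: "van n h p \<Longrightarrow> smooth_at k p \<Longrightarrow> van n (\<lambda>z. h z * k z) p"
  using van_mult[of n h p 0 k] by simp

lemma van_zero: "van n (\<lambda>z. 0) p"
  by (induction n) auto

lemma van_sum: "(\<And>i. i \<in> I \<Longrightarrow> van n (h i) p) \<Longrightarrow> van n (\<lambda>z. \<Sum>i\<in>I. h i z) p"
proof (induction I rule: infinite_finite_induct)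
  case (insert i I)
  then show ?case using van_add[of n "h i" p "\<lambda>z. \<Sum>i\<in>I. h i z"] by simp
qed (simp_all add: van_zero)

lemma van_prod3:
  assumes "smooth_at f p" "f p = 0" "smooth_at g p" "g p = 0" "smooth_at h p" "h p = 0"
  shows "van 3 (\<lambda>z. f z * g z * h z) p"
  using van_mult[OF van_mult[OF van_1[OF assms(1,2)] van_1[OF assms(3,4)]] van_1[OF assms(5,6)]]
  by (simp add: numeral_3_eq_3)

lemma D2_add:
  fixes h k :: "'a::real_normed_vector \<Rightarrow> real"
  assumes "smooth_at h p" "smooth_at k p"
  shows "D2 (\<lambda>z. h z + k z) p v w = D2 h p v w + D2 k p v w"
proof -
  have "\<forall>\<^sub>F z in nhds p. D (\<lambda>z. h z + k z) z v = D h z v + D k z v"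
    using assms[THEN smooth_at_eventually] by eventually_elim (rule D_add)
  from D_cong_ev[OF this] show ?thesis using assms[THEN smooth_at_D] by (simp add: D_add)
qed

lemma D2_cong_ev:
  assumes "\<forall>\<^sub>F z in nhds p. h z = k z" shows "D2 h p v w = D2 k p v w"
proof -
  have "\<forall>\<^sub>F z in nhds p. D h z v = D k z v"
    using ev_nhds2[OF assms] by eventually_elim (simp add: D_cong_ev)
  from D_cong_ev[OF this] show ?thesis by simp
qed

lemma D2_mult:
  fixes h k :: "'a::real_normed_vector \<Rightarrow> real"
  assumes "smooth_at h p" "smooth_at k p"
  shows "D2 (\<lambda>z. h z * k z) p v w = D2 h p v w * k p + D h p v * D k p w + D h p w * D k p v + h p * D2 k p v w"
proof -
  have "\<forall>\<^sub>F z in nhds p. D (\<lambda>z. h z * k z) z v = D h z v * k z + h z * D k z v"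
    using assms[THEN smooth_at_eventually] by eventually_elim (rule D_mult)
  from D_cong_ev[OF this] show ?thesis
    using assms assms[THEN smooth_at_D] by (simp add: D_add D_mult sm)
qed

lemma van_3_D2: "van 3 h p \<Longrightarrow> D2 h p v w = 0"
  by (simp add: numeral_3_eq_3)

lemma van_2_iff:
  fixes h :: "real^2 \<Rightarrow> real"
  assumes "smooth_at h p"
  shows "van 2 h p \<longleftrightarrow> h p = 0 \<and> D h p (axis 1 1) = 0 \<and> D h p (axis 2 1) = 0"
proof -
  have "(\<forall>v. D h p v = 0) \<longleftrightarrow> D h p (axis 1 1) = 0 \<and> D h p (axis 2 1) = 0"
    using D_basis2[OF assms] by (metis add.right_neutral scale_zero_right)
  then show ?thesis
    using assms by (auto simp: numeral_2_eq_2 intro: smooth_at_D)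
qed

lemma det_Hess_D2:
  "det_Hess h q = D2 h q (axis 1 1) (axis 1 1) * D2 h q (axis 2 1) (axis 2 1) - (D2 h q (axis 1 1) (axis 2 1))\<^sup>2"
  by (simp add: det_Hess_def partial_def[abs_def])

text \<open>Since \<open>N\<close> vanishes to second order, only second derivatives of
  \<open>N\<close> survive in the chain and product rules, and \<open>h\<close> contributes nothing.
  The Hessian transforms as a quadratic form: its determinant gains the square of the Jacobian and,
  being of size two, the square of the factor \<mu>.\<close>

lemma det_Hess_reparam:
  fixes \<theta> :: "real^2 \<Rightarrow> real^2" and N :: "real^2 \<Rightarrow> real"
  assumes \<phi>: "\<forall>\<^sub>F z in nhds p. \<phi> z = \<mu> z * N (\<theta> z) + h z"
    and \<theta>: "smooth_at \<theta> p" and N: "van 2 N (\<theta> p)" and \<mu>: "smooth_at \<mu> p" and h: "van 3 h p"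
  shows "det_Hess \<phi> p = (\<mu> p)\<^sup>2 *
    (D \<theta> p (axis 1 1) $ 1 * D \<theta> p (axis 2 1) $ 2 - D \<theta> p (axis 1 1) $ 2 * D \<theta> p (axis 2 1) $ 1)\<^sup>2 * det_Hess N (\<theta> p)"
proof -
  have Ns: "smooth_at N (\<theta> p)" using van_smooth[OF N] .
  have N0: "N (\<theta> p) = 0" "D N (\<theta> p) v = 0" for v using N by (simp_all add: numeral_2_eq_2)
  have N\<theta>: "smooth_at (\<lambda>z. N (\<theta> z)) p" by (rule smooth_at_compose[OF Ns \<theta>])
  have DN: "D (\<lambda>z. N (\<theta> z)) p v = 0" for v using D_compose[OF Ns \<theta>] N0 by simp
  have 1: "D2 \<phi> p v w = \<mu> p * D2 N (\<theta> p) (D \<theta> p v) (D \<theta> p w)" for v w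
    using D2_cong_ev[OF \<phi>, of v w] van_smooth[OF h] van_3_D2[OF h] \<mu> N\<theta> N0
    by (simp add: D2_add D2_mult DN sm D2_compose[OF Ns \<theta>])
  have 2: "D2 N (\<theta> p) v w = v $ 1 * w $ 1 * D2 N (\<theta> p) (axis 1 1) (axis 1 1) +
      (v $ 1 * w $ 2 + v $ 2 * w $ 1) * D2 N (\<theta> p) (axis 1 1) (axis 2 1) +
      v $ 2 * w $ 2 * D2 N (\<theta> p) (axis 2 1) (axis 2 1)" for v w
    using linear_basis2[OF linear_D2_left[OF Ns], of v w]
      linear_basis2[OF linear_D2_right[OF Ns], of "axis 1 1" w]
      linear_basis2[OF linear_D2_right[OF Ns], of "axis 2 1" w]
      D2_symmetric[OF Ns, of "axis 2 1" "axis 1 1"] by (simp add: algebra_simps)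
  have alg: "m * (a * a * A + (a * b + b * a) * B + b * b * C) * (m * (c * c * A + (c * d + d * c) * B + d * d * C)) -
      (m * (a * c * A + (a * d + b * c) * B + b * d * C))\<^sup>2 = m\<^sup>2 * (a * d - b * c)\<^sup>2 * (A * C - B\<^sup>2)"
    for m a b c d A B C :: real
    by (simp add: algebra_simps power2_eq_square)
  show ?thesis
    unfolding det_Hess_D2 1 2[of "D \<theta> p (axis 1 1)" "D \<theta> p (axis 1 1)"]
      2[of "D \<theta> p (axis 2 1)" "D \<theta> p (axis 2 1)"] 2[of "D \<theta> p (axis 1 1)" "D \<theta> p (axis 2 1)"]
    by (rule alg)
qed

section \<open>Determinants as multilinear forms\<close>

definition det3 :: "real^3 \<Rightarrow> real^3 \<Rightarrow> real^3 \<Rightarrow> real" where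
  "det3 x y z = det (vector [x, y, z] :: real^3^3)"

lemma det3_expand:
  "det3 x y z = x $ 1 * y $ 2 * z $ 3 + x $ 2 * y $ 3 * z $ 1 + x $ 3 * y $ 1 * z $ 2
     - x $ 1 * y $ 3 * z $ 2 - x $ 2 * y $ 1 * z $ 3 - x $ 3 * y $ 2 * z $ 1"
  by (simp add: det3_def det_3)

lemma det2_expand: "det2 x y = x $ 1 * y $ 2 - x $ 2 * y $ 1"
  by (simp add: det2_def det_2)

lemma linear_det_row:
  fixes A :: "real^'n^'n"
  shows "linear (\<lambda>w. det (\<chi> i. if i = k then w else A $ i))"
proof (rule linearI)
  fix r :: real and w :: "real^'n"
  show "det (\<chi> i. if i = k then r *\<^sub>R w else A $ i) = r *\<^sub>R det (\<chi> i. if i = k then w else A $ i)"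
    using det_row_mul[of k r "\<lambda>_. w" "\<lambda>i. A $ i"] by (simp add: scalar_mult_eq_scaleR cong: if_cong)
qed (simp add: det_row_add)

lemma det4_linears:
  "linear (\<lambda>w. det4 w x y z)" "linear (\<lambda>w. det4 x w y z)" "linear (\<lambda>w. det4 x y w z)" "linear (\<lambda>w. det4 x y z w)"
proof -
  have E1: "det4 w x y z = det (\<chi> i. if i = 1 then w else (vector [0, x, y, z] :: real^4^4) $ i)" for w
    unfolding det4_def by (rule arg_cong[of _ _ det]) (simp add: vec_eq_iff forall_4)
  have E2: "det4 x w y z = det (\<chi> i. if i = 2 then w else (vector [x, 0, y, z] :: real^4^4) $ i)" for w
    unfolding det4_def by (rule arg_cong[of _ _ det]) (simp add: vec_eq_iff forall_4)
  have E3: "det4 x y w z = det (\<chi> i. if i = 3 then w else (vector [x, y, 0, z] :: real^4^4) $ i)" for w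
    unfolding det4_def by (rule arg_cong[of _ _ det]) (simp add: vec_eq_iff forall_4)
  have E4: "det4 x y z w = det (\<chi> i. if i = 4 then w else (vector [x, y, z, 0] :: real^4^4) $ i)" for w
    unfolding det4_def by (rule arg_cong[of _ _ det]) (simp add: vec_eq_iff forall_4)
  show "linear (\<lambda>w. det4 w x y z)" unfolding E1 by (rule linear_det_row)
  show "linear (\<lambda>w. det4 x w y z)" unfolding E2 by (rule linear_det_row)
  show "linear (\<lambda>w. det4 x y w z)" unfolding E3 by (rule linear_det_row)
  show "linear (\<lambda>w. det4 x y z w)" unfolding E4 by (rule linear_det_row)
qed

lemmas det4_add = det4_linears[THEN linear_add]
lemmas det4_scale = det4_linears[THEN linear_scale, unfolded real_scaleR_def]
lemmas det4_zero = det4_linears[THEN linear_0]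
lemma det4_same [simp]:
  "det4 x x y z = 0" "det4 x y x z = 0" "det4 x y z x = 0"
  "det4 y x x z = 0" "det4 y x z x = 0" "det4 y z x x = 0"
proof -
  have "det A = 0" if "A $ i = A $ j" "i \<noteq> j" for A :: "real^4^4" and i j
    using that det_identical_rows[of i j A] by (simp add: row_def vec_eq_iff)
  from this[of "vector [x, x, y, z]" 1 2] this[of "vector [x, y, x, z]" 1 3] this[of "vector [x, y, z, x]" 1 4]
    this[of "vector [y, x, x, z]" 2 3] this[of "vector [y, x, z, x]" 2 4] this[of "vector [y, z, x, x]" 3 4]
  show "det4 x x y z = 0" "det4 x y x z = 0" "det4 x y z x = 0"
    "det4 y x x z = 0" "det4 y x z x = 0" "det4 y z x x = 0"
    unfolding det4_def by simp_all
qed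

lemma det4_swap:
  "det4 w y x z = - det4 w x y z" "det4 w x z y = - det4 w x y z" "det4 w z y x = - det4 w x y z"
proof -
  have "det4 w (x + y) (x + y) z = 0" "det4 w x (y + z) (y + z) = 0" "det4 w (x + z) y (x + z) = 0" by simp_all
  then show "det4 w y x z = - det4 w x y z" "det4 w x z y = - det4 w x y z" "det4 w z y x = - det4 w x y z"
    unfolding det4_add by simp_all
qed

text \<open>Pulled back by \<open>L\<close>, the determinant with fixed first row is an alternating
  trilinear form on \<open>real^3\<close>, hence a multiple of \<open>det3\<close>.\<close>

lemma det4_combine3:
  assumes L: "linear L"
  shows "det4 w (L A) (L B) (L C) = det3 A B C * det4 w (L (axis 1 1)) (L (axis 2 1)) (L (axis 3 1))"
proof -
  let ?e1 = "L (axis 1 1)" and ?e2 = "L (axis 2 1)" and ?e3 = "L (axis 3 1)"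
  have s: "det4 w ?e1 ?e3 ?e2 = - det4 w ?e1 ?e2 ?e3" "det4 w ?e2 ?e1 ?e3 = - det4 w ?e1 ?e2 ?e3"
    "det4 w ?e3 ?e2 ?e1 = - det4 w ?e1 ?e2 ?e3" "det4 w ?e2 ?e3 ?e1 = det4 w ?e1 ?e2 ?e3"
    "det4 w ?e3 ?e1 ?e2 = det4 w ?e1 ?e2 ?e3"
    using det4_swap(2)[of w ?e1 ?e3 ?e2] det4_swap(1)[of w ?e2 ?e1 ?e3] det4_swap(3)[of w ?e3 ?e2 ?e1]
      det4_swap(2)[of w ?e2 ?e3 ?e1] det4_swap(2)[of w ?e3 ?e1 ?e2] by simp_all
  show ?thesis
    unfolding linear_basis3[OF L, of A] linear_basis3[OF L, of B] linear_basis3[OF L, of C]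
    by (simp add: det4_add det4_scale s det3_expand algebra_simps)
qed

lemma smooth_at_det4 [sm]:
  assumes "smooth_at f z" "smooth_at g z" "smooth_at h z" "smooth_at k z"
  shows "smooth_at (\<lambda>z. det4 (f z) (g z) (h z) (k z)) z"
  unfolding det4_def
proof (rule smooth_at_det)
  fix i j :: 4
  show "smooth_at (\<lambda>z. (vector [f z, g z, h z, k z] :: real^4^4) $ i $ j) z"
    using exhaust_4[of i] assms by (auto intro: sm)
qed

lemma smooth_at_det3 [sm]:
  assumes "smooth_at f z" "smooth_at g z" "smooth_at h z"
  shows "smooth_at (\<lambda>z. det3 (f z) (g z) (h z)) z"
  unfolding det3_expand by (intro sm assms)

lemma D_det3:
  assumes "smooth_at f z" "smooth_at g z" "smooth_at h z"
  shows "D (\<lambda>z. det3 (f z) (g z) (h z)) z v =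
    det3 (D f z v) (g z) (h z) + det3 (f z) (D g z v) (h z) + det3 (f z) (g z) (D h z v)"
  unfolding det3_expand using assms
  by (simp add: D_add D_diff D_mult D_nth sm algebra_simps)

section \<open>Invariants of presented germs\<close>

lemma det4_nonzero:
  assumes "\<And>a b c d. a *\<^sub>R w + b *\<^sub>R x + c *\<^sub>R y + d *\<^sub>R z = 0 \<Longrightarrow> a = 0 \<and> b = 0 \<and> c = 0 \<and> d = 0"
  shows "det4 w x y z \<noteq> 0"
proof
  let ?A = "vector [w, x, y, z] :: real^4^4"
  assume "det4 w x y z = 0"
  then have "det (transpose ?A) = 0" by (simp add: det4_def)
  moreover have "det B \<noteq> 0 \<longleftrightarrow> inj ((*v) B)" for B :: "real^4^4"
    using det_nz_iff_inj[OF matrix_vector_mul_linear[of B]] by (simp add: matrix_of_matrix_vector_mul)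
  ultimately have "\<not> inj ((*v) (transpose ?A))" by metis
  then obtain u where u: "u \<noteq> 0" "transpose ?A *v u = 0"
    using linear_injective_0[OF matrix_vector_mul_linear[of "transpose ?A"]] by blast
  have "u $ 1 *\<^sub>R w + u $ 2 *\<^sub>R x + u $ 3 *\<^sub>R y + u $ 4 *\<^sub>R z = transpose ?A *v u"
    by (simp add: vec_eq_iff matrix_vector_mult_def transpose_def sum_4 mult.commute)
  then have "u = 0" using assms[of "u $ 1" "u $ 2" "u $ 3" "u $ 4"] u(2) by (simp add: vec_eq_iff forall_4)
  then show False using u(1) by simp
qed

lemma det3_simps [simp]: "det3 0 b c = 0" "det3 a 0 c = 0" "det3 a b 0 = 0" "det3 a b b = 0" "det3 a a b = 0"
  by (simp_all add: det3_expand)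

lemma linear_basis_UNIV:
  fixes L :: "real^'n \<Rightarrow> 'b::real_vector"
  assumes "linear L" shows "L w = (\<Sum>i\<in>UNIV. w $ i *\<^sub>R L (axis i 1))"
proof -
  have "w = (\<Sum>i\<in>UNIV. w $ i *\<^sub>R axis i 1)" by (metis basis_expansion scalar_mult_eq_scaleR)
  then have "L w = L (\<Sum>i\<in>UNIV. w $ i *\<^sub>R axis i 1)" by simp
  then show ?thesis by (simp only: linear_sum[OF assms] linear_scale[OF assms])
qed

lemma van_2_compose:
  fixes \<theta> :: "real^2 \<Rightarrow> real^2"
  assumes h: "van 2 h (\<theta> p)" and \<theta>: "smooth_at \<theta> p"
  shows "van 2 (\<lambda>z. h (\<theta> z)) p"
proof -
  note hs = van_smooth[OF h]
  have "h (\<theta> p) = 0" "D h (\<theta> p) v = 0" for v using h by (simp_all add: numeral_2_eq_2)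
  then show ?thesis
    unfolding van_2_iff[OF smooth_at_compose[OF hs \<theta>]] D_compose[OF hs \<theta>] by simp
qed

text \<open>Fixes the witnesses of \<open>presents\<close>, so that derivatives of \<open>x\<close>
  can be compared with those of \<open>F\<close>.\<close>

locale presented =
  fixes x :: "real^2 \<Rightarrow> real^4" and p F \<Phi> \<theta>
  assumes \<Phi>: "smooth_at \<Phi> 0" "inj (D \<Phi> 0)" "\<forall>\<^sub>F w in nhds 0. \<Phi> w \<in> H3"
    and \<theta>: "smooth_at \<theta> p" "inj (D \<theta> p)" "\<theta> p = (0 :: real^2)"
    and F: "smooth_at F 0" "F 0 = (0 :: real^3)"
    and xe: "\<forall>\<^sub>F z in nhds p. x z = \<Phi> (F (\<theta> z))"
begin

definition y where "y z = F (\<theta> z)"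

text \<open>The volume factor of \<Phi>: it converts determinants with first row on the hyperboloid
  into \<open>det3\<close> in the chart, see \<open>det4_image\<close>.\<close>

definition \<Lambda> where "\<Lambda> w = det4 (\<Phi> w) (D \<Phi> w (axis 1 1)) (D \<Phi> w (axis 2 1)) (D \<Phi> w (axis 3 1))"

lemma y: "smooth_at y p" "y p = 0"
  using smooth_at_compose[of F \<theta> p] F \<theta> by (auto simp: y_def[abs_def])

lemma smooth_x: "smooth_at x p"
proof (rule smooth_at_cong_ev)
  show "smooth_at (\<lambda>z. \<Phi> (y z)) p" by (rule smooth_at_compose) (use y \<Phi> in auto)
  show "\<forall>\<^sub>F z in nhds p. \<Phi> (y z) = x z" using xe by eventually_elim (simp add: y_def)
qed

lemma x_p: "x p = \<Phi> 0"
  using eventually_nhds_x_imp_x[OF xe] F \<theta> by simp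

lemma near:
  "\<forall>\<^sub>F z in nhds p. smooth_at \<theta> z \<and> smooth_at F (\<theta> z) \<and> smooth_at y z \<and> smooth_at \<Phi> (y z) \<and> smooth_at x z \<and>
    (\<forall>\<^sub>F z in nhds z. x z = \<Phi> (y z))"
  using smooth_at_eventually[OF \<theta>(1)] eventually_nhds_smooth[OF \<theta>(1), unfolded \<theta>(3), OF smooth_at_eventually[OF F(1)]]
    smooth_at_eventually[OF y(1)] eventually_nhds_smooth[OF y(1), unfolded y(2), OF smooth_at_eventually[OF \<Phi>(1)]]
    smooth_at_eventually[OF smooth_x] ev_nhds2[OF xe]
  by eventually_elim (simp add: y_def)

lemma derivs:
  "\<forall>\<^sub>F z in nhds p. x z = \<Phi> (y z) \<and>
    (\<forall>v. D x z v = D \<Phi> (y z) (D y z v)) \<and>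
    (\<forall>a b. D2 x z a b = D2 \<Phi> (y z) (D y z a) (D y z b) + D \<Phi> (y z) (D2 y z a b)) \<and>
    (\<forall>v. D y z v = D F (\<theta> z) (D \<theta> z v)) \<and>
    (\<forall>a b. D2 y z a b = D2 F (\<theta> z) (D \<theta> z a) (D \<theta> z b) + D F (\<theta> z) (D2 \<theta> z a b))"
  using near
proof eventually_elim
  case (elim z)
  then have s: "smooth_at \<theta> z" "smooth_at F (\<theta> z)" "smooth_at y z" "smooth_at \<Phi> (y z)" "smooth_at x z"
    and e: "\<forall>\<^sub>F z in nhds z. x z = \<Phi> (y z)" by auto
  have "\<forall>\<^sub>F w in nhds z. D x w v = D (\<lambda>z. \<Phi> (y z)) w v" for v
    using ev_nhds2[OF e] by eventually_elim (simp add: D_cong_ev)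
  note e2 = D_cong_ev[OF this]
  have "x z = \<Phi> (y z)" using eventually_nhds_x_imp_x[OF e] .
  moreover have "D x z v = D \<Phi> (y z) (D y z v)" for v
    using D_cong_ev[OF e] D_compose[OF s(4,3)] by simp
  moreover have "D2 x z a b = D2 \<Phi> (y z) (D y z a) (D y z b) + D \<Phi> (y z) (D2 y z a b)" for a b
    unfolding e2 by (rule D2_compose[OF s(4,3)])
  moreover have "D y z v = D F (\<theta> z) (D \<theta> z v)" for v
    unfolding y_def[abs_def] by (rule D_compose[OF s(2,1)])
  moreover have "D2 y z a b = D2 F (\<theta> z) (D \<theta> z a) (D \<theta> z b) + D F (\<theta> z) (D2 \<theta> z a b)" for a b
    unfolding y_def[abs_def] by (rule D2_compose[OF s(2,1)])
  ultimately show ?case by blast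
qed

text \<open>The vector \<open>\<Phi> 0\<close> has Minkowski square \<open>-1\<close> and is
  orthogonal to the image of \<open>D \<Phi> 0\<close>; pairing a linear relation with it isolates
  the coefficient \<open>a\<close>, and injectivity of the derivative handles the others.\<close>

lemma \<Lambda>_0: "\<Lambda> 0 \<noteq> 0"
  unfolding \<Lambda>_def
proof (rule det4_nonzero)
  fix a b c d
  let ?w = "vector [b, c, d] :: real^3"
  assume "a *\<^sub>R \<Phi> 0 + b *\<^sub>R D \<Phi> 0 (axis 1 1) + c *\<^sub>R D \<Phi> 0 (axis 2 1) + d *\<^sub>R D \<Phi> 0 (axis 3 1) = 0"
  then have z: "a *\<^sub>R \<Phi> 0 + D \<Phi> 0 ?w = 0" using D_basis3[OF \<Phi>(1), of ?w] by (simp add: add.assoc)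
  have H: "\<Phi> 0 \<in> H3" using eventually_nhds_x_imp_x[OF \<Phi>(3)] .
  interpret m: bounded_bilinear mink by (rule bounded_bilinear_mink)
  have "mink (\<Phi> 0) (a *\<^sub>R \<Phi> 0 + D \<Phi> 0 ?w) = - a"
    using H D_tangent_H3[OF \<Phi>(1,3), of ?w] by (simp add: m.add_right m.scaleR_right H3_def)
  then have a: "a = 0" using z by (simp add: m.zero_right)
  then have "D \<Phi> 0 ?w = 0" using z by simp
  then have "?w = 0" using linear_injective_0[OF smooth_at_linear_D[OF \<Phi>(1)]] \<Phi>(2) by blast
  then show "a = 0 \<and> b = 0 \<and> c = 0 \<and> d = 0" using a by (simp add: vec_eq_iff forall_3)
qed

lemma smooth_\<Lambda>_y: "smooth_at (\<lambda>z. \<Lambda> (y z)) p"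
  by (rule smooth_at_compose[OF _ y(1)]) (unfold \<Lambda>_def y(2), intro sm \<Phi>)

lemma D_\<Phi>_0_iff: "D \<Phi> 0 w = 0 \<longleftrightarrow> w = 0"
  using linear_injective_0[OF smooth_at_linear_D[OF \<Phi>(1)]] \<Phi>(2) linear_0[OF smooth_at_linear_D[OF \<Phi>(1)]] by auto

lemma D_\<theta>_0_iff: "D \<theta> p w = 0 \<longleftrightarrow> w = 0"
  using linear_injective_0[OF smooth_at_linear_D[OF \<theta>(1)]] \<theta>(2) linear_0[OF smooth_at_linear_D[OF \<theta>(1)]] by auto

lemma Dx_p: "D x p v = D \<Phi> 0 (D F 0 (D \<theta> p v))"
  using eventually_nhds_x_imp_x[OF derivs] y \<theta> by simp

lemma det4_image:
  assumes "smooth_at \<Phi> w"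
  shows "det4 (\<Phi> w) (D \<Phi> w A) (D \<Phi> w B) (D \<Phi> w C) = det3 A B C * \<Lambda> w"
  unfolding \<Lambda>_def by (rule det4_combine3[OF smooth_at_linear_D[OF assms]])

definition J\<theta> where
  "J\<theta> = D \<theta> p (axis 1 1) $ 1 * D \<theta> p (axis 2 1) $ 2 - D \<theta> p (axis 1 1) $ 2 * D \<theta> p (axis 2 1) $ 1"

lemma J\<theta>_nonzero: "J\<theta> \<noteq> 0"
proof
  assume J: "J\<theta> = 0"
  let ?a = "D \<theta> p (axis 1 1)" and ?b = "D \<theta> p (axis 2 1)"
  have "D \<theta> p (vector [s, t]) = s *\<^sub>R ?a + t *\<^sub>R ?b" for s t
    using D_basis2[OF \<theta>(1), of "vector [s, t]"] by simp
  then have 0: "s *\<^sub>R ?a + t *\<^sub>R ?b = 0 \<Longrightarrow> s = 0 \<and> t = 0" for s t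
    using D_\<theta>_0_iff[of "vector [s, t]"] by (simp add: vec_eq_iff forall_2)
  have *: "?b $ 2 *\<^sub>R ?a + (- (?a $ 2)) *\<^sub>R ?b = 0" "?b $ 1 *\<^sub>R ?a + (- (?a $ 1)) *\<^sub>R ?b = 0"
    using J by (simp_all add: vec_eq_iff forall_2 J\<theta>_def algebra_simps)
  have "?b = 0" using 0[OF *(1)] 0[OF *(2)] by (simp add: vec_eq_iff forall_2)
  then show False using 0[of 0 1] by simp
qed

end

section \<open>Invariants of germs of corank one\<close>

locale corank_one = presented +
  assumes Fv: "D F 0 (axis 2 1) = 0" and Fu: "D F 0 (axis 1 1) \<noteq> 0"
begin

abbreviation m where "m \<equiv> D F 0 (axis 1 1)"

lemma DF_0: "D F 0 w = w $ 1 *\<^sub>R m"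
  using D_basis2[OF F(1), of w] Fv by simp

lemma Dx_m: "D x p v = D \<theta> p v $ 1 *\<^sub>R D \<Phi> 0 m"
  by (simp add: Dx_p DF_0[of "D \<theta> p v"] linear_scale[OF smooth_at_linear_D[OF \<Phi>(1)]])

lemma Dm_nonzero: "D \<Phi> 0 m \<noteq> 0"
  using Fu D_\<Phi>_0_iff by blast

lemma kernel:
  assumes "D x p k = 0" "k \<noteq> 0"
  shows "D \<theta> p k = D \<theta> p k $ 2 *\<^sub>R axis 2 1" "D \<theta> p k $ 2 \<noteq> 0" "D y p k = 0"
proof -
  have 1: "D \<theta> p k $ 1 = 0" using assms(1) Dx_m Dm_nonzero by auto
  then show e: "D \<theta> p k = D \<theta> p k $ 2 *\<^sub>R axis 2 1" by (simp add: vec_eq_iff forall_2)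
  show "D \<theta> p k $ 2 \<noteq> 0" using e assms(2) D_\<theta>_0_iff[of k] by auto
  show "D y p k = 0" using eventually_nhds_x_imp_x[OF derivs] \<theta>(3) 1 by (simp add: DF_0[of "D \<theta> p k"])
qed

text \<open>In the chain rule the second derivative of \<Phi> drops out because
  \<open>D y p k = 0\<close>, and the second derivative of \<theta> contributes a multiple of
  \<open>m\<close>. So modulo the image of the differential, second derivatives in a kernel
  direction transform like first ones.\<close>

lemma D2x_kernel:
  assumes k: "D x p k = 0" "k \<noteq> 0"
  obtains t where "D2 x p k w = D \<Phi> 0 (D \<theta> p k $ 2 *\<^sub>R D2 F 0 (axis 2 1) (D \<theta> p w) + t *\<^sub>R m)"
proof -
  have "D2 x p k w = D2 \<Phi> 0 0 (D y p w) + D \<Phi> 0 (D2 y p k w)"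
    using eventually_nhds_x_imp_x[OF derivs] y(2) kernel(3)[OF k] by simp
  also have "D2 \<Phi> 0 0 (D y p w) = 0" by (rule linear_0[OF linear_D2_left[OF \<Phi>(1)]])
  also have "D2 y p k w = D2 F 0 (D \<theta> p k) (D \<theta> p w) + D F 0 (D2 \<theta> p k w)"
    using eventually_nhds_x_imp_x[OF derivs] \<theta>(3) by simp
  also have "D2 F 0 (D \<theta> p k) (D \<theta> p w) = D \<theta> p k $ 2 *\<^sub>R D2 F 0 (axis 2 1) (D \<theta> p w)"
    by (subst kernel(1)[OF k]) (rule linear_scale[OF linear_D2_left[OF F(1)]])
  finally show ?thesis using that by (simp only: DF_0[of "D2 \<theta> p k w"] add_0)
qed

text \<open>The unknown multiples of \<open>m\<close> from \<open>D2x_kernel\<close> disappear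
  against the row \<open>m\<close>. What remains is a change of basis in the kernel direction,
  counted twice, and one in the second direction with determinant \<open>J\<theta>\<close>.\<close>

lemma cross_cap_invariant:
  assumes k: "D x p k = 0" "k \<noteq> 0"
  shows "det4 (x p) (D \<Phi> 0 m) (D2 x p k (axis 1 1)) (D2 x p k (axis 2 1)) =
    (D \<theta> p k $ 2)\<^sup>2 * J\<theta> * \<Lambda> 0 * det3 m (D2 F 0 (axis 2 1) (axis 1 1)) (D2 F 0 (axis 2 1) (axis 2 1))"
proof -
  obtain s where s: "D2 x p k (axis 1 1) = D \<Phi> 0 (D \<theta> p k $ 2 *\<^sub>R D2 F 0 (axis 2 1) (D \<theta> p (axis 1 1)) + s *\<^sub>R m)"
    by (rule D2x_kernel[OF k])
  obtain t where t: "D2 x p k (axis 2 1) = D \<Phi> 0 (D \<theta> p k $ 2 *\<^sub>R D2 F 0 (axis 2 1) (D \<theta> p (axis 2 1)) + t *\<^sub>R m)"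
    by (rule D2x_kernel[OF k])
  have lin: "D2 F 0 (axis 2 1) w = w $ 1 *\<^sub>R D2 F 0 (axis 2 1) (axis 1 1) + w $ 2 *\<^sub>R D2 F 0 (axis 2 1) (axis 2 1)" for w
    by (rule linear_basis2[OF linear_D2_right[OF F(1)]])
  have alg: "det3 c (r *\<^sub>R (a1 *\<^sub>R A + a2 *\<^sub>R B) + s *\<^sub>R c) (r *\<^sub>R (b1 *\<^sub>R A + b2 *\<^sub>R B) + t *\<^sub>R c) =
      r\<^sup>2 * (a1 * b2 - a2 * b1) * det3 c A B" for c A B r a1 a2 b1 b2 s t
    by (simp add: det3_expand power2_eq_square algebra_simps)
  show ?thesis
    unfolding s t x_p det4_image[OF \<Phi>(1)]
    unfolding lin[of "D \<theta> p (axis 1 1)"] lin[of "D \<theta> p (axis 2 1)"] alg J\<theta>_def by simp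
qed

text \<open>The case of \<open>D2x_kernel\<close> with both directions in the kernel: the second
  derivative is multiplied by a nonzero square, modulo the image.\<close>

lemma second_order_invariant:
  assumes k: "D x p k = 0" "k \<noteq> 0"
  shows "(\<exists>r. D2 x p k k = r *\<^sub>R D \<Phi> 0 m) \<longleftrightarrow> (\<exists>r. D2 F 0 (axis 2 1) (axis 2 1) = r *\<^sub>R m)"
proof -
  obtain t where "D2 x p k k = D \<Phi> 0 (D \<theta> p k $ 2 *\<^sub>R D2 F 0 (axis 2 1) (D \<theta> p k) + t *\<^sub>R m)"
    by (rule D2x_kernel[OF k])
  also have "D2 F 0 (axis 2 1) (D \<theta> p k) = D \<theta> p k $ 2 *\<^sub>R D2 F 0 (axis 2 1) (axis 2 1)"
    by (subst kernel(1)[OF k]) (rule linear_scale[OF linear_D2_right[OF F(1)]])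
  finally have e: "D2 x p k k = D \<Phi> 0 ((D \<theta> p k $ 2 * D \<theta> p k $ 2) *\<^sub>R D2 F 0 (axis 2 1) (axis 2 1) + t *\<^sub>R m)"
    by simp
  define q where "q = D \<theta> p k $ 2 * D \<theta> p k $ 2"
  have q: "q \<noteq> 0" using kernel(2)[OF k] by (simp add: q_def)
  let ?f = "D2 F 0 (axis 2 1) (axis 2 1)"
  have "D \<Phi> 0 (q *\<^sub>R ?f + t *\<^sub>R m) = r *\<^sub>R D \<Phi> 0 m \<longleftrightarrow> q *\<^sub>R ?f + t *\<^sub>R m = r *\<^sub>R m" for r
    using \<Phi>(2) by (simp add: linear_scale[OF smooth_at_linear_D[OF \<Phi>(1)], symmetric] inj_eq)
  moreover have "q *\<^sub>R ?f + t *\<^sub>R m = r *\<^sub>R m \<longleftrightarrow> ?f = ((r - t) / q) *\<^sub>R m" for r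
  proof
    assume "q *\<^sub>R ?f + t *\<^sub>R m = r *\<^sub>R m"
    then have "q *\<^sub>R ?f = (r - t) *\<^sub>R m" by (simp add: scaleR_left_diff_distrib eq_diff_eq)
    then have "(1 / q) *\<^sub>R (q *\<^sub>R ?f) = (1 / q) *\<^sub>R ((r - t) *\<^sub>R m)" by simp
    then show "?f = ((r - t) / q) *\<^sub>R m" using q by simp
  next
    assume "?f = ((r - t) / q) *\<^sub>R m"
    then show "q *\<^sub>R ?f + t *\<^sub>R m = r *\<^sub>R m" using q by (simp add: scaleR_left_diff_distrib)
  qed
  moreover have "(\<exists>r. ?f = ((r - t) / q) *\<^sub>R m) \<longleftrightarrow> (\<exists>r. ?f = r *\<^sub>R m)"
    using q by (metis add_diff_cancel_right' nonzero_mult_div_cancel_right)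
  ultimately show ?thesis unfolding e q_def[symmetric] by simp
qed

text \<open>What \<phi> becomes for the reduced germ, with the coordinate fields in place of \<xi>
  and \<eta>.\<close>

definition N where "N w = det3 (D F w (axis 1 1)) (D F w (axis 2 1)) (D2 F w (axis 2 1) (axis 2 1))"

text \<open>Expanding the second derivative of \<open>x\<close> along \<eta> gives
  \<open>\<mu> z * N (\<theta> z)\<close> plus \<open>h1\<close>, \<open>h2\<close> and
  \<open>h3\<close>, which vanish to third order. \<open>J\<close> is used to see that
  \<open>N\<close> and \<open>L2\<close> vanish to second order.\<close>

lemma Hessian_invariant:
  fixes \<xi> \<eta> :: "real^2 \<Rightarrow> real^2"
  assumes \<xi>: "smooth_at \<xi> p" and \<eta>: "smooth_at \<eta> p" and k: "D x p (\<eta> p) = 0"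
    and indep: "\<xi> p $ 1 * \<eta> p $ 2 - \<xi> p $ 2 * \<eta> p $ 1 \<noteq> 0"
    and J: "det3 m (D2 F 0 (axis 2 1) (axis 1 1)) (D2 F 0 (axis 2 1) (axis 2 1)) = 0"
    and \<phi>: "\<forall>\<^sub>F z in nhds p. \<phi> z = det4 (x z) (D x z (\<xi> z)) (D x z (\<eta> z)) (D (\<lambda>z. D x z (\<eta> z)) z (\<eta> z))"
  obtains K where "K \<noteq> 0" "det_Hess \<phi> p = K\<^sup>2 * det_Hess N 0"
proof -
  have \<eta>0: "\<eta> p \<noteq> 0" using indep by auto
  let ?e1 = "axis 1 1 :: real^2" and ?e2 = "axis 2 1 :: real^2"
  \<comment> \<open>Components of the field \<eta> in the coordinates of \<open>F\<close>. As
    \<open>\<eta> p\<close> spans the kernel, \<open>R\<close> vanishes at \<open>p\<close> and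
    \<open>S\<close> does not; \<kappa> is the determinant of the two transported fields.\<close>
  define R where "R z = D \<theta> z (\<eta> z) $ 1" for z
  define S where "S z = D \<theta> z (\<eta> z) $ 2" for z
  define \<kappa> where "\<kappa> z = D \<theta> z (\<xi> z) $ 1 * S z - D \<theta> z (\<xi> z) $ 2 * R z" for z
  have RS: "smooth_at R p" "smooth_at S p" "smooth_at \<kappa> p"
    unfolding R_def S_def \<kappa>_def by (intro sm smooth_at_D_dir \<theta> \<eta> \<xi>)+
  have R0: "R p = 0" and S0: "S p \<noteq> 0"
    using kernel(1,2)[OF k \<eta>0] by (auto simp: R_def S_def vec_eq_iff forall_2)
  have \<kappa>0: "\<kappa> p \<noteq> 0"
  proof -
    have "\<kappa> p = J\<theta> * (\<xi> p $ 1 * \<eta> p $ 2 - \<xi> p $ 2 * \<eta> p $ 1)"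
      unfolding \<kappa>_def R_def S_def J\<theta>_def
      using D_basis2[OF \<theta>(1), of "\<xi> p"] D_basis2[OF \<theta>(1), of "\<eta> p"] by (simp add: algebra_simps)
    then show ?thesis using J\<theta>_nonzero indep by simp
  qed
  define L1 where "L1 w = det3 (D F w ?e1) (D F w ?e2) (D2 F w ?e1 ?e1)" for w
  define L2 where "L2 w = det3 (D F w ?e1) (D F w ?e2) (D2 F w ?e2 ?e1)" for w
  have sF: "smooth_at (\<lambda>w. D F w a) 0" "smooth_at (\<lambda>w. D2 F w a b) 0" for a b
    using F(1) by (auto intro: smooth_at_D)
  have L1: "smooth_at L1 0" "L1 0 = 0" unfolding L1_def by (intro sm sF) (simp add: Fv)
  \<comment> \<open>Only the row \<open>D F w (axis 2 1)\<close> vanishes at the origin, so only its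
    derivative counts. Along the first axis two rows then coincide, along the second one the value
    is the determinant in \<open>J\<close> up to sign.\<close>
  have L2: "van 2 L2 0"
  proof -
    have "smooth_at L2 0" unfolding L2_def by (intro sm sF)
    moreover have "D L2 0 v = det3 m (D2 F 0 ?e2 v) (D2 F 0 ?e2 ?e1)" for v
      unfolding L2_def by (subst D_det3[OF sF(1) sF(1) sF(2)]) (simp add: Fv)
    moreover have "det3 m (D2 F 0 ?e2 ?e2) (D2 F 0 ?e2 ?e1) = 0" using J by (simp add: det3_expand algebra_simps)
    moreover have "L2 0 = 0" by (simp add: L2_def Fv)
    ultimately show ?thesis by (simp add: van_2_iff)
  qed
  have N: "van 2 N 0"
  proof -
    have "smooth_at N 0" unfolding N_def[abs_def] by (intro sm sF)
    moreover have "D N 0 v = det3 m (D2 F 0 ?e2 v) (D2 F 0 ?e2 ?e2)" for v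
      unfolding N_def[abs_def] by (subst D_det3[OF sF(1) sF(1) sF(2)]) (simp add: Fv)
    moreover have "N 0 = 0" by (simp add: N_def Fv)
    ultimately show ?thesis using J by (simp add: van_2_iff)
  qed
  \<comment> \<open>These coefficients belong to the second derivative of \<Phi>. They vanish at
    \<open>p\<close> through the row \<open>D x z (\<eta> z)\<close>, and the components
    \<open>Y\<close> vanish there too, so that each summand of \<open>h3\<close> has three vanishing
    factors.\<close>
  define E where "E i j z = det4 (x z) (D x z (\<xi> z)) (D x z (\<eta> z)) (D2 \<Phi> (y z) (axis i 1) (axis j 1))" for i j :: 3 and z
  define Y where "Y i z = D y z (\<eta> z) $ i" for i :: 3 and z
  define h1 where "h1 z = (R z * R z * L1 (\<theta> z)) * (\<Lambda> (y z) * \<kappa> z)" for z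
  define h2 where "h2 z = (L2 (\<theta> z) * R z) * (2 * \<Lambda> (y z) * \<kappa> z * S z)" for z
  define h3 where "h3 z = (\<Sum>i\<in>UNIV. \<Sum>j\<in>UNIV. Y i z * Y j z * E i j z)" for z
  have \<Phi>y: "smooth_at (\<lambda>z. D2 \<Phi> (y z) a b) p" for a b
    by (rule smooth_at_compose[where f=y]) (use y \<Phi> in \<open>auto intro: smooth_at_D\<close>)
  have v1: "van 3 h1 p"
    unfolding h1_def
    by (intro van_mult_right van_prod3 RS R0 sm smooth_\<Lambda>_y smooth_at_compose[OF _ \<theta>(1)]) (use L1 \<theta> in auto)
  have v2: "van 3 h2 p"
    unfolding h2_def
  proof (rule van_mult_right)
    have "van 2 (\<lambda>z. L2 (\<theta> z)) p" by (rule van_2_compose[OF _ \<theta>(1)]) (simp add: L2 \<theta>(3))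
    from van_mult[OF this van_1[OF RS(1) R0]] show "van 3 (\<lambda>z. L2 (\<theta> z) * R z) p" by simp
  qed (intro sm smooth_\<Lambda>_y RS)
  have v3: "van 3 h3 p"
    unfolding h3_def
  proof (intro van_sum van_prod3)
    fix i j :: 3
    show "smooth_at (Y i) p" "smooth_at (Y j) p" unfolding Y_def by (intro sm smooth_at_D_dir y \<eta>)+
    show "Y i p = 0" "Y j p = 0" using kernel(3)[OF k \<eta>0] by (simp_all add: Y_def)
    show "smooth_at (E i j) p" unfolding E_def by (intro sm smooth_at_D_dir smooth_x \<eta> \<xi> \<Phi>y)
    show "E i j p = 0" unfolding E_def k by (rule det4_zero)
  qed
  define \<mu> where "\<mu> z = \<Lambda> (y z) * \<kappa> z * (S z)\<^sup>2" for z
  have \<mu>: "smooth_at \<mu> p" unfolding \<mu>_def by (intro sm smooth_\<Lambda>_y RS)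
  have \<mu>0: "\<mu> p \<noteq> 0" using S0 \<kappa>0 \<Lambda>_0 by (simp add: \<mu>_def y)
  have "\<forall>\<^sub>F z in nhds p. \<phi> z = \<mu> z * N (\<theta> z) + (h1 z + (h2 z + h3 z))"
    using \<phi> near derivs smooth_at_eventually[OF \<eta>]
  proof eventually_elim
    case (elim z)
    let ?L = "D \<Phi> (y z)" and ?P = "D F (\<theta> z)"
    have s: "smooth_at \<theta> z" "smooth_at F (\<theta> z)" "smooth_at y z" "smooth_at \<Phi> (y z)" "smooth_at x z" using elim(2) by auto
    have dx: "D x z v = ?L (D y z v)" and dy: "D y z v = ?P (D \<theta> z v)"
      and dxx: "D2 x z a b = D2 \<Phi> (y z) (D y z a) (D y z b) + ?L (D2 y z a b)"
      and dyy: "D2 y z a b = D2 F (\<theta> z) (D \<theta> z a) (D \<theta> z b) + ?P (D2 \<theta> z a b)" and xz: "x z = \<Phi> (y z)" for v a b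
      using elim(3) by auto
    note lL = smooth_at_linear_D[OF s(4)] and lP = smooth_at_linear_D[OF s(2)]
    \<comment> \<open>Collects all terms of the second derivative that lie in the image of
      \<open>D F (\<theta> z)\<close>; they are killed by the other two rows of the determinant, as
      \<open>alg\<close> shows.\<close>
    define q where "q = D2 \<theta> z (\<eta> z) (\<eta> z) + D \<theta> z (D \<eta> z (\<eta> z))"
    have "D (\<lambda>z. D x z (\<eta> z)) z (\<eta> z) = D2 x z (\<eta> z) (\<eta> z) + D x z (D \<eta> z (\<eta> z))"
      by (rule D_D_dir[OF s(5) elim(4)])
    also have "\<dots> = D2 \<Phi> (y z) (D y z (\<eta> z)) (D y z (\<eta> z)) +
        ?L (D2 F (\<theta> z) (D \<theta> z (\<eta> z)) (D \<theta> z (\<eta> z)) + ?P q)"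
      unfolding dxx dx unfolding dyy unfolding q_def
      by (simp add: dy linear_add[OF lL] linear_add[OF lP] add.assoc)
    finally have xx: "D (\<lambda>z. D x z (\<eta> z)) z (\<eta> z) = D2 \<Phi> (y z) (D y z (\<eta> z)) (D y z (\<eta> z)) +
        ?L (D2 F (\<theta> z) (D \<theta> z (\<eta> z)) (D \<theta> z (\<eta> z)) + ?P q)" .
    have H3: "det4 (x z) (D x z (\<xi> z)) (D x z (\<eta> z)) (D2 \<Phi> (y z) (D y z (\<eta> z)) (D y z (\<eta> z))) = h3 z"
    proof -
      have expand: "D2 \<Phi> (y z) a b = (\<Sum>i\<in>UNIV. \<Sum>j\<in>UNIV. (a $ i * b $ j) *\<^sub>R D2 \<Phi> (y z) (axis i 1) (axis j 1))" for a b
      proof -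
        have "D2 \<Phi> (y z) a b = (\<Sum>i\<in>UNIV. a $ i *\<^sub>R D2 \<Phi> (y z) (axis i 1) b)"
          by (rule linear_basis_UNIV[OF linear_D2_left[OF s(4)]])
        also have "\<dots> = (\<Sum>i\<in>UNIV. a $ i *\<^sub>R (\<Sum>j\<in>UNIV. b $ j *\<^sub>R D2 \<Phi> (y z) (axis i 1) (axis j 1)))"
          by (subst linear_basis_UNIV[OF linear_D2_right[OF s(4)], of _ b]) simp
        finally show ?thesis by (simp add: scaleR_sum_right)
      qed
      show ?thesis
        unfolding expand[of "D y z (\<eta> z)" "D y z (\<eta> z)"] linear_sum[OF det4_linears(4)] det4_scale
          h3_def Y_def E_def ..
    qed
    have D2F: "D2 F (\<theta> z) (D \<theta> z (\<eta> z)) (D \<theta> z (\<eta> z)) =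
        (R z * R z) *\<^sub>R D2 F (\<theta> z) ?e1 ?e1 + (2 * R z * S z) *\<^sub>R D2 F (\<theta> z) ?e2 ?e1 + (S z * S z) *\<^sub>R D2 F (\<theta> z) ?e2 ?e2"
    proof -
      have quad: "r *\<^sub>R (r *\<^sub>R A + t *\<^sub>R B) + t *\<^sub>R (r *\<^sub>R B + t *\<^sub>R C) = (r * r) *\<^sub>R A + (2 * r * t) *\<^sub>R B + (t * t) *\<^sub>R C"
        for r t and A B C :: "real^3"
        by (simp add: vec_eq_iff algebra_simps)
      show ?thesis
        unfolding linear_basis2[OF linear_D2_left[OF s(2)], of "D \<theta> z (\<eta> z)" "D \<theta> z (\<eta> z)"]
          linear_basis2[OF linear_D2_right[OF s(2)], of ?e1 "D \<theta> z (\<eta> z)"]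
          linear_basis2[OF linear_D2_right[OF s(2)], of ?e2 "D \<theta> z (\<eta> z)"]
          D2_symmetric_vec[OF s(2), of ?e1 ?e2] R_def[symmetric] S_def[symmetric]
        by (rule quad)
    qed
    have alg: "det3 (a1 *\<^sub>R A + a2 *\<^sub>R B) (b1 *\<^sub>R A + b2 *\<^sub>R B) (r1 *\<^sub>R C1 + r2 *\<^sub>R C2 + r3 *\<^sub>R C3 + (c1 *\<^sub>R A + c2 *\<^sub>R B)) =
        (a1 * b2 - a2 * b1) * (r1 * det3 A B C1 + r2 * det3 A B C2 + r3 * det3 A B C3)"
      for A B C1 C2 C3 a1 a2 b1 b2 c1 c2 r1 r2 r3
      by (simp add: det3_expand algebra_simps)
    have "det4 (x z) (D x z (\<xi> z)) (D x z (\<eta> z)) (?L (D2 F (\<theta> z) (D \<theta> z (\<eta> z)) (D \<theta> z (\<eta> z)) + ?P q)) =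
       det3 (?P (D \<theta> z (\<xi> z))) (?P (D \<theta> z (\<eta> z))) (D2 F (\<theta> z) (D \<theta> z (\<eta> z)) (D \<theta> z (\<eta> z)) + ?P q) * \<Lambda> (y z)"
      unfolding dx dy xz det4_image[OF s(4)] ..
    also have "\<dots> = \<kappa> z * (R z * R z * L1 (\<theta> z) + 2 * R z * S z * L2 (\<theta> z) + S z * S z * N (\<theta> z)) * \<Lambda> (y z)"
      unfolding D2F linear_basis2[OF lP, of "D \<theta> z (\<xi> z)"] linear_basis2[OF lP, of "D \<theta> z (\<eta> z)"]
        linear_basis2[OF lP, of q] alg
      unfolding \<kappa>_def L1_def L2_def N_def R_def S_def by simp
    finally show ?case
      using H3 elim(1) unfolding xx det4_add(4)
      by (simp add: h1_def h2_def \<mu>_def power2_eq_square algebra_simps)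
  qed
  from det_Hess_reparam[OF this \<theta>(1) _ \<mu>] N v1 v2 v3 \<theta>(3)
  have "det_Hess \<phi> p = (\<mu> p)\<^sup>2 * J\<theta>\<^sup>2 * det_Hess N 0" by (simp add: van_add J\<theta>_def)
  then show ?thesis
    using that[of "\<mu> p * J\<theta>"] \<mu>0 J\<theta>_nonzero by (simp add: power_mult_distrib)
qed

end

section \<open>Derivatives of fold maps\<close>

lemma fold_map_derivs:
  assumes G: "smooth_at G 0"
  defines "g \<equiv> \<lambda>z. G (vector [z $ 1, (z $ 2)\<^sup>2])"
  shows "smooth_at (fold_map G) 0" "smooth_at g 0"
    "\<forall>\<^sub>F w in nhds 0. \<forall>v. D (fold_map G) w v = vector [v $ 1, 2 * w $ 2 * v $ 2, v $ 2 * g w + w $ 2 * D g w v]"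
    "\<forall>\<^sub>F w in nhds 0. \<forall>a b. D2 (fold_map G) w a b =
      vector [0, 2 * b $ 2 * a $ 2, a $ 2 * D g w b + b $ 2 * D g w a + w $ 2 * D2 g w a b]"
    "D g 0 a = a $ 1 * D G 0 (axis 1 1)"
    "D2 g 0 a b = a $ 1 * b $ 1 * D2 G 0 (axis 1 1) (axis 1 1) + 2 * a $ 2 * b $ 2 * D G 0 (axis 2 1)"
proof -
  have F: "fold_map G = (\<lambda>z. vector [z $ 1, (z $ 2)\<^sup>2, z $ 2 * g z])"
    by (simp add: fun_eq_iff fold_map_def g_def)
  show g: "smooth_at g 0" unfolding g_def by (rule smooth_square_compose[OF G])
  show "smooth_at (fold_map G) 0" unfolding F by (intro sm g)
  have D1: "D (fold_map G) w v = vector [v $ 1, 2 * w $ 2 * v $ 2, v $ 2 * g w + w $ 2 * D g w v]"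
    if "smooth_at g w" for w v
    unfolding F using that by (subst D_vector3) (simp_all add: sm D_power2 D_mult)
  show d1: "\<forall>\<^sub>F w in nhds 0. \<forall>v. D (fold_map G) w v = vector [v $ 1, 2 * w $ 2 * v $ 2, v $ 2 * g w + w $ 2 * D g w v]"
    using smooth_at_eventually[OF g] by eventually_elim (simp add: D1)
  show "\<forall>\<^sub>F w in nhds 0. \<forall>a b. D2 (fold_map G) w a b =
      vector [0, 2 * b $ 2 * a $ 2, a $ 2 * D g w b + b $ 2 * D g w a + w $ 2 * D2 g w a b]"
    using smooth_at_eventually[OF g] ev_nhds2[OF d1]
  proof eventually_elim
    case (elim w)
    have s: "smooth_at (\<lambda>z. D g z v) w" for v using elim(1) by (rule smooth_at_D)
    have "D2 (fold_map G) w a b = D (\<lambda>w. vector [a $ 1, 2 * w $ 2 * a $ 2, a $ 2 * g w + w $ 2 * D g w a] :: real^3) w b" for a b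
      by (rule fun_cong[OF D_cong_ev]) (use elim(2) in eventually_elim, simp)
    then show ?case
      using elim(1) s by (simp add: D_vector3 D_mult D_add sm add.assoc)
  qed
  show "D g 0 a = a $ 1 * D G 0 (axis 1 1)" for a
    unfolding g_def D_square_compose[OF G] vector_10_scale by (simp add: linear_scale[OF smooth_at_linear_D[OF G]])
  let ?q = "\<lambda>z::real^2. vector [z $ 1, (z $ 2)\<^sup>2] :: real^2"
  have q: "smooth_at ?q z" for z by (rule smooth_square_pair)
  have Dq: "D ?q z v = vector [v $ 1, 2 * z $ 2 * v $ 2]" for z v
    by (subst D_vector2) (simp_all add: sm D_power2)
  have Dq2: "D2 ?q z v w = vector [0, 2 * w $ 2 * v $ 2]" for z v w
    unfolding Dq by (subst D_vector2) (simp_all add: sm D_mult)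
  have Gq: "smooth_at G (?q 0)" using G by simp
  have vs: "vector [0, t] = t *\<^sub>R (axis 2 1 :: real^2)" for t by (simp add: vec_eq_iff forall_2)
  have "D2 g 0 a b = D2 G (?q 0) (D ?q 0 a) (D ?q 0 b) + D G (?q 0) (D2 ?q 0 a b)"
    unfolding g_def by (rule D2_compose[OF Gq q])
  also have "D2 G (?q 0) (D ?q 0 a) (D ?q 0 b) = a $ 1 * b $ 1 * D2 G 0 (axis 1 1) (axis 1 1)"
    unfolding Dq using linear_scale[OF linear_D2_left[OF G]] linear_scale[OF linear_D2_right[OF G]]
    by (simp add: vector_10_scale)
  also have "D G (?q 0) (D2 ?q 0 a b) = 2 * a $ 2 * b $ 2 * D G 0 (axis 2 1)"
    unfolding Dq2 vs by (simp add: linear_scale[OF smooth_at_linear_D[OF G]])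
  finally show "D2 g 0 a b = a $ 1 * b $ 1 * D2 G 0 (axis 1 1) (axis 1 1) + 2 * a $ 2 * b $ 2 * D G 0 (axis 2 1)" .
qed

lemma fold_map_0_derivs:
  assumes G: "smooth_at G 0"
  shows "D (fold_map G) 0 v = vector [v $ 1, 0, v $ 2 * G 0]"
    "D2 (fold_map G) 0 (axis 2 1) (axis 1 1) = vector [0, 0, D G 0 (axis 1 1)]"
    "D2 (fold_map G) 0 (axis 2 1) (axis 2 1) = vector [0, 2, 0]"
  using eventually_nhds_x_imp_x[OF fold_map_derivs(3)[OF G]] eventually_nhds_x_imp_x[OF fold_map_derivs(4)[OF G]]
    fold_map_derivs(5)[OF G]
  by simp_all

lemma D2_diff:
  fixes h k :: "'a::real_normed_vector \<Rightarrow> real"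
  assumes "smooth_at h p" "smooth_at k p"
  shows "D2 (\<lambda>z. h z - k z) p v w = D2 h p v w - D2 k p v w"
proof -
  have "\<forall>\<^sub>F z in nhds p. D (\<lambda>z. h z - k z) z v = D h z v - D k z v"
    using assms[THEN smooth_at_eventually] by eventually_elim (rule D_diff)
  from D_cong_ev[OF this] show ?thesis using assms[THEN smooth_at_D] by (simp add: D_diff)
qed

text \<open>With \<open>g = G (u, v\<^sup>2)\<close> the determinant is
  \<open>2 v g_v + 2 v\<^sup>2 g_vv - 2 g\<close>. Its second derivatives at the origin are
  \<open>- 2 G_uu\<close>, \<open>0\<close> and \<open>12 G_Y\<close>, whence the factor
  \<open>- 24\<close>.\<close>

lemma det_Hess_fold_map:
  assumes G: "smooth_at G 0" "G 0 = 0" "D G 0 (axis 1 1) = 0"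
  shows "det_Hess (\<lambda>w. det3 (D (fold_map G) w (axis 1 1)) (D (fold_map G) w (axis 2 1))
      (D2 (fold_map G) w (axis 2 1) (axis 2 1))) 0 =
    - 24 * D2 G 0 (axis 1 1) (axis 1 1) * D G 0 (axis 2 1)" (is "det_Hess ?N 0 = _")
proof -
  define g where "g z = G (vector [z $ 1, (z $ 2)\<^sup>2])" for z :: "real^2"
  note d = fold_map_derivs[OF G(1), folded g_def]
  have g0: "g 0 = 0" by (simp add: g_def G)
  have gs: "smooth_at (\<lambda>w. D g w v) 0" "smooth_at (\<lambda>w. D2 g w v u) 0" for u v
    using d(2) by (auto intro: smooth_at_D)
  have "\<forall>\<^sub>F w in nhds 0. ?N w = 2 * (w $ 2 * D g w (axis 2 1)) + (2 * (w $ 2 * (w $ 2 * D2 g w (axis 2 1) (axis 2 1))) - 2 * g w)"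
    using d(3,4) by eventually_elim (simp add: det3_expand algebra_simps)
  note N = D2_cong_ev[OF this]
  have z: "D2 (\<lambda>w::real^2. w $ i) 0 u v = 0" for i u v by simp
  have c: "D2 (\<lambda>w::real^2. k :: real) 0 u v = 0" for k u v by simp
  have N2: "D2 ?N 0 u v = 2 * (u $ 2 * D2 g 0 (axis 2 1) v + v $ 2 * D2 g 0 (axis 2 1) u) +
      4 * u $ 2 * v $ 2 * D2 g 0 (axis 2 1) (axis 2 1) - 2 * D2 g 0 u v" for u v
    unfolding N using d(2) gs d(5)
    by (simp add: D2_add D2_diff D2_mult D_mult sm z c g0 G algebra_simps)
  show ?thesis
    unfolding det_Hess_D2 N2 d(6) by simp
qed

section \<open>The frame at a fold map\<close>

lemma det4_swap1: "det4 x w y z = - det4 w x y z"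
proof -
  have "det4 (w + x) (w + x) y z = 0" by simp
  then show ?thesis unfolding det4_add by simp
qed

context presented
begin

text \<open>The timelike vector \<open>\<Phi> 0\<close> is not tangent to the hyperboloid, so
  together with the image of \<open>D \<Phi> 0\<close> it spans \<open>real^4\<close>.\<close>

lemma tangent_basis:
  obtains s n where "v = s *\<^sub>R \<Phi> 0 + D \<Phi> 0 n"
proof -
  let ?T = "\<lambda>u::real^4. u $ 1 *\<^sub>R \<Phi> 0 + D \<Phi> 0 (vector [u $ 2, u $ 3, u $ 4])"
  let ?e = "\<lambda>i. D \<Phi> 0 (axis i 1)"
  have T: "?T u = u $ 1 *\<^sub>R \<Phi> 0 + u $ 2 *\<^sub>R ?e 1 + u $ 3 *\<^sub>R ?e 2 + u $ 4 *\<^sub>R ?e 3" for u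
    using D_basis3[OF \<Phi>(1), of "vector [u $ 2, u $ 3, u $ 4]"] by (simp add: add.assoc)
  have lin: "linear ?T"
    unfolding T by (rule linearI) (simp_all add: scaleR_left_distrib scaleR_right_distrib)
  have "u = 0" if "?T u = 0" for u
  proof (rule ccontr)
    assume u: "u \<noteq> 0"
    have H: "\<Phi> 0 \<in> H3" using eventually_nhds_x_imp_x[OF \<Phi>(3)] .
    let ?w = "vector [u $ 2, u $ 3, u $ 4] :: real^3"
    interpret m: bounded_bilinear mink by (rule bounded_bilinear_mink)
    have "mink (\<Phi> 0) (?T u) = - (u $ 1)"
      using H D_tangent_H3[OF \<Phi>(1,3), of ?w] by (simp add: m.add_right m.scaleR_right H3_def)
    then have 1: "u $ 1 = 0" using that by (simp add: m.zero_right)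
    then have "?w = 0" using that D_\<Phi>_0_iff by simp
    then show False using 1 u by (simp add: vec_eq_iff forall_3 forall_4)
  qed
  then have "surj ?T"
    using linear_injective_0[OF lin] linear_injective_imp_surjective[OF lin] by blast
  then obtain u where "v = ?T u" by (rule surjE)
  then show ?thesis using that by blast
qed

text \<open>The hypothesis \<open>Gu\<close> makes the points of the first axis off the origin
  regular. Continuity from these points gives one component of \<nu> in the chart, and a derivative
  at the origin gives the other.\<close>

lemma fold_frame_direction:
  assumes FG: "F = fold_map G" and G: "smooth_at G 0" "G 0 = 0"
    and Gu: "\<forall>\<^sub>F w::real^2 in nhds 0. w $ 1 \<noteq> 0 \<longrightarrow> G (vector [w $ 1, 0]) \<noteq> 0"
    and \<nu>: "smooth_at \<nu> p" "mink (x p) (\<nu> p) = 0"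
    and det: "\<forall>\<^sub>F z in nhds p. det4 (x z) (\<nu> z) (D x z (axis 1 1)) (D x z (axis 2 1)) = 0"
  shows "\<exists>n. \<nu> p = n *\<^sub>R D \<Phi> 0 (axis 1 1)"
proof -
  let ?E1 = "axis 1 1 :: real^3" and ?E2 = "axis 2 1 :: real^3" and ?E3 = "axis 3 1 :: real^3"
  define g where "g z = G (vector [z $ 1, (z $ 2)\<^sup>2])" for z :: "real^2"
  note d = fold_map_derivs[OF G(1), folded g_def FG]
  have g0: "g 0 = 0" by (simp add: g_def G)
  obtain \<tau> where \<tau>: "smooth_at \<tau> (\<theta> p)" "\<tau> (\<theta> p) = p" "\<forall>\<^sub>F w in nhds (\<theta> p). \<theta> (\<tau> w) = w"
    by (rule local_inverse[OF \<theta>(1,2)]) blast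
  note \<tau> = \<tau>[unfolded \<theta>(3)]
  \<comment> \<open>The partial derivatives of \<open>x\<close> are combinations of those of the
    chart expression along the new coordinates; the determinant of this change is nonzero near
    \<open>p\<close> and divides out.\<close>
  have Jz: "\<forall>\<^sub>F z in nhds p. D \<theta> z (axis 1 1) $ 1 * D \<theta> z (axis 2 1) $ 2 - D \<theta> z (axis 1 1) $ 2 * D \<theta> z (axis 2 1) $ 1 \<noteq> 0"
  proof -
    let ?j = "\<lambda>z. D \<theta> z (axis 1 1) $ 1 * D \<theta> z (axis 2 1) $ 2 - D \<theta> z (axis 1 1) $ 2 * D \<theta> z (axis 2 1) $ 1"
    have "smooth_at ?j p" by (intro sm \<theta>)
    moreover have "\<forall>\<^sub>F t in nhds (?j p). t \<noteq> 0"
      using J\<theta>_nonzero unfolding J\<theta>_def by (intro t1_space_nhds)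
    ultimately show ?thesis by (rule eventually_nhds_smooth)
  qed
  \<comment> \<open>The map \<tau> inverts \<theta>, so everything is transported to the coordinates
    in which \<open>F\<close> is the fold map.\<close>
  define M where "M A B w = det4 (\<Phi> (F w)) (\<nu> (\<tau> w)) (D \<Phi> (F w) A) (D \<Phi> (F w) B)" for A B w
  have Ms: "smooth_at (M A B) 0" for A B
    unfolding M_def
  proof (intro sm)
    show "smooth_at (\<lambda>w. \<Phi> (F w)) 0" by (rule smooth_at_compose) (use F \<Phi> in auto)
    show "smooth_at (\<lambda>w. \<nu> (\<tau> w)) 0" by (rule smooth_at_compose) (use \<tau> \<nu> in auto)
    show "smooth_at (\<lambda>w. D \<Phi> (F w) A) 0" "smooth_at (\<lambda>w. D \<Phi> (F w) B) 0"
      by (rule smooth_at_compose[where f=F]; use F \<Phi> in \<open>auto intro: smooth_at_D\<close>)+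
  qed
  have "\<forall>\<^sub>F z in nhds p. det4 (x z) (\<nu> z) (D \<Phi> (y z) (D F (\<theta> z) (axis 1 1))) (D \<Phi> (y z) (D F (\<theta> z) (axis 2 1))) = 0"
    using det derivs Jz near
  proof eventually_elim
    case (elim z)
    have s: "smooth_at \<Phi> (y z)" "smooth_at F (\<theta> z)" using elim(4) by auto
    let ?P = "\<lambda>v. D \<Phi> (y z) (D F (\<theta> z) v)"
    have lin: "linear ?P"
      using linear_compose[OF smooth_at_linear_D[OF s(2)] smooth_at_linear_D[OF s(1)]] by (simp add: o_def)
    have "D x z v = ?P (D \<theta> z v)" for v using elim(2) by simp
    then have e: "D x z v = D \<theta> z v $ 1 *\<^sub>R ?P (axis 1 1) + D \<theta> z v $ 2 *\<^sub>R ?P (axis 2 1)" for v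
      using linear_basis2[OF lin, of "D \<theta> z v"] by simp
    have "det4 (x z) (\<nu> z) (D x z (axis 1 1)) (D x z (axis 2 1)) =
      (D \<theta> z (axis 1 1) $ 1 * D \<theta> z (axis 2 1) $ 2 - D \<theta> z (axis 1 1) $ 2 * D \<theta> z (axis 2 1) $ 1) *
      det4 (x z) (\<nu> z) (?P (axis 1 1)) (?P (axis 2 1))"
      unfolding e[of "axis 1 1"] e[of "axis 2 1"]
      by (simp add: det4_add det4_scale det4_swap(2)[of "x z" "\<nu> z" "?P (axis 2 1)" "?P (axis 1 1)"] algebra_simps)
    then show ?case using elim(1,3) by simp
  qed
  then have "\<forall>\<^sub>F z in nhds (\<tau> 0). det4 (x z) (\<nu> z) (D \<Phi> (y z) (D F (\<theta> z) (axis 1 1))) (D \<Phi> (y z) (D F (\<theta> z) (axis 2 1))) = 0 \<and> x z = \<Phi> (F (\<theta> z))"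
    using xe \<tau>(2) by (auto intro: eventually_conj)
  from eventually_nhds_smooth[OF \<tau>(1) this]
  have "\<forall>\<^sub>F w in nhds 0. M (D F w (axis 1 1)) (D F w (axis 2 1)) w = 0"
    using \<tau>(3) by eventually_elim (auto simp: M_def y_def)
  then have h: "\<forall>\<^sub>F w in nhds 0. 2 * w $ 2 * M ?E1 ?E2 w + ((g w + w $ 2 * D g w (axis 2 1)) * M ?E1 ?E3 w +
      w $ 2 * (w $ 2 * (2 * D g w (axis 1 1) * M ?E3 ?E2 w))) = 0"
    using d(3) eventually_nhds_smooth[OF F(1), unfolded F(2), OF smooth_at_eventually[OF \<Phi>(1)]]
  proof eventually_elim
    case (elim w)
    note lin = smooth_at_linear_D[OF elim(3)]
    have "D F w (axis 1 1) = ?E1 + (w $ 2 * D g w (axis 1 1)) *\<^sub>R ?E3"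
      "D F w (axis 2 1) = (2 * w $ 2) *\<^sub>R ?E2 + (g w + w $ 2 * D g w (axis 2 1)) *\<^sub>R ?E3"
      using elim(2) by (simp_all add: vec_eq_iff forall_3)
    then have "M (D F w (axis 1 1)) (D F w (axis 2 1)) w =
      2 * w $ 2 * M ?E1 ?E2 w + ((g w + w $ 2 * D g w (axis 2 1)) * M ?E1 ?E3 w +
      w $ 2 * (w $ 2 * (2 * D g w (axis 1 1) * M ?E3 ?E2 w)))"
      by (simp add: M_def linear_add[OF lin] linear_scale[OF lin] det4_add det4_scale algebra_simps)
    then show ?case using elim(1) by simp
  qed
  \<comment> \<open>On the first axis the identity \<open>h\<close> reduces to the product of
    \<open>g\<close> with this minor. Were the minor nonzero at the origin, it would be so at a
    nearby axis point, where \<open>g\<close> is nonzero as well.\<close>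
  have M13: "M ?E1 ?E3 0 = 0"
  proof (rule ccontr)
    assume "M ?E1 ?E3 0 \<noteq> 0"
    then have "\<forall>\<^sub>F w in nhds 0. M ?E1 ?E3 w \<noteq> 0"
      by (intro eventually_nhds_smooth[OF Ms] t1_space_nhds)
    from eventually_conj[OF this eventually_conj[OF h Gu]]
    obtain r where r: "r > 0" "\<And>w. w \<in> box2 r r \<Longrightarrow> M ?E1 ?E3 w \<noteq> 0 \<and>
      2 * w $ 2 * M ?E1 ?E2 w + ((g w + w $ 2 * D g w (axis 2 1)) * M ?E1 ?E3 w +
      w $ 2 * (w $ 2 * (2 * D g w (axis 1 1) * M ?E3 ?E2 w))) = 0 \<and> (w $ 1 \<noteq> 0 \<longrightarrow> G (vector [w $ 1, 0]) \<noteq> 0)"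
      by (rule box2_nhds) blast
    have "vector [r / 2, 0] \<in> box2 r r" using r(1) by (simp add: box2_def)
    from r(2)[OF this] r(1) show False by (auto simp: g_def)
  qed
  \<comment> \<open>Derivative of \<open>h\<close> in the second direction: every term but the first
    vanishes, since \<open>g\<close>, its derivative in that direction, and the minor of the
    previous step are zero at the origin.\<close>
  have M12: "M ?E1 ?E2 0 = 0"
  proof -
    have gs: "smooth_at (\<lambda>w. D g w v) 0" for v using d(2) by (rule smooth_at_D)
    have "D (\<lambda>w. 2 * w $ 2 * M ?E1 ?E2 w + ((g w + w $ 2 * D g w (axis 2 1)) * M ?E1 ?E3 w +
      w $ 2 * (w $ 2 * (2 * D g w (axis 1 1) * M ?E3 ?E2 w)))) 0 (axis 2 1) = D (\<lambda>w. 0) 0 (axis 2 1)"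
      using D_cong_ev[OF h] by simp
    then show ?thesis
      using Ms d(2) gs d(5) by (simp add: D_add D_mult sm M13 g0)
  qed
  obtain s n where n: "\<nu> p = s *\<^sub>R \<Phi> 0 + D \<Phi> 0 n" by (rule tangent_basis)
  interpret m: bounded_bilinear mink by (rule bounded_bilinear_mink)
  have "mink (\<Phi> 0) (\<nu> p) = - s"
    using eventually_nhds_x_imp_x[OF \<Phi>(3)] D_tangent_H3[OF \<Phi>(1,3), of n] unfolding n
    by (simp add: m.add_right m.scaleR_right H3_def)
  then have "s = 0" using \<nu>(2) x_p by simp
  then have n: "\<nu> p = D \<Phi> 0 n" using n by simp
  have "M A B 0 = det3 n A B * \<Lambda> 0" for A B
    unfolding M_def F \<tau>(2) n by (rule det4_image[OF \<Phi>(1)])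
  then have "n $ 3 = 0" "n $ 2 = 0" using M12 M13 \<Lambda>_0 by (simp_all add: det3_expand)
  then have "n = n $ 1 *\<^sub>R ?E1" by (simp add: vec_eq_iff forall_3)
  then show ?thesis using n linear_scale[OF smooth_at_linear_D[OF \<Phi>(1)], of "n $ 1" ?E1] by metis
qed

end

section \<open>Framed surfaces\<close>

lemma mink_wedge: "mink w (wedge x y z) = det4 w x y z"
  using theI'[OF ex1_wedge[of x y z]] unfolding wedge_def by blast

lemma wedge_components:
  "wedge x y z = (\<chi> i. if i = 1 then - det4 (axis 1 1) x y z else det4 (axis i 1) x y z)"
  unfolding mink_wedge[symmetric] by (simp add: vec_eq_iff forall_4 mink_def axis_def)

lemma smooth_at_wedge:
  assumes "smooth_at f z" "smooth_at g z" "smooth_at h z"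
  shows "smooth_at (\<lambda>z. wedge (f z) (g z) (h z)) z"
  unfolding wedge_components
proof (rule smooth_at_vec_lambda)
  fix i :: 4
  show "smooth_at (\<lambda>z. if i = 1 then - det4 (axis 1 1) (f z) (g z) (h z) else det4 (axis i 1) (f z) (g z) (h z)) z"
    by (cases "i = 1") (auto intro!: sm assms)
qed

text \<open>The sign change \<open>j\<close> converts the Minkowski product into the Euclidean one,
  where three vectors cannot span four dimensions.\<close>

lemma exists_mink_orthogonal:
  obtains n where "n \<noteq> 0" "mink x n = 0" "mink y n = 0" "mink z n = 0"
proof -
  define j where "j v = (\<chi> i. if i = 1 then - (v $ 1) else v $ i)" for v :: "real^4"
  have j: "inner n (j v) = mink v n" for v n
    by (simp add: j_def inner_vec_def sum_4 mink_def mult.commute)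
  have "dim {j x, j y, j z} \<le> card {j x, j y, j z}" by (rule dim_le_card') simp
  also have "\<dots> < DIM(real^4)" by (simp add: card_insert_if)
  finally obtain n where "n \<noteq> 0" "\<And>v. v \<in> span {j x, j y, j z} \<Longrightarrow> orthogonal n v"
    using orthogonal_to_subspace_exists by blast
  then show ?thesis
    using that[of n] by (auto simp: orthogonal_def span_base simp flip: j)
qed

text \<open>For the first claim the wedge is paired with a nonzero \<open>n\<close> orthogonal to
  all three vectors; these are orthogonal to each other with nonzero squares, so the four vectors
  are independent.\<close>

lemma frame_complement:
  assumes x: "x \<in> H3" and \<nu>: "(\<nu>1, \<nu>2) \<in> Delta5" "mink x \<nu>1 = 0" "mink x \<nu>2 = 0"
  shows "wedge x \<nu>1 \<nu>2 \<noteq> 0" "mink x (wedge x \<nu>1 \<nu>2) = 0"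
    "mink \<nu>1 (wedge x \<nu>1 \<nu>2) = 0" "mink \<nu>2 (wedge x \<nu>1 \<nu>2) = 0"
proof -
  interpret m: bounded_bilinear mink by (rule bounded_bilinear_mink)
  have \<nu>': "mink \<nu>1 \<nu>1 = 1" "mink \<nu>2 \<nu>2 = 1" "mink \<nu>1 \<nu>2 = 0" and xx: "mink x x = -1"
    using \<nu>(1) x by (auto simp: Delta5_def S31_def H3_def)
  obtain n where n: "n \<noteq> 0" "mink x n = 0" "mink \<nu>1 n = 0" "mink \<nu>2 n = 0" by (rule exists_mink_orthogonal)
  have "det4 n x \<nu>1 \<nu>2 \<noteq> 0"
  proof (rule det4_nonzero)
    fix a b c d
    assume e: "a *\<^sub>R n + b *\<^sub>R x + c *\<^sub>R \<nu>1 + d *\<^sub>R \<nu>2 = 0"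
    have "mink v (a *\<^sub>R n + b *\<^sub>R x + c *\<^sub>R \<nu>1 + d *\<^sub>R \<nu>2) = a * mink v n + b * mink v x + c * mink v \<nu>1 + d * mink v \<nu>2" for v
      by (simp add: m.add_right m.scaleR_right)
    from this[of x] this[of \<nu>1] this[of \<nu>2] have "b = 0" "c = 0" "d = 0"
      unfolding e using n \<nu> \<nu>' xx by (simp_all add: m.zero_right mink_commute[of \<nu>1 x] mink_commute[of \<nu>2 x] mink_commute[of \<nu>2 \<nu>1])
    then show "a = 0 \<and> b = 0 \<and> c = 0 \<and> d = 0" using e n(1) by simp
  qed
  then show "wedge x \<nu>1 \<nu>2 \<noteq> 0" using mink_wedge[of n x \<nu>1 \<nu>2] by (auto simp: m.zero_right)
qed (simp_all add: mink_wedge)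

text \<open>Keeps what the proof uses of a framed surface: orthogonality at \<open>p\<close>, the
  frame equation for the derivatives of \<open>x\<close> as a germ, and the framing condition in the
  form \<open>det\<close>, that is, orthogonality of the normal direction to \<nu>3. The vector
  field \<nu>3 is left abstract.\<close>

locale framed =
  fixes x \<nu>1 \<nu>2 \<nu>3 :: "real^2 \<Rightarrow> real^4" and a b c :: "real^2 \<Rightarrow> real^2" and p :: "real^2" and \<phi> :: "real^2 \<Rightarrow> real"
  assumes smooth: "smooth_at x p" "smooth_at \<nu>1 p" "smooth_at \<nu>2 p" "smooth_at \<nu>3 p"
      "smooth_at a p" "smooth_at b p" "smooth_at c p"
    and H: "\<forall>\<^sub>F z in nhds p. x z \<in> H3"
    and frame: "mink (\<nu>1 p) (\<nu>1 p) = 1" "mink (\<nu>2 p) (\<nu>2 p) = 1" "mink (\<nu>1 p) (\<nu>2 p) = 0"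
      "mink (x p) (\<nu>1 p) = 0" "mink (x p) (\<nu>2 p) = 0" "mink (x p) (\<nu>3 p) = 0"
      "mink (\<nu>1 p) (\<nu>3 p) = 0" "mink (\<nu>2 p) (\<nu>3 p) = 0" "\<nu>3 p \<noteq> 0"
    and dx: "\<forall>\<^sub>F z in nhds p. \<forall>i. D x z (axis i 1) = a z $ i *\<^sub>R \<nu>1 z + b z $ i *\<^sub>R \<nu>2 z + c z $ i *\<^sub>R \<nu>3 z"
    and det: "\<forall>\<^sub>F z in nhds p. det4 (x z) (\<nu>3 z) (D x z (axis 1 1)) (D x z (axis 2 1)) = 0"
    and \<phi>: "\<forall>\<^sub>F z in nhds p. \<phi> z = det4 (x z) (D x z (c z)) (D x z (vector [c z $ 2, - (c z $ 1)]))
      (D (\<lambda>z. D x z (vector [c z $ 2, - (c z $ 1)])) z (vector [c z $ 2, - (c z $ 1)]))"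
begin

sublocale m: bounded_bilinear mink by (rule bounded_bilinear_mink)

lemma mink_combination:
  "mink v (d *\<^sub>R x p + r *\<^sub>R \<nu>1 p + s *\<^sub>R \<nu>2 p + t *\<^sub>R \<nu>3 p) =
    d * mink v (x p) + r * mink v (\<nu>1 p) + s * mink v (\<nu>2 p) + t * mink v (\<nu>3 p)"
  by (simp add: m.add_right m.scaleR_right)

lemma frame_independent:
  assumes e: "d *\<^sub>R x p + r *\<^sub>R \<nu>1 p + s *\<^sub>R \<nu>2 p + t *\<^sub>R \<nu>3 p = 0"
  shows "d = 0 \<and> r = 0 \<and> s = 0 \<and> t = 0"
proof -
  have "mink (x p) (x p) = -1" using eventually_nhds_x_imp_x[OF H] by (simp add: H3_def)
  with mink_combination[of "x p" d r s t] mink_combination[of "\<nu>1 p" d r s t] mink_combination[of "\<nu>2 p" d r s t]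
  have "d = 0" "r = 0" "s = 0"
    unfolding e using frame by (simp_all add: m.zero_right mink_commute[of "\<nu>1 p" "x p"] mink_commute[of "\<nu>2 p" "x p"]
        mink_commute[of "\<nu>2 p" "\<nu>1 p"])
  then show ?thesis using e frame(9) by simp
qed

lemma frame_independent3:
  "r *\<^sub>R \<nu>1 p + s *\<^sub>R \<nu>2 p + t *\<^sub>R \<nu>3 p = 0 \<Longrightarrow> r = 0 \<and> s = 0 \<and> t = 0"
  using frame_independent[of 0 r s t] by simp

lemma det4_frame: "det4 (x p) (\<nu>3 p) (\<nu>1 p) (\<nu>2 p) \<noteq> 0"
proof (rule det4_nonzero)
  fix d t r s
  assume "d *\<^sub>R x p + t *\<^sub>R \<nu>3 p + r *\<^sub>R \<nu>1 p + s *\<^sub>R \<nu>2 p = 0"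
  then have "d *\<^sub>R x p + r *\<^sub>R \<nu>1 p + s *\<^sub>R \<nu>2 p + t *\<^sub>R \<nu>3 p = 0" by (simp add: algebra_simps)
  then show "d = 0 \<and> t = 0 \<and> r = 0 \<and> s = 0" using frame_independent by blast
qed

text \<open>\<open>A v\<close> and \<open>B v\<close> are the \<nu>1- and \<nu>2-components of the
  second derivative of \<open>x\<close> in the directions \<open>\<eta> p\<close> and
  \<open>v\<close>, once \<open>a\<close> and \<open>b\<close> vanish at \<open>p\<close>; see
  \<open>D2x_\<eta>\<close>.\<close>

definition A where "A v = det2 (D a p v) (c p)"
definition B where "B v = det2 (D b p v) (c p)"
definition J where "J = B (axis 1 1) * A (axis 2 1) - B (axis 2 1) * A (axis 1 1)"
definition \<eta> where "\<eta> z = (vector [c z $ 2, - (c z $ 1)] :: real^2)"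
definition A\<eta> where "A\<eta> = - (c p $ 1) * A (axis 2 1) + c p $ 2 * A (axis 1 1)"
definition B\<eta> where "B\<eta> = c p $ 2 * B (axis 1 1) - c p $ 1 * B (axis 2 1)"

lemma dx_p: "D x p (axis i 1) = a p $ i *\<^sub>R \<nu>1 p + b p $ i *\<^sub>R \<nu>2 p + c p $ i *\<^sub>R \<nu>3 p"
  using eventually_nhds_x_imp_x[OF dx] by blast

text \<open>By \<open>fold_frame_direction\<close> the vector \<nu>3 spans the image of the
  differential, so the \<nu>1- and \<nu>2-components \<open>a\<close> and \<open>b\<close> of the
  derivatives vanish. If \<open>c\<close> vanished as well, the Jacobian of \<theta> would be
  zero.\<close>

lemma fold_necessary:
  assumes pr: "presents x p (fold_map G)" and G: "smooth_at G 0" "G 0 = 0"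
    and Gu: "\<forall>\<^sub>F w::real^2 in nhds 0. w $ 1 \<noteq> 0 \<longrightarrow> G (vector [w $ 1, 0]) \<noteq> 0"
  shows "a p = 0 \<and> b p = 0 \<and> c p \<noteq> 0"
proof -
  obtain \<Phi> \<theta> where "presented x p (fold_map G) \<Phi> \<theta>"
    using pr unfolding presents_def presented_def by blast
  then interpret P: presented x p "fold_map G" \<Phi> \<theta> .
  have m: "D (fold_map G) 0 v = v $ 1 *\<^sub>R axis 1 1" for v
    using fold_map_0_derivs(1)[OF G(1)] by (simp add: G vec_eq_iff forall_3)
  interpret corank_one x p "fold_map G" \<Phi> \<theta>
    by unfold_locales (simp_all add: m axis_eq_0_iff)
  obtain n where n: "\<nu>3 p = n *\<^sub>R D \<Phi> 0 (axis 1 1)"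
    using P.fold_frame_direction[OF refl G Gu smooth(4) frame(6) det] by blast
  then have n0: "n \<noteq> 0" using frame(9) by auto
  have D: "D x p v = (D \<theta> p v $ 1 / n) *\<^sub>R \<nu>3 p" for v
    using Dx_m[of v] n n0 by (simp add: m)
  have "a p $ i = 0 \<and> b p $ i = 0 \<and> c p $ i - D \<theta> p (axis i 1) $ 1 / n = 0" for i
    using dx_p[of i] unfolding D by (intro frame_independent3) (simp add: scaleR_left_diff_distrib)
  then have abc: "a p = 0" "b p = 0" "\<And>i. c p $ i = D \<theta> p (axis i 1) $ 1 / n"
    by (simp_all add: vec_eq_iff)
  have "c p \<noteq> 0"
  proof
    assume "c p = 0"
    then have "D \<theta> p (axis 1 1) $ 1 = 0" "D \<theta> p (axis 2 1) $ 1 = 0"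
      using abc(3)[of 1] abc(3)[of 2] n0 by simp_all
    then show False using P.J\<theta>_nonzero by (simp add: P.J\<theta>_def)
  qed
  then show ?thesis using abc by simp
qed

lemma Dx_corank_one:
  assumes "a p = 0" "b p = 0"
  shows "D x p v = (c p $ 1 * v $ 1 + c p $ 2 * v $ 2) *\<^sub>R \<nu>3 p"
  using D_basis2[OF smooth(1), of v] dx_p[of 1] dx_p[of 2] assms
  by (simp add: scaleR_left_distrib mult.commute)

text \<open>Because \<open>a\<close> and \<open>b\<close> vanish at \<open>p\<close>, the
  derivatives of \<nu>1 and \<nu>2 do not enter. The derivative of \<nu>3 enters with coefficient
  \<open>c\<^sub>2 c\<^sub>1 - c\<^sub>1 c\<^sub>2 = 0\<close>.\<close>

lemma D2x_\<eta>:
  assumes ab: "a p = 0" "b p = 0"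
  shows "\<exists>t. D2 x p (\<eta> p) v = A v *\<^sub>R \<nu>1 p + B v *\<^sub>R \<nu>2 p + t *\<^sub>R \<nu>3 p"
proof -
  have e: "D2 x p (axis i 1) v = D a p v $ i *\<^sub>R \<nu>1 p + D b p v $ i *\<^sub>R \<nu>2 p + D c p v $ i *\<^sub>R \<nu>3 p + c p $ i *\<^sub>R D \<nu>3 p v" for i
  proof -
    have "\<forall>\<^sub>F z in nhds p. D x z (axis i 1) = a z $ i *\<^sub>R \<nu>1 z + b z $ i *\<^sub>R \<nu>2 z + c z $ i *\<^sub>R \<nu>3 z"
      using dx by eventually_elim blast
    from D_cong_ev[OF this] show ?thesis
      using smooth ab by (simp add: D_add D_scaleR D_nth sm)
  qed
  have "D2 x p (\<eta> p) v = c p $ 2 *\<^sub>R D2 x p (axis 1 1) v - c p $ 1 *\<^sub>R D2 x p (axis 2 1) v"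
    using linear_basis2[OF linear_D2_left[OF smooth(1)], of "\<eta> p" v] by (simp add: \<eta>_def)
  also have "\<dots> = A v *\<^sub>R \<nu>1 p + B v *\<^sub>R \<nu>2 p + det2 (D c p v) (c p) *\<^sub>R \<nu>3 p"
    unfolding e A_def B_def det2_expand by (simp add: vec_eq_iff algebra_simps)
  finally show ?thesis by blast
qed

lemma D2x_\<eta>\<eta>:
  assumes ab: "a p = 0" "b p = 0"
  shows "\<exists>t. D2 x p (\<eta> p) (\<eta> p) = A\<eta> *\<^sub>R \<nu>1 p + B\<eta> *\<^sub>R \<nu>2 p + t *\<^sub>R \<nu>3 p"
proof -
  obtain s where s: "D2 x p (\<eta> p) (axis 1 1) = A (axis 1 1) *\<^sub>R \<nu>1 p + B (axis 1 1) *\<^sub>R \<nu>2 p + s *\<^sub>R \<nu>3 p"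
    using D2x_\<eta>[OF ab] by blast
  obtain t where t: "D2 x p (\<eta> p) (axis 2 1) = A (axis 2 1) *\<^sub>R \<nu>1 p + B (axis 2 1) *\<^sub>R \<nu>2 p + t *\<^sub>R \<nu>3 p"
    using D2x_\<eta>[OF ab] by blast
  have "D2 x p (\<eta> p) (\<eta> p) = c p $ 2 *\<^sub>R D2 x p (\<eta> p) (axis 1 1) - c p $ 1 *\<^sub>R D2 x p (\<eta> p) (axis 2 1)"
    using linear_basis2[OF linear_D2_right[OF smooth(1)], of "\<eta> p" "\<eta> p"] by (simp add: \<eta>_def)
  also have "\<dots> = A\<eta> *\<^sub>R \<nu>1 p + B\<eta> *\<^sub>R \<nu>2 p + (c p $ 2 * s - c p $ 1 * t) *\<^sub>R \<nu>3 p"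
    unfolding s t A\<eta>_def B\<eta>_def by (simp add: vec_eq_iff algebra_simps)
  finally show ?thesis by blast
qed

text \<open>Links the frame to an arbitrary corank one presentation. Both sides compute the same
  quantities of \<open>x\<close> at \<open>p\<close>, once in the frame and once through \<Phi>, and
  differ by nonzero factors.\<close>

lemma invariants:
  assumes abc: "a p = 0" "b p = 0" "c p \<noteq> 0" and P: "corank_one x p F \<Phi> \<theta>"
  shows "J \<noteq> 0 \<longleftrightarrow> det3 (D F 0 (axis 1 1)) (D2 F 0 (axis 2 1) (axis 1 1)) (D2 F 0 (axis 2 1) (axis 2 1)) \<noteq> 0"
    "A\<eta> = 0 \<and> B\<eta> = 0 \<longleftrightarrow> (\<exists>r. D2 F 0 (axis 2 1) (axis 2 1) = r *\<^sub>R D F 0 (axis 1 1))"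
    "J = 0 \<Longrightarrow> \<exists>K. K \<noteq> 0 \<and> det_Hess \<phi> p = K\<^sup>2 *
      det_Hess (\<lambda>w. det3 (D F w (axis 1 1)) (D F w (axis 2 1)) (D2 F w (axis 2 1) (axis 2 1))) 0"
proof -
  interpret corank_one x p F \<Phi> \<theta> by (rule P)
  have k: "D x p (\<eta> p) = 0" unfolding Dx_corank_one[OF abc(1,2)] by (simp add: \<eta>_def)
  have cc: "c p $ 1 * c p $ 1 + c p $ 2 * c p $ 2 \<noteq> 0"
    using abc(3) by (simp add: vec_eq_iff forall_2 sum_squares_eq_zero_iff)
  have \<eta>0: "\<eta> p \<noteq> 0" using abc(3) by (auto simp: \<eta>_def vec_eq_iff forall_2)
  define q where "q = c p $ 1 * c p $ 1 + c p $ 2 * c p $ 2"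
  have q: "q \<noteq> 0" using cc by (simp add: q_def)
  \<comment> \<open>Both \<nu>3 and \<open>D \<Phi> 0 m\<close> span the image of
    \<open>D x p\<close>. Evaluation at \<open>c p\<close>, which lies outside the kernel,
    determines their ratio \<rho>.\<close>
  have e: "q *\<^sub>R \<nu>3 p = D \<theta> p (c p) $ 1 *\<^sub>R D \<Phi> 0 m"
    using Dx_corank_one[OF abc(1,2), of "c p"] Dx_m[of "c p"] by (simp add: q_def)
  define u where "u = D \<theta> p (c p) $ 1"
  have u: "u \<noteq> 0" using e q frame(9) by (auto simp: u_def)
  define \<rho> where "\<rho> = q / u"
  have \<rho>: "\<rho> \<noteq> 0" using q u by (simp add: \<rho>_def)
  have "(1 / u) *\<^sub>R (q *\<^sub>R \<nu>3 p) = (1 / u) *\<^sub>R (u *\<^sub>R D \<Phi> 0 m)" using e by (simp add: u_def)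
  then have m\<rho>: "D \<Phi> 0 m = \<rho> *\<^sub>R \<nu>3 p" using u by (simp add: \<rho>_def)
  obtain s where s: "D2 x p (\<eta> p) (axis 1 1) = A (axis 1 1) *\<^sub>R \<nu>1 p + B (axis 1 1) *\<^sub>R \<nu>2 p + s *\<^sub>R \<nu>3 p"
    using D2x_\<eta>[OF abc(1,2)] by blast
  obtain t where t: "D2 x p (\<eta> p) (axis 2 1) = A (axis 2 1) *\<^sub>R \<nu>1 p + B (axis 2 1) *\<^sub>R \<nu>2 p + t *\<^sub>R \<nu>3 p"
    using D2x_\<eta>[OF abc(1,2)] by blast
  \<comment> \<open>The \<nu>3-parts cancel against the second row, and the remaining minor of the
    coefficients \<open>A\<close> and \<open>B\<close> is \<open>- J\<close>.\<close>
  have "det4 (x p) (D \<Phi> 0 m) (D2 x p (\<eta> p) (axis 1 1)) (D2 x p (\<eta> p) (axis 2 1)) =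
      - (\<rho> * J * det4 (x p) (\<nu>3 p) (\<nu>1 p) (\<nu>2 p))"
    unfolding s t m\<rho> J_def
    by (simp add: det4_add det4_scale det4_swap(2)[of "x p" "\<nu>3 p" "\<nu>2 p" "\<nu>1 p"] algebra_simps)
  then have c1: "- (\<rho> * J * det4 (x p) (\<nu>3 p) (\<nu>1 p) (\<nu>2 p)) = (D \<theta> p (\<eta> p) $ 2)\<^sup>2 * J\<theta> * \<Lambda> 0 *
      det3 m (D2 F 0 (axis 2 1) (axis 1 1)) (D2 F 0 (axis 2 1) (axis 2 1))"
    using cross_cap_invariant[OF k \<eta>0] by simp
  then show J: "J \<noteq> 0 \<longleftrightarrow> det3 m (D2 F 0 (axis 2 1) (axis 1 1)) (D2 F 0 (axis 2 1) (axis 2 1)) \<noteq> 0"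
    using \<rho> det4_frame kernel(2)[OF k \<eta>0] J\<theta>_nonzero \<Lambda>_0
    by (metis mult_eq_0_iff neg_equal_0_iff_equal power_not_zero)
  obtain w where w: "D2 x p (\<eta> p) (\<eta> p) = A\<eta> *\<^sub>R \<nu>1 p + B\<eta> *\<^sub>R \<nu>2 p + w *\<^sub>R \<nu>3 p"
    using D2x_\<eta>\<eta>[OF abc(1,2)] by blast
  have "(\<exists>r. D2 x p (\<eta> p) (\<eta> p) = r *\<^sub>R D \<Phi> 0 m) \<longleftrightarrow> A\<eta> = 0 \<and> B\<eta> = 0"
  proof
    assume "\<exists>r. D2 x p (\<eta> p) (\<eta> p) = r *\<^sub>R D \<Phi> 0 m"
    then obtain r where "A\<eta> *\<^sub>R \<nu>1 p + B\<eta> *\<^sub>R \<nu>2 p + w *\<^sub>R \<nu>3 p = (r * \<rho>) *\<^sub>R \<nu>3 p"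
      unfolding w m\<rho> by auto
    then have "A\<eta> *\<^sub>R \<nu>1 p + B\<eta> *\<^sub>R \<nu>2 p + (w - r * \<rho>) *\<^sub>R \<nu>3 p = 0"
      by (simp add: scaleR_left_diff_distrib add_diff_eq)
    from frame_independent3[OF this] show "A\<eta> = 0 \<and> B\<eta> = 0" by simp
  next
    assume "A\<eta> = 0 \<and> B\<eta> = 0"
    then have "D2 x p (\<eta> p) (\<eta> p) = (w / \<rho>) *\<^sub>R D \<Phi> 0 m" unfolding w m\<rho> using \<rho> by simp
    then show "\<exists>r. D2 x p (\<eta> p) (\<eta> p) = r *\<^sub>R D \<Phi> 0 m" by blast
  qed
  then show "A\<eta> = 0 \<and> B\<eta> = 0 \<longleftrightarrow> (\<exists>r. D2 F 0 (axis 2 1) (axis 2 1) = r *\<^sub>R m)"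
    using second_order_invariant[OF k \<eta>0] by simp
  assume "J = 0"
  then have J0: "det3 m (D2 F 0 (axis 2 1) (axis 1 1)) (D2 F 0 (axis 2 1) (axis 2 1)) = 0" using J by simp
  have \<eta>s: "smooth_at \<eta> p" unfolding \<eta>_def by (intro sm smooth)
  have ind: "c p $ 1 * \<eta> p $ 2 - c p $ 2 * \<eta> p $ 1 \<noteq> 0" using cc by (simp add: \<eta>_def add_eq_0_iff)
  obtain K where "K \<noteq> 0" "det_Hess \<phi> p = K\<^sup>2 * det_Hess N 0"
    by (rule Hessian_invariant[OF smooth(7) \<eta>s k ind J0 \<phi>[folded \<eta>_def]])
  then show "\<exists>K. K \<noteq> 0 \<and> det_Hess \<phi> p = K\<^sup>2 *
      det_Hess (\<lambda>w. det3 (D F w (axis 1 1)) (D F w (axis 2 1)) (D2 F w (axis 2 1) (axis 2 1))) 0"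
    unfolding N_def[abs_def] by blast
qed

text \<open>For a fold map with \<open>G 0 = 0\<close> the image is the first axis and the second
  derivative along the kernel is \<open>(0, 2, 0)\<close>, hence transverse; the cross cap
  determinant is \<open>- 2\<close> times the derivative of \<open>G\<close> in
  \<open>u\<close>.\<close>

lemma fold_invariants:
  assumes abc: "a p = 0" "b p = 0" "c p \<noteq> 0"
    and pr: "presents x p (fold_map G)" and G: "smooth_at G 0" "G 0 = 0"
  shows "J \<noteq> 0 \<longleftrightarrow> D G 0 (axis 1 1) \<noteq> 0" "\<not> (A\<eta> = 0 \<and> B\<eta> = 0)"
    "J = 0 \<Longrightarrow> \<exists>K. K \<noteq> 0 \<and> det_Hess \<phi> p = K\<^sup>2 * (- 24 * D2 G 0 (axis 1 1) (axis 1 1) * D G 0 (axis 2 1))"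
proof -
  obtain \<Phi> \<theta> where P: "presented x p (fold_map G) \<Phi> \<theta>"
    using pr unfolding presents_def presented_def by blast
  have d: "D (fold_map G) 0 (axis 1 1) = axis 1 1" "D (fold_map G) 0 (axis 2 1) = 0"
    using fold_map_0_derivs(1)[OF G(1)] by (simp_all add: G vec_eq_iff forall_3)
  have C: "corank_one x p (fold_map G) \<Phi> \<theta>"
    using P d by (simp add: corank_one_def corank_one_axioms_def axis_eq_0_iff)
  note i = invariants[OF abc C]
  show J: "J \<noteq> 0 \<longleftrightarrow> D G 0 (axis 1 1) \<noteq> 0"
    unfolding i(1) d fold_map_0_derivs(2,3)[OF G(1)] by (simp add: det3_expand)
  show "\<not> (A\<eta> = 0 \<and> B\<eta> = 0)"
    unfolding i(2) d fold_map_0_derivs(3)[OF G(1)] by (simp add: vec_eq_iff forall_3)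
  assume "J = 0"
  then show "\<exists>K. K \<noteq> 0 \<and> det_Hess \<phi> p = K\<^sup>2 * (- 24 * D2 G 0 (axis 1 1) (axis 1 1) * D G 0 (axis 2 1))"
    using i(3) J det_Hess_fold_map[OF G] by simp
qed

text \<open>Each alternative in \<open>second\<close> excludes that the second derivative along the
  kernel vanishes modulo the image, so that \<open>presents_fold\<close> applies. The third
  alternative is what makes the criterion for the minus sign free of a second-order
  condition.\<close>

lemma fold_exists:
  assumes abc: "a p = 0" "b p = 0" "c p \<noteq> 0"
    and second: "\<not> (A\<eta> = 0 \<and> B\<eta> = 0) \<or> J \<noteq> 0 \<or> det_Hess \<phi> p > 0"
  obtains G where "smooth_at G 0" "G 0 = 0" "presents x p (fold_map G)"
proof -
  let ?F0 = "\<lambda>z. proj3 (x (z + p)) - proj3 (x p)"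
  have x0: "presents x p ?F0" by (rule presents_initial[OF smooth(1) H])
  have DF0: "D ?F0 0 v = proj3 (D x p v)" for v
  proof -
    have ps: "smooth_at proj3 z" for z by (rule smooth_at_bounded_linear[OF bounded_linear_proj3])
    have ts: "smooth_at (\<lambda>z. z + p) 0" by (intro sm)
    have xs: "smooth_at (\<lambda>z. x (z + p)) 0" by (rule smooth_at_compose[OF _ ts]) (use smooth in simp)
    have "D (\<lambda>z. x (z + p)) 0 v = D x (0 + p) (D (\<lambda>z. z + p) 0 v)"
      by (rule D_compose[OF _ ts]) (use smooth in simp)
    then have 1: "D (\<lambda>z. x (z + p)) 0 v = D x p v" by (simp add: D_add)
    have "D ?F0 0 v = D (\<lambda>z. proj3 (x (z + p))) 0 v"
      by (simp add: D_diff smooth_at_compose[OF ps xs])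
    also have "\<dots> = D proj3 (x (0 + p)) (D (\<lambda>z. x (z + p)) 0 v)" by (rule D_compose[OF ps xs])
    finally show ?thesis by (simp add: 1 D_linear[OF bounded_linear_proj3])
  qed
  have k: "D x p (\<eta> p) = 0" unfolding Dx_corank_one[OF abc(1,2)] by (simp add: \<eta>_def)
  have \<eta>0: "\<eta> p \<noteq> 0" using abc(3) by (auto simp: \<eta>_def vec_eq_iff forall_2)
  have cc: "c p $ 1 * c p $ 1 + c p $ 2 * c p $ 2 \<noteq> 0"
    using abc(3) by (simp add: vec_eq_iff forall_2 sum_squares_eq_zero_iff)
  have "D x p (c p) \<noteq> 0" unfolding Dx_corank_one[OF abc(1,2)] using cc frame(9) by simp
  then have c: "D ?F0 0 (c p) \<noteq> 0"
    unfolding DF0 using inj_proj3_tangent[OF eventually_nhds_x_imp_x[OF H] D_tangent_H3[OF smooth(1) H]] by blast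
  have k0: "D ?F0 0 (\<eta> p) = 0"
    unfolding DF0 k by (simp add: vec_eq_iff forall_3)
  obtain F where F: "presents x p F" "\<forall>\<^sub>F z in nhds 0. F z $ 1 = z $ 1" "D F 0 (axis 2 1) = 0"
    by (rule presents_rank_one[OF x0 k0 \<eta>0 c]) blast
  have Fs: "smooth_at F 0" using F(1) by (simp add: presents_def)
  have F1: "\<forall>\<^sub>F z in nhds 0. smooth_at F z \<and> (\<forall>v. D F z v $ 1 = v $ 1)"
    using smooth_at_eventually[OF Fs] ev_nhds2[OF F(2)]
  proof eventually_elim
    case (elim z)
    have "D F z v $ 1 = v $ 1" for v
      using D_nth[OF elim(1), of 1 v] D_cong_ev[OF elim(2)] by simp
    then show ?case using elim(1) by simp
  qed
  have F11: "\<forall>\<^sub>F z in nhds 0. \<forall>v w. D2 F z v w $ 1 = 0"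
    using ev_nhds2[OF F1] smooth_at_eventually[OF Fs]
  proof eventually_elim
    case (elim z)
    have "D2 F z v w $ 1 = 0" for v w
    proof -
      have "\<forall>\<^sub>F z in nhds z. D F z v $ 1 = v $ 1" using elim(1) by eventually_elim simp
      from D_cong_ev[OF this] show ?thesis
        using D_nth[OF smooth_at_D[OF elim(2)], of v 1 w] by simp
    qed
    then show ?case by blast
  qed
  have m1: "D F 0 (axis 1 1) $ 1 = 1" using eventually_nhds_x_imp_x[OF F1] by simp
  obtain \<Phi> \<theta> where P: "presented x p F \<Phi> \<theta>"
    using F(1) unfolding presents_def presented_def by blast
  have C: "corank_one x p F \<Phi> \<theta>"
    using P F(3) m1 by (auto simp: corank_one_def corank_one_axioms_def)
  note i = invariants[OF abc C]
  let ?f = "D2 F 0 (axis 2 1) (axis 2 1)"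
  \<comment> \<open>The first component of \<open>F\<close> is the first coordinate, so second
    derivatives have zero first component, and failure of the claim means
    \<open>?f = 0\<close>.\<close>
  have "?f $ 2 \<noteq> 0 \<or> ?f $ 3 \<noteq> 0"
  proof (rule ccontr)
    assume "\<not> (?f $ 2 \<noteq> 0 \<or> ?f $ 3 \<noteq> 0)"
    then have f0: "?f = 0" using eventually_nhds_x_imp_x[OF F11] by (simp add: vec_eq_iff forall_3)
    have "?f = 0 *\<^sub>R D F 0 (axis 1 1)" using f0 by simp
    then have AB: "A\<eta> = 0 \<and> B\<eta> = 0" using i(2) by blast
    have J0: "J = 0" using i(1) f0 by simp
    let ?N = "\<lambda>w. det3 (D F w (axis 1 1)) (D F w (axis 2 1)) (D2 F w (axis 2 1) (axis 2 1))"
    let ?v = "\<lambda>w j. D F w (axis 2 1) $ j" and ?vv = "\<lambda>w j. D2 F w (axis 2 1) (axis 2 1) $ j"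
    have "\<forall>\<^sub>F w in nhds 0. ?N w = ?v w 2 * ?vv w 3 - ?v w 3 * ?vv w 2"
      using F1 F11 by eventually_elim (simp add: det3_expand)
    note N = D2_cong_ev[OF this]
    have s: "smooth_at (\<lambda>w. ?v w j) 0" "smooth_at (\<lambda>w. ?vv w j) 0" for j
      using Fs by (auto intro!: sm smooth_at_D)
    have "D (\<lambda>w. ?v w j) 0 (axis 2 1) = 0" for j
      using D_nth[OF smooth_at_D[OF Fs]] f0 by simp
    \<comment> \<open>By the product rule each term contains a value or first derivative along the
      kernel of \<open>?v\<close>, or a value of \<open>?vv\<close>, and all of these are zero at
      the origin. A quadratic form with a vanishing diagonal entry has nonpositive
      determinant.\<close>
    then have "D2 ?N 0 (axis 2 1) (axis 2 1) = 0"
      unfolding N using F(3) f0 by (simp add: D2_diff D2_mult s sm)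
    then have "det_Hess ?N 0 \<le> 0" unfolding det_Hess_D2 by simp
    moreover obtain K where "det_Hess \<phi> p = K\<^sup>2 * det_Hess ?N 0" using i(3)[OF J0] by blast
    ultimately have "det_Hess \<phi> p \<le> 0" by (simp add: mult_nonneg_nonpos)
    then show False using second AB J0 by simp
  qed
  then obtain G where G: "smooth_at G 0" "presents x p (fold_map G)"
    using presents_fold[OF F] by blast
  \<comment> \<open>Otherwise the fold map would be an immersion at the origin, contradicting the
    kernel direction \<open>\<eta> p\<close>.\<close>
  have "G 0 = 0"
  proof (rule ccontr)
    assume G0: "G 0 \<noteq> 0"
    obtain \<Phi>' \<theta>' where "presented x p (fold_map G) \<Phi>' \<theta>'"
      using G(2) unfolding presents_def presented_def by blast
    then interpret Q: presented x p "fold_map G" \<Phi>' \<theta>' .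
    have "D (fold_map G) 0 (D \<theta>' p (\<eta> p)) = 0" using k Q.Dx_p Q.D_\<Phi>_0_iff by simp
    then have "D \<theta>' p (\<eta> p) = 0"
      using G0 unfolding fold_map_0_derivs(1)[OF G(1)] by (simp add: vec_eq_iff forall_2 forall_3)
    then show False using Q.D_\<theta>_0_iff \<eta>0 by simp
  qed
  then show ?thesis using that G by blast
qed

section \<open>The three criteria for presented germs\<close>

lemma cross_cap_iff:
  "presents x p cross_cap_map \<longleftrightarrow> a p = 0 \<and> b p = 0 \<and> c p \<noteq> 0 \<and> J \<noteq> 0"
proof
  let ?G = "\<lambda>z::real^2. z $ 1"
  assume pr: "presents x p cross_cap_map"
  then have pr: "presents x p (fold_map ?G)" by (simp add: fold_map_cross_cap)
  have G: "smooth_at ?G 0" "?G 0 = 0" by (intro sm) simp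
  have abc: "a p = 0 \<and> b p = 0 \<and> c p \<noteq> 0" by (rule fold_necessary[OF pr G]) simp
  then show "a p = 0 \<and> b p = 0 \<and> c p \<noteq> 0 \<and> J \<noteq> 0"
    using fold_invariants(1)[OF _ _ _ pr G] by simp
next
  assume abc: "a p = 0 \<and> b p = 0 \<and> c p \<noteq> 0 \<and> J \<noteq> 0"
  then obtain G where G: "smooth_at G 0" "G 0 = 0" "presents x p (fold_map G)"
    using fold_exists by blast
  then show "presents x p cross_cap_map"
    using presents_cross_cap fold_invariants(1)[OF _ _ _ G(3,1,2)] abc by blast
qed

text \<open>Both normal forms are treated at once through \<epsilon>. On the axis \<open>G\<close>
  is \<open>u\<^sup>2\<close>, which is nonzero off the origin; its second derivative
  \<open>2\<close> and the derivative \<epsilon> in the second argument turn \<open>- 24\<close>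
  into \<open>- 48 * \<epsilon>\<close>.\<close>

lemma S1_necessary:
  assumes pr: "presents x p (fold_map (\<lambda>z. (z $ 1)\<^sup>2 + \<epsilon> * z $ 2))"
  shows "a p = 0 \<and> b p = 0 \<and> c p \<noteq> 0" "J = 0" "\<not> (A\<eta> = 0 \<and> B\<eta> = 0)"
    "\<exists>K. K \<noteq> 0 \<and> det_Hess \<phi> p = K\<^sup>2 * (- 48 * \<epsilon>)"
proof -
  let ?G = "\<lambda>z::real^2. (z $ 1)\<^sup>2 + \<epsilon> * z $ 2"
  have G: "smooth_at ?G z" "?G 0 = 0" for z by (intro sm) simp
  have D: "D ?G z v = 2 * z $ 1 * v $ 1 + \<epsilon> * v $ 2" for z v
    by (simp add: D_add D_mult D_power2 sm)
  have D2: "D2 ?G 0 (axis 1 1) (axis 1 1) = 2" unfolding D by (simp add: D_mult sm)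
  show abc: "a p = 0 \<and> b p = 0 \<and> c p \<noteq> 0"
    by (rule fold_necessary[OF pr G]) simp
  then show J: "J = 0" using fold_invariants(1)[OF _ _ _ pr G] D by simp
  show "\<not> (A\<eta> = 0 \<and> B\<eta> = 0)" using abc fold_invariants(2)[OF _ _ _ pr G] by blast
  show "\<exists>K. K \<noteq> 0 \<and> det_Hess \<phi> p = K\<^sup>2 * (- 48 * \<epsilon>)"
    using fold_invariants(3)[OF _ _ _ pr G J] abc unfolding D2 D[of 0] by simp
qed

text \<open>A nonzero Hessian determinant makes both derivatives of \<open>G\<close> in
  \<open>presents_S1\<close> nonzero. The negative factor \<open>- 24\<close> reverses signs, so the
  plus form belongs to a negative determinant.\<close>

lemma S1_sufficient:
  assumes abc: "a p = 0" "b p = 0" "c p \<noteq> 0" "J = 0" "det_Hess \<phi> p \<noteq> 0"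
    and second: "\<not> (A\<eta> = 0 \<and> B\<eta> = 0) \<or> det_Hess \<phi> p > 0"
  shows "presents x p (if det_Hess \<phi> p < 0 then S1_plus_map else S1_minus_map)"
proof -
  obtain G where G: "smooth_at G 0" "G 0 = 0" "presents x p (fold_map G)"
    using fold_exists[OF abc(1-3)] second by blast
  note i = fold_invariants[OF abc(1-3) G(3,1,2)]
  have Gu: "D G 0 (axis 1 1) = 0" using i(1) abc(4) by simp
  obtain K where K: "K \<noteq> 0" "det_Hess \<phi> p = K\<^sup>2 * (- 24 * D2 G 0 (axis 1 1) (axis 1 1) * D G 0 (axis 2 1))"
    using i(3)[OF abc(4)] by blast
  then have nz: "D2 G 0 (axis 1 1) (axis 1 1) \<noteq> 0" "D G 0 (axis 2 1) \<noteq> 0" using abc(5) by auto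
  have "det_Hess \<phi> p < 0 \<longleftrightarrow> D2 G 0 (axis 1 1) (axis 1 1) * D G 0 (axis 2 1) > 0"
    unfolding K(2) using K(1) by (simp add: mult_less_0_iff zero_less_mult_iff)
  then show ?thesis using presents_S1[OF G(3,1,2) Gu nz] by simp
qed

lemma S1_plus_iff:
  "presents x p S1_plus_map \<longleftrightarrow> a p = 0 \<and> b p = 0 \<and> c p \<noteq> 0 \<and> J = 0 \<and> det_Hess \<phi> p < 0 \<and> (A\<eta>, B\<eta>) \<noteq> (0, 0)"
proof
  assume "presents x p S1_plus_map"
  then have pr: "presents x p (fold_map (\<lambda>z. (z $ 1)\<^sup>2 + 1 * z $ 2))" by (simp add: fold_map_S1)
  obtain K where "K \<noteq> 0" "det_Hess \<phi> p = K\<^sup>2 * (- 48 * 1)" using S1_necessary(4)[OF pr] by blast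
  then have "det_Hess \<phi> p < 0" by simp
  then show "a p = 0 \<and> b p = 0 \<and> c p \<noteq> 0 \<and> J = 0 \<and> det_Hess \<phi> p < 0 \<and> (A\<eta>, B\<eta>) \<noteq> (0, 0)"
    using S1_necessary(1-3)[OF pr] by simp
next
  assume "a p = 0 \<and> b p = 0 \<and> c p \<noteq> 0 \<and> J = 0 \<and> det_Hess \<phi> p < 0 \<and> (A\<eta>, B\<eta>) \<noteq> (0, 0)"
  then show "presents x p S1_plus_map" using S1_sufficient by auto
qed

lemma S1_minus_iff:
  "presents x p S1_minus_map \<longleftrightarrow> a p = 0 \<and> b p = 0 \<and> c p \<noteq> 0 \<and> J = 0 \<and> det_Hess \<phi> p > 0"
proof
  assume "presents x p S1_minus_map"
  then have pr: "presents x p (fold_map (\<lambda>z. (z $ 1)\<^sup>2 + (-1) * z $ 2))" by (simp add: fold_map_S1)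
  obtain K where "K \<noteq> 0" "det_Hess \<phi> p = K\<^sup>2 * (- 48 * (-1))" using S1_necessary(4)[OF pr] by blast
  then have "det_Hess \<phi> p > 0" by simp
  then show "a p = 0 \<and> b p = 0 \<and> c p \<noteq> 0 \<and> J = 0 \<and> det_Hess \<phi> p > 0"
    using S1_necessary(1-3)[OF pr] by simp
next
  assume "a p = 0 \<and> b p = 0 \<and> c p \<noteq> 0 \<and> J = 0 \<and> det_Hess \<phi> p > 0"
  then show "presents x p S1_minus_map" using S1_sufficient by auto
qed

end

section \<open>The criteria for framed surfaces\<close>

lemma along_eq_D: "smooth_at f q \<Longrightarrow> along \<zeta> f q = D f q (\<zeta> q)"
  using D_basis2[of f q "\<zeta> q"] by (simp add: along_def partial_def)

theorem proposition3p16: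
  fixes U :: "(real^2) set"
    and x \<nu>1 \<nu>2 :: "real^2 \<Rightarrow> real^4"
    and \<alpha> \<beta> :: "real^2 \<Rightarrow> real"
    and a b c e f g :: "real^2 \<Rightarrow> real^2"
    and \<xi> \<eta> :: "real^2 \<Rightarrow> real^2"
    and \<phi> :: "real^2 \<Rightarrow> real"
    and p :: "real^2"
  assumes "open U" and "simply_connected U"
    and "hyperbolic_generalized_framed_surface U x \<nu>1 \<nu>2"
    and "framing_coefficients U x \<nu>1 \<nu>2 \<alpha> \<beta>"
    and "basic_invariants U x \<nu>1 \<nu>2 a b c e f g"
    and "p \<in> U" and "\<alpha> p = 0" and "\<beta> p = 0"
  defines "\<xi> \<equiv> \<lambda>q. vector [c q $ 1, c q $ 2]"
    and "\<eta> \<equiv> \<lambda>q. vector [c q $ 2, - (c q $ 1)]"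
  defines "\<phi> \<equiv> \<lambda>q. det4 (x q) (along \<xi> x q) (along \<eta> x q) (along \<eta> (along \<eta> x) q)"
  shows
    "(cross_cap_point U x p \<longleftrightarrow>
        a p = 0 \<and> b p = 0 \<and> c p \<noteq> 0 \<and>
        det2 (partial 1 b p) (c p) * det2 (partial 2 a p) (c p)
          - det2 (partial 2 b p) (c p) * det2 (partial 1 a p) (c p) \<noteq> 0) \<and>
     (S1_plus_point U x p \<longleftrightarrow>
        a p = 0 \<and> b p = 0 \<and> c p \<noteq> 0 \<and>
        det2 (partial 1 b p) (c p) * det2 (partial 2 a p) (c p)
          - det2 (partial 2 b p) (c p) * det2 (partial 1 a p) (c p) = 0 \<and>
        det_Hess \<phi> p < 0 \<and>
        (- (c p $ 1) * det2 (partial 2 a p) (c p) + c p $ 2 * det2 (partial 1 a p) (c p),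
         c p $ 2 * det2 (partial 1 b p) (c p) - c p $ 1 * det2 (partial 2 b p) (c p)) \<noteq> (0, 0)) \<and>
     (S1_minus_point U x p \<longleftrightarrow>
        a p = 0 \<and> b p = 0 \<and> c p \<noteq> 0 \<and>
        det2 (partial 1 b p) (c p) * det2 (partial 2 a p) (c p)
          - det2 (partial 2 b p) (c p) * det2 (partial 1 a p) (c p) = 0 \<and>
        det_Hess \<phi> p > 0)"
proof -
  let ?\<nu>3 = "\<lambda>q. wedge (x q) (\<nu>1 q) (\<nu>2 q)"
  note U = \<open>open U\<close> and p = \<open>p \<in> U\<close>
  have evU: "\<forall>\<^sub>F q in nhds p. q \<in> U" using U p eventually_nhds by blast
  have frame: "x q \<in> H3" "(\<nu>1 q, \<nu>2 q) \<in> Delta5" "mink (x q) (\<nu>1 q) = 0" "mink (x q) (\<nu>2 q) = 0" if "q \<in> U" for q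
    using assms(3) that unfolding hyperbolic_generalized_framed_surface_def by blast+
  have s\<nu>: "smooth_at x q" "smooth_at \<nu>1 q" "smooth_at \<nu>2 q" if "q \<in> U" for q
    using assms(3) that smooth_on_iff_smooth_at[OF U] unfolding hyperbolic_generalized_framed_surface_def by blast+
  have bi: "smooth_on U a" "smooth_on U b" "smooth_on U c"
    "\<And>q i. q \<in> U \<Longrightarrow> partial i x q = a q $ i *\<^sub>R \<nu>1 q + b q $ i *\<^sub>R \<nu>2 q + c q $ i *\<^sub>R ?\<nu>3 q"
    using assms(5) unfolding basic_invariants_def Let_def by blast+
  have sa: "smooth_at a q" "smooth_at b q" "smooth_at c q" if "q \<in> U" for q
    using bi(1-3) that smooth_on_iff_smooth_at[OF U] by blast+
  interpret F: framed x \<nu>1 \<nu>2 ?\<nu>3 a b c p \<phi>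
  proof
    show "smooth_at x p" "smooth_at \<nu>1 p" "smooth_at \<nu>2 p" "smooth_at a p" "smooth_at b p" "smooth_at c p"
      using s\<nu> sa p by auto
    show "smooth_at ?\<nu>3 p" by (intro smooth_at_wedge s\<nu> p)
    show "\<forall>\<^sub>F z in nhds p. x z \<in> H3" using evU by eventually_elim (rule frame)
    show "mink (\<nu>1 p) (\<nu>1 p) = 1" "mink (\<nu>2 p) (\<nu>2 p) = 1" "mink (\<nu>1 p) (\<nu>2 p) = 0"
      using frame(2)[OF p] by (auto simp: Delta5_def S31_def)
    show "mink (x p) (\<nu>1 p) = 0" "mink (x p) (\<nu>2 p) = 0" using frame p by auto
    show "?\<nu>3 p \<noteq> 0" "mink (x p) (?\<nu>3 p) = 0" "mink (\<nu>1 p) (?\<nu>3 p) = 0" "mink (\<nu>2 p) (?\<nu>3 p) = 0"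
      using frame_complement[OF frame[OF p]] by auto
    show "\<forall>\<^sub>F z in nhds p. \<forall>i. D x z (axis i 1) = a z $ i *\<^sub>R \<nu>1 z + b z $ i *\<^sub>R \<nu>2 z + c z $ i *\<^sub>R ?\<nu>3 z"
      using evU by eventually_elim (simp add: bi(4)[unfolded partial_def])
    \<comment> \<open>The framing equation puts the wedge of \<open>x\<close> with its partial
      derivatives into the span of \<nu>1 and \<nu>2, which is orthogonal to \<nu>3.\<close>
    show "\<forall>\<^sub>F z in nhds p. det4 (x z) (?\<nu>3 z) (D x z (axis 1 1)) (D x z (axis 2 1)) = 0"
      using evU
    proof eventually_elim
      case (elim z)
      interpret m: bounded_bilinear mink by (rule bounded_bilinear_mink)
      have "wedge (x z) (D x z (axis 1 1)) (D x z (axis 2 1)) = \<alpha> z *\<^sub>R \<nu>1 z + \<beta> z *\<^sub>R \<nu>2 z"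
        using assms(4) elim unfolding framing_coefficients_def partial_def by blast
      then have "det4 (?\<nu>3 z) (x z) (D x z (axis 1 1)) (D x z (axis 2 1)) = mink (?\<nu>3 z) (\<alpha> z *\<^sub>R \<nu>1 z + \<beta> z *\<^sub>R \<nu>2 z)"
        by (metis mink_wedge)
      also have "\<dots> = 0"
        using frame_complement(3,4)[OF frame[OF elim]] by (simp add: m.add_right m.scaleR_right mink_commute[of "?\<nu>3 z"])
      finally show ?case using det4_swap1[of "x z" "?\<nu>3 z"] by simp
    qed
    have al: "along \<eta> x q = D x q (\<eta> q)" "along \<xi> x q = D x q (c q)" if "q \<in> U" for q
      using along_eq_D[OF s\<nu>(1)[OF that]] by (simp_all add: \<xi>_def)
    show "\<forall>\<^sub>F z in nhds p. \<phi> z = det4 (x z) (D x z (c z)) (D x z (vector [c z $ 2, - (c z $ 1)]))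
      (D (\<lambda>z. D x z (vector [c z $ 2, - (c z $ 1)])) z (vector [c z $ 2, - (c z $ 1)]))"
      using evU
    proof eventually_elim
      case (elim q)
      have "\<forall>\<^sub>F z in nhds q. z \<in> U" using U elim eventually_nhds by blast
      \<comment> \<open>The outer \<open>along\<close> differentiates the function
        \<open>along \<eta> x\<close>, so the identity is required near \<open>q\<close> and not
        just at \<open>q\<close>.\<close>
      then have ev: "\<forall>\<^sub>F z in nhds q. D x z (\<eta> z) = along \<eta> x z" by eventually_elim (simp add: al)
      have "smooth_at (\<lambda>z. D x z (\<eta> z)) q"
        unfolding \<eta>_def by (intro smooth_at_D_dir sm s\<nu> sa elim)
      then have "smooth_at (along \<eta> x) q" using ev by (rule smooth_at_cong_ev)
      then have "along \<eta> (along \<eta> x) q = D (along \<eta> x) q (\<eta> q)" by (rule along_eq_D)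
      also have "\<dots> = D (\<lambda>z. D x z (\<eta> z)) q (\<eta> q)" using D_cong_ev[OF ev] by simp
      finally show ?case by (simp add: \<phi>_def al elim) (simp add: \<eta>_def)
    qed
  qed
  have eqv: "A_equivalent U H3 x p UNIV UNIV h 0 \<longleftrightarrow> presents x p h" if "smooth_at h 0" "h 0 = 0" for h
    by (rule iffI[OF A_equivalent_imp_presents[OF U p that] presents_imp_A_equivalent[where x=x, OF U p frame(1)]])
  have "cross_cap_point U x p \<longleftrightarrow> presents x p cross_cap_map"
    "S1_plus_point U x p \<longleftrightarrow> presents x p S1_plus_map"
    "S1_minus_point U x p \<longleftrightarrow> presents x p S1_minus_map"
    unfolding cross_cap_point_def S1_plus_point_def S1_minus_point_def
    by (intro eqv smooth_cross_cap smooth_S1; simp add: cross_cap_map_def S1_plus_map_def S1_minus_map_def)+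
  then show ?thesis
    unfolding F.cross_cap_iff F.S1_plus_iff F.S1_minus_iff F.J_def F.A\<eta>_def F.B\<eta>_def F.A_def F.B_def partial_def
    by blast
qed

end
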